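(* Let $p_1\equiv p_2\equiv1\pmod4$ be primes and $\mathbb{K}=\mathbb{Q}(\sqrt{p_1},\sqrt{2p_2},i)$, with maximal real subfield $\mathbb{K}^+=\mathbb{Q}(\sqrt{p_1},\sqrt{2p_2})$. Let $\varepsilon_1,\varepsilon_2,\varepsilon_3$ be the fundamental units of $\mathbb{Q}(\sqrt{p_1})$, $\mathbb{Q}(\sqrt{2p_2})$, $\mathbb{Q}(\sqrt{2p_1p_2})$ respectively, and write $\varepsilon_3=x+y\sqrt{2p_1p_2}$ with $x,y\in\mathbb{Z}$. Then: (1) If $N(\varepsilon_2)=N(\varepsilon_3)=-1$: (i) if $\varepsilon_1\varepsilon_2\varepsilon_3$ is a square in $\mathbb{K}^+$, then $\{\varepsilon_1,\varepsilon_2,\sqrt{\varepsilon_1\varepsilon_2\varepsilon_3}\}$ is an F.S.U. of both $\mathbb{K}^+$ and $\mathbb{K}$, and $Q_{\mathbb{K}}=1$; (ii) otherwise $\{\varepsilon_1,\varepsilon_2,\varepsilon_3\}$ is an F.S.U. of $\mathbb{K}^+$, $\{\varepsilon_1,\varepsilon_2,\sqrt{i\varepsilon_1\varepsilon_2\varepsilon_3}\}$ is an F.S.U. of $\mathbb{K}$, and $Q_{\mathbb{K}}=2$. (2) If $N(\varepsilon_2)=1$ and $N(\varepsilon_3)=-1$: $\{\varepsilon_1,\varepsilon_2,\varepsilon_3\}$ is an F.S.U. of $\mathbb{K}^+$, $\{\varepsilon_1,\sqrt{i\varepsilon_2},\varepsilon_3\}$ is an F.S.U. of $\mathbb{K}$,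 and $Q_{\mathbb{K}}=2$. (3) If $N(\varepsilon_3)=1$ and $N(\varepsilon_2)=-1$: (i) if $2p_1(x+1)$ or $2p_1(x-1)$ is a perfect square in $\mathbb{N}$, then $\{\varepsilon_1,\varepsilon_2,\sqrt{\varepsilon_3}\}$ is an F.S.U. of both $\mathbb{K}^+$ and $\mathbb{K}$, and $Q_{\mathbb{K}}=1$; (ii) otherwise $\{\varepsilon_1,\varepsilon_2,\varepsilon_3\}$ is an F.S.U. of $\mathbb{K}^+$, $\{\varepsilon_1,\varepsilon_2,\sqrt{i\varepsilon_3}\}$ is an F.S.U. of $\mathbb{K}$, and $Q_{\mathbb{K}}=2$. (4) If $N(\varepsilon_2)=N(\varepsilon_3)=1$: (i) if $2p_1(x+1)$ or $2p_1(x-1)$ is a perfect square in $\mathbb{N}$, then $\{\varepsilon_1,\varepsilon_2,\sqrt{\varepsilon_3}\}$ is an F.S.U. of $\mathbb{K}^+$, $\{\varepsilon_1,\sqrt{i\varepsilon_2},\sqrt{\varepsilon_3}\}$ is an F.S.U. of $\mathbb{K}$, and $Q_{\mathbb{K}}=2$; (ii) otherwise $\{\varepsilon_1,\varepsilon_2,\sqrt{\varepsilon_2\varepsilon_3}\}$ is an F.S.U. of $\mathbb{K}^+$, $\{\varepsilon_1,\sqrt{\varepsilon_2\varepsilon_3},\sqrt{i\varepsilon_3}\}$ is an F.S.U. of $\mathbb{K}$, and $Q_{\mathbb{K}}=2$.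
   Context: $i=\sqrt{-1}$; $N(\cdot)$ is the absolute norm (here the norm from the relevant real quadratic field to $\mathbb{Q}$). An F.S.U. (fundamental system of units) of a number field $L$ is a set of units whose images form a basis of the free abelian group $E_L/W_L$, where $E_L$ is the unit group of $\mathcal{O}_L$ and $W_L$ the group of roots of unity in $L$. For a CM-field $L$ with maximal real subfield $L^+$, Hasse's unit index is $Q_L=[E_L:W_LE_{L^+}]$. The square roots appearing are elements of the field in question (for appropriate choices of sign). *)

theory Defs
  imports "HOL-Computational_Algebra.Polynomial" Complex_Main
begin

text \<open>All number fields are realised as subfields of the complex numbers.\<close>

definition subfield_C :: "complex set \<Rightarrow> bool" where
  "subfield_C F \<longleftrightarrow> 0 \<in> F \<and> 1 \<in> F \<and>
     (\<forall>x\<in>F. \<forall>y\<in>F. x + y \<in> F \<and> x * y \<in> F) \<and>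
     (\<forall>x\<in>F. - x \<in> F \<and> inverse x \<in> F)"

definition field_gen :: "complex set \<Rightarrow> complex set" where
  "field_gen S = \<Inter>{F. subfield_C F \<and> S \<subseteq> F}"

definition ints_of :: "complex set \<Rightarrow> complex set" where
  "ints_of L = {x \<in> L. algebraic_int x}"

definition units_of_field :: "complex set \<Rightarrow> complex set" where
  "units_of_field L = {x \<in> ints_of L. x \<noteq> 0 \<and> inverse x \<in> ints_of L}"

definition roots_of_unity :: "complex set \<Rightarrow> complex set" where
  "roots_of_unity L = {x \<in> L. \<exists>n::nat. n > 0 \<and> x ^ n = 1}"

text \<open>F.S.U.: the images of the listed units form a basis of the free abelian group E_L/W_L,
  i.e. every unit is, modulo roots of unity, a unique product of integer powers of them.\<close>
definition FSU :: "complex set \<Rightarrow> complex list \<Rightarrow> bool" where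
  "FSU L us \<longleftrightarrow> set us \<subseteq> units_of_field L \<and>
     (\<forall>e \<in> units_of_field L. \<exists>!a::int list. length a = length us \<and>
        e / (\<Prod>j<length us. (us ! j) powi (a ! j)) \<in> roots_of_unity L)"

definition hasse_unit_index :: "complex set \<Rightarrow> complex set \<Rightarrow> nat" where
  "hasse_unit_index L Lp =
     card ((\<lambda>e. (\<lambda>h. e * h) ` {w * u | w u. w \<in> roots_of_unity L \<and> u \<in> units_of_field Lp})
            ` units_of_field L)"

definition quad_field :: "int \<Rightarrow> complex set" where
  "quad_field d = field_gen {complex_of_real (sqrt (real_of_int d))}"

definition fund_unit :: "int \<Rightarrow> real \<Rightarrow> bool" where
  "fund_unit d \<epsilon> \<longleftrightarrow> complex_of_real \<epsilon> \<in> units_of_field (quad_field d) \<and> \<epsilon> > 1 \<and>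
     (\<forall>u::real. complex_of_real u \<in> units_of_field (quad_field d) \<and> u > 1 \<longrightarrow> \<epsilon> \<le> u)"

definition quad_norm :: "int \<Rightarrow> real \<Rightarrow> rat" where
  "quad_norm d \<epsilon> = (THE n. \<exists>a b :: rat.
      \<epsilon> = of_rat a + of_rat b * sqrt (real_of_int d) \<and> n = a^2 - of_int d * b^2)"

end

theory Submission
  imports Defs "Jordan_Normal_Form.Char_Poly" "HOL-Computational_Algebra.Squarefree"
begin

text \<open>Write E1, E2, E3 for the fundamental units and Kp for the real biquadratic field.
  Relative norms show that the square of a unit of Kp is a monomial in E1, E2, E3 up to sign, and
  that a unit e of K either lies in W times the units of Kp or satisfies: the square of e is
  imaginary and twice its absolute square is a square in Kp. Hence everything is governed by the
  monomials M such that M or 2M is a square in Kp. Signs of relative norms restrict the exponents.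
  If w^2 = c M with w in Kp and c a positive rational number, then the square class of c contains
  only primes ramified in Kp, so M or 2M is a square; suitable w are Ei + 1 for units of norm 1 and
  E1 E2 E3 - E1 - E2 - E3 for norms -1. Bases are recognised through ln of the absolute value,
  which is injective modulo roots of unity because a unit of K of absolute value 1 is a root
  of unity.\<close>

text \<open>The factor 2 comes from (1 + i)^2 = 2i: if 2M is a square in Kp, then iM is a square in
  K. Since p1 and 2 p2 are squares in Kp, every divisor of 2 p1 p2 has there the square class of 1
  or of 2, and 2 itself is no square. So M and 2M are never squares together, and this exclusion
  separates the index 1 from the index 2. Parity of exponents only limits which monomials can occur;
  that one of M and 2M really is a square needs an explicit w, and this existence question is the
  harder half. The sign argument in turn needs the norm of E1, which no hypothesis supplies: it is
  -1 because p1 is 1 modulo 4. Finally, the theorem does not assume p1 and p2 to be distinct. If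
  they coincide, Q(sqrt(2 p1 p2)) is Q(sqrt 2), and the integrality of x and y contradicts the size
  of its fundamental unit 1 + sqrt 2, so that only distinct primes remain.\<close>

section \<open>Algebraic integers are closed under sums and products\<close>

text \<open>\<open>x\<close> is an eigenvalue of an integer matrix, and the characteristic
  polynomial of such a matrix is monic with integer coefficients. The condition \<open>nz\<close>
  makes \<open>v\<close> a genuine eigenvector.\<close>

lemma algebraic_int_eigen:
  fixes v :: "nat \<Rightarrow> complex" and M :: "nat \<Rightarrow> nat \<Rightarrow> int"
  assumes ev: "\<And>i. i < n \<Longrightarrow> x * v i = (\<Sum>j<n. of_int (M i j) * v j)"
    and nz: "i < n" "v i \<noteq> 0"
  shows "algebraic_int x"
proof -
  define B where "B = mat n n (\<lambda>(i, j). M i j)"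
  define A :: "complex mat" where "A = map_mat of_int B"
  define w where "w = vec n v"
  have B: "B \<in> carrier_mat n n" and A: "A \<in> carrier_mat n n"
    by (auto simp: A_def B_def)
  have "A *\<^sub>v w = x \<cdot>\<^sub>v w"
    by (rule eq_vecI) (auto simp: A_def B_def w_def scalar_prod_def ev lessThan_atLeast0)
  moreover have "w \<noteq> 0\<^sub>v n"
    using nz by (metis index_vec index_zero_vec(1) w_def)
  ultimately have "eigenvalue A x"
    using A unfolding eigenvalue_def eigenvector_def by (intro exI[of _ w]) (auto simp: w_def)
  hence root: "poly (char_poly A) x = 0"
    using eigenvalue_root_char_poly[OF A] by simp
  have "char_poly A = map_poly of_int (char_poly B)"
    unfolding A_def by (rule of_int_hom.char_poly_hom[OF B])
  moreover have "lead_coeff (char_poly B) = 1"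
    using degree_monic_char_poly[OF B] by auto
  ultimately show ?thesis
    using root by (auto simp: algebraic_int_altdef_ipoly)
qed

definition zspan :: "nat \<Rightarrow> (nat \<Rightarrow> complex) \<Rightarrow> complex set" where
  "zspan n v = {(\<Sum>j<n. of_int (c j) * v j) | c :: nat \<Rightarrow> int. True}"

lemma zspanI: "x = (\<Sum>j<n. of_int (c j) * v j) \<Longrightarrow> x \<in> zspan n v"
  by (auto simp: zspan_def)

lemma zspan_base:
  assumes "i < n" shows "v i \<in> zspan n v"
proof (rule zspanI)
  show "v i = (\<Sum>j<n. of_int (if j = i then 1 else 0) * v j)"
    using assms by (subst sum.remove[of _ i]) (auto intro: sum.neutral)
qed

lemma zspan_add:
  assumes "x \<in> zspan n v" "y \<in> zspan n v" shows "x + y \<in> zspan n v"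
proof -
  obtain c d :: "nat \<Rightarrow> int" where "x = (\<Sum>j<n. of_int (c j) * v j)" "y = (\<Sum>j<n. of_int (d j) * v j)"
    using assms by (auto simp: zspan_def)
  thus ?thesis
    by (intro zspanI[where c = "\<lambda>j. c j + d j"]) (simp add: sum.distrib ring_distribs)
qed

lemma zspan_scale:
  assumes "x \<in> zspan n v" shows "of_int k * x \<in> zspan n v"
proof -
  obtain c :: "nat \<Rightarrow> int" where "x = (\<Sum>j<n. of_int (c j) * v j)"
    using assms by (auto simp: zspan_def)
  thus ?thesis
    by (intro zspanI[where c = "\<lambda>j. k * c j"]) (simp add: sum_distrib_left mult.assoc)
qed

lemma zspan_0: "0 \<in> zspan n v"
  by (rule zspanI[where c = "\<lambda>_. 0"]) simp

lemma zspan_sum: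
  "(\<And>i. i \<in> I \<Longrightarrow> f i \<in> zspan n v) \<Longrightarrow> sum f I \<in> zspan n v"
  by (induction I rule: infinite_finite_induct) (auto intro: zspan_0 zspan_add)

text \<open>Multiplication by \<open>x\<close> acts on the spanned module through an integer matrix.
  The generators may be linearly dependent; an eigenvector only has to be nonzero.\<close>

lemma algebraic_int_stable_span:
  assumes st: "\<And>i. i < n \<Longrightarrow> x * v i \<in> zspan n v" and nz: "i < n" "v i \<noteq> 0"
  shows "algebraic_int x"
proof -
  have "\<forall>i. \<exists>c :: nat \<Rightarrow> int. i < n \<longrightarrow> x * v i = (\<Sum>j<n. of_int (c j) * v j)"
    using st unfolding zspan_def by blast
  then obtain M :: "nat \<Rightarrow> nat \<Rightarrow> int"
    where M: "\<And>i. i < n \<Longrightarrow> x * v i = (\<Sum>j<n. of_int (M i j) * v j)" by metis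
  show ?thesis by (rule algebraic_int_eigen[OF M nz]) auto
qed

lemma algebraic_int_power_reduce:
  fixes x :: complex
  assumes "algebraic_int x"
  obtains m and c :: "nat \<Rightarrow> int" where "m > 0" "x ^ m = (\<Sum>i<m. of_int (c i) * x ^ i)"
proof -
  obtain p :: "int poly" where p: "lead_coeff p = 1" "poly (map_poly of_int p) x = 0"
    using assms by (auto simp: algebraic_int_altdef_ipoly)
  have deg: "degree (map_poly (of_int :: int \<Rightarrow> complex) p) = degree p"
    by (rule degree_map_poly) auto
  have z: "0 = (\<Sum>i\<le>degree p. of_int (coeff p i) * x ^ i)"
    using p(2) by (simp add: poly_altdef deg coeff_map_poly)
  \<comment> \<open>A monic polynomial of degree 0 is 1 and has no root, so the reduction is never
    the empty one with \<open>m = 0\<close>.\<close>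
  have pos: "degree p > 0"
  proof (rule ccontr)
    assume "\<not> ?thesis"
    with z p(1) show False by simp
  qed
  have "0 = (\<Sum>i<degree p. of_int (coeff p i) * x ^ i) + x ^ degree p"
    using z p(1) by (simp add: lessThan_Suc_atMost[symmetric])
  hence "x ^ degree p = (\<Sum>i<degree p. of_int (- coeff p i) * x ^ i)"
    by (simp add: sum_negf eq_neg_iff_add_eq_0 add.commute)
  with pos show ?thesis by (rule that)
qed

text \<open>The monomials \<open>x ^ a * y ^ b\<close> with \<open>a < m\<close> and
  \<open>b < n\<close> span a module that is stable under both \<open>x\<close> and
  \<open>y\<close>, hence under their sum and product.\<close>

lemma algebraic_int_add_mult:
  fixes x y :: complex
  assumes "algebraic_int x" "algebraic_int y"
  shows "algebraic_int (x + y) \<and> algebraic_int (x * y)"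
proof -
  obtain m c where m: "m > 0" "x ^ m = (\<Sum>i<m. of_int (c i) * x ^ i)"
    using algebraic_int_power_reduce[OF assms(1)] .
  obtain n d where n: "n > 0" "y ^ n = (\<Sum>i<n. of_int (d i) * y ^ i)"
    using algebraic_int_power_reduce[OF assms(2)] .
  \<comment> \<open>The index \<open>k < m * n\<close> encodes the pair of exponents in base
    \<open>n\<close>.\<close>
  define v where "v k = x ^ (k div n) * y ^ (k mod n)" for k
  \<comment> \<open>All exponents have to be covered, since multiplying a generator by
    \<open>x\<close> or \<open>y\<close> may leave the box. A relation replaces a high power by
    monomials of smaller total degree, hence the induction on \<open>a + b\<close>.\<close>
  have mono: "x ^ a * y ^ b \<in> zspan (m * n) v" for a b
  proof (induction "a + b" arbitrary: a b rule: less_induct)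
    case less
    consider "a < m" "b < n" | "a \<ge> m" | "b \<ge> n" by linarith
    thus ?case
    proof cases
      case 1
      have "a * n + b < m * n"
        using 1 by (metis add.commute div_less_iff_less_mult div_mult_self3 div_less add_0_right gr_implies_not0 not_gr_zero)
      from zspan_base[OF this, of v] show ?thesis using 1 by (simp add: v_def)
    next
      case 2
      have "x ^ a = x ^ m * x ^ (a - m)" using 2 by (simp flip: power_add)
      also have "\<dots> = (\<Sum>i<m. of_int (c i) * x ^ (i + (a - m)))"
        unfolding m(2) by (simp add: sum_distrib_right power_add mult.assoc)
      finally have "x ^ a * y ^ b = (\<Sum>i<m. of_int (c i) * (x ^ (i + (a - m)) * y ^ b))"
        by (simp add: sum_distrib_right mult.assoc)
      also have "\<dots> \<in> zspan (m * n) v"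
        using 2 by (intro zspan_sum zspan_scale less) auto
      finally show ?thesis .
    next
      case 3
      have "y ^ b = y ^ n * y ^ (b - n)" using 3 by (simp flip: power_add)
      also have "\<dots> = (\<Sum>i<n. of_int (d i) * y ^ (i + (b - n)))"
        unfolding n(2) by (simp add: sum_distrib_right power_add mult.assoc)
      finally have "x ^ a * y ^ b = (\<Sum>i<n. of_int (d i) * (x ^ a * y ^ (i + (b - n))))"
        by (simp add: sum_distrib_left mult.assoc mult.left_commute)
      also have "\<dots> \<in> zspan (m * n) v"
        using 3 by (intro zspan_sum zspan_scale less) auto
      finally show ?thesis .
    qed
  qed
  have nz: "0 < m * n" "v 0 \<noteq> 0" using m n by (auto simp: v_def)
  have "(x + y) * v k \<in> zspan (m * n) v" for k
    using zspan_add[OF mono[of "Suc (k div n)" "k mod n"] mono[of "k div n" "Suc (k mod n)"]]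
    by (simp add: v_def algebra_simps)
  moreover have "(x * y) * v k \<in> zspan (m * n) v" for k
    using mono[of "Suc (k div n)" "Suc (k mod n)"] by (simp add: v_def algebra_simps)
  ultimately show ?thesis
    using algebraic_int_stable_span nz by blast
qed

lemma algebraic_int_add: "algebraic_int x \<Longrightarrow> algebraic_int y \<Longrightarrow> algebraic_int (x + y :: complex)"
  and algebraic_int_mult: "algebraic_int x \<Longrightarrow> algebraic_int y \<Longrightarrow> algebraic_int (x * y :: complex)"
  using algebraic_int_add_mult by blast+

lemma algebraic_int_diff: "algebraic_int x \<Longrightarrow> algebraic_int y \<Longrightarrow> algebraic_int (x - y :: complex)"
  using algebraic_int_add[of x "- y"] by simp

lemma algebraic_int_1 [simp]: "algebraic_int (1 :: complex)"
  and algebraic_int_of_int [simp]: "algebraic_int (of_int k :: complex)"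
  and algebraic_int_of_nat [simp]: "algebraic_int (of_nat n :: complex)"
  and algebraic_int_numeral [simp]: "algebraic_int (numeral m :: complex)"
  by (auto intro: int_imp_algebraic_int)

lemma algebraic_int_power: "algebraic_int x \<Longrightarrow> algebraic_int (x ^ n :: complex)"
  by (induction n) (auto intro: algebraic_int_mult)

text \<open>The monic polynomial X^2 takes an integral value at \<open>x\<close>. Integrality of
  units and of conjugate quotients is tested on squares in this way.\<close>

lemma algebraic_int_sqrtD:
  assumes "algebraic_int (x ^ 2 :: complex)" shows "algebraic_int x"
  by (rule algebraic_int_root[OF assms, of "monom 1 2"]) (auto simp: poly_monom degree_monom_eq)

section \<open>Subfields of the complex numbers and their automorphisms\<close>

lemma subfield_CD:
  assumes "subfield_C F"
  shows subfield_C_0: "0 \<in> F" and subfield_C_1: "1 \<in> F"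
    and subfield_C_add: "\<And>x y. x \<in> F \<Longrightarrow> y \<in> F \<Longrightarrow> x + y \<in> F"
    and subfield_C_mult: "\<And>x y. x \<in> F \<Longrightarrow> y \<in> F \<Longrightarrow> x * y \<in> F"
    and subfield_C_minus: "\<And>x. x \<in> F \<Longrightarrow> - x \<in> F"
    and subfield_C_inverse: "\<And>x. x \<in> F \<Longrightarrow> inverse x \<in> F"
  using assms by (auto simp: subfield_C_def)

lemma subfield_C_diff: "subfield_C F \<Longrightarrow> x \<in> F \<Longrightarrow> y \<in> F \<Longrightarrow> x - y \<in> F"
  using subfield_CD(3)[of F x "- y"] subfield_CD(5)[of F y] by simp

lemma subfield_C_divide: "subfield_C F \<Longrightarrow> x \<in> F \<Longrightarrow> y \<in> F \<Longrightarrow> x / y \<in> F"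
  using subfield_CD(4)[of F x "inverse y"] subfield_CD(6)[of F y] by (simp add: field_simps)

lemma subfield_C_power: "subfield_C F \<Longrightarrow> x \<in> F \<Longrightarrow> x ^ n \<in> F"
  by (induction n) (auto intro: subfield_CD)

lemma subfield_C_powi: "subfield_C F \<Longrightarrow> x \<in> F \<Longrightarrow> x powi n \<in> F"
  by (auto simp: power_int_def intro: subfield_CD subfield_C_power)

lemma subfield_C_of_nat: "subfield_C F \<Longrightarrow> of_nat n \<in> F"
  by (induction n) (auto intro: subfield_CD)

lemma subfield_C_of_int: "subfield_C F \<Longrightarrow> of_int n \<in> F"
  by (cases n rule: int_cases2) (auto intro: subfield_C_of_nat subfield_CD)

lemma subfield_C_numeral: "subfield_C F \<Longrightarrow> numeral m \<in> F"
  using subfield_C_of_nat[of F "numeral m"] by simp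

lemma subfield_C_Rats:
  assumes "subfield_C F" shows "\<rat> \<subseteq> F"
proof
  fix x :: complex assume "x \<in> \<rat>"
  then obtain a b where "x = of_int a / of_int b" by (auto elim: Rats_cases')
  thus "x \<in> F" using assms by (auto intro: subfield_C_divide subfield_C_of_int)
qed

lemma subfield_C_Rats_complex: "subfield_C \<rat>"
  by (auto simp: subfield_C_def)

lemmas subfield_C_closed = subfield_CD subfield_C_diff subfield_C_divide subfield_C_power
  subfield_C_powi subfield_C_of_nat subfield_C_of_int subfield_C_numeral

section \<open>Quadratic extensions in explicit coordinates\<close>

text \<open>For \<open>t\<close> outside \<open>L\<close> with its square in \<open>L\<close> this
  is the field L(t). Keeping the two coordinates explicit lets conjugation and fixed fields be
  computed by comparing them.\<close>

definition adj :: "complex set \<Rightarrow> complex \<Rightarrow> complex set" where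
  "adj L t = {a + b * t | a b. a \<in> L \<and> b \<in> L}"

lemma adjI: "a \<in> L \<Longrightarrow> b \<in> L \<Longrightarrow> a + b * t \<in> adj L t"
  by (auto simp: adj_def)

lemma adjE:
  assumes "x \<in> adj L t" obtains a b where "a \<in> L" "b \<in> L" "x = a + b * t"
  using assms by (auto simp: adj_def)

lemma adj_coords_unique:
  assumes L: "subfield_C L" and t: "t \<notin> L"
    and "a \<in> L" "b \<in> L" "c \<in> L" "d \<in> L" "a + b * t = c + d * t"
  shows "a = c \<and> b = d"
proof -
  have "b = d"
  proof (rule ccontr)
    assume "b \<noteq> d"
    hence "t = (c - a) / (b - d)" using assms(7) by (simp add: field_simps)
    also have "\<dots> \<in> L" using assms by (auto intro!: subfield_C_closed)
    finally show False using t by simp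
  qed
  thus ?thesis using assms by simp
qed

lemma subset_adj: "subfield_C L \<Longrightarrow> L \<subseteq> adj L t"
  using adjI[of _ L 0 t] by (auto dest: subfield_C_0)

lemma gen_in_adj: "subfield_C L \<Longrightarrow> t \<in> adj L t"
  using adjI[of 0 L 1 t] by (auto dest: subfield_C_0 subfield_C_1)

lemma subfield_adj:
  assumes L: "subfield_C L" and t: "t \<notin> L" and t2: "t\<^sup>2 \<in> L"
  shows "subfield_C (adj L t)"
  unfolding subfield_C_def
proof (intro conjI ballI)
  show "0 \<in> adj L t" "1 \<in> adj L t"
    using subset_adj[OF L] subfield_C_0[OF L] subfield_C_1[OF L] by auto
next
  fix x y assume "x \<in> adj L t" "y \<in> adj L t"
  then obtain a b c d where ab: "a \<in> L" "b \<in> L" "c \<in> L" "d \<in> L" and x: "x = a + b * t" and y: "y = c + d * t"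
    by (auto elim!: adjE)
  have "x + y = (a + c) + (b + d) * t" by (simp add: x y algebra_simps)
  thus "x + y \<in> adj L t" using ab L by (auto intro!: adjI subfield_C_closed)
  have "x * y = (a * c + b * d * t\<^sup>2) + (a * d + b * c) * t"
    by (simp add: x y algebra_simps power2_eq_square)
  thus "x * y \<in> adj L t" using ab L t2 by (auto intro!: adjI subfield_C_closed)
next
  fix x assume "x \<in> adj L t"
  then obtain a b where ab: "a \<in> L" "b \<in> L" and x: "x = a + b * t"
    by (auto elim!: adjE)
  have "- x = - a + (- b) * t" by (simp add: x)
  thus "- x \<in> adj L t" using ab L adjI subfield_C_minus by metis
  show "inverse x \<in> adj L t"
  proof (cases "x = 0")
    case True
    thus ?thesis using subset_adj[OF L] subfield_C_0[OF L] by auto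
  next
    case False
    \<comment> \<open>The conjugate of a nonzero element is nonzero, since otherwise both
      coordinates of \<open>x\<close> would vanish by uniqueness; so the denominator can be
      rationalised.\<close>
    have "a - b * t \<noteq> 0"
    proof
      assume "a - b * t = 0"
      hence "a + (- b) * t = 0 + 0 * t" by simp
      moreover have "- b \<in> L" "0 \<in> L" using ab L by (auto intro: subfield_C_closed)
      ultimately have "a = 0 \<and> - b = 0"
        using adj_coords_unique[OF L t ab(1) _ _ _, of "- b" 0 0] by blast
      with False show False by (simp add: x)
    qed
    hence "inverse x = (a - b * t) / (x * (a - b * t))" by (simp add: inverse_eq_divide)
    also have "x * (a - b * t) = a\<^sup>2 - b\<^sup>2 * t\<^sup>2" by (simp add: x algebra_simps power2_eq_square)
    finally have "inverse x = a / (a\<^sup>2 - b\<^sup>2 * t\<^sup>2) + (- b / (a\<^sup>2 - b\<^sup>2 * t\<^sup>2)) * t"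
      by (simp add: diff_divide_distrib)
    moreover have "a\<^sup>2 - b\<^sup>2 * t\<^sup>2 \<in> L" using ab L t2 by (simp add: subfield_C_diff subfield_C_mult subfield_C_power)
    hence "a / (a\<^sup>2 - b\<^sup>2 * t\<^sup>2) \<in> L" "- b / (a\<^sup>2 - b\<^sup>2 * t\<^sup>2) \<in> L"
      using subfield_C_divide[OF L ab(1)] subfield_C_divide[OF L subfield_C_minus[OF L ab(2)]] by blast+
    ultimately show ?thesis using adjI by metis
  qed
qed

lemma adj_subset: "subfield_C F \<Longrightarrow> L \<subseteq> F \<Longrightarrow> t \<in> F \<Longrightarrow> adj L t \<subseteq> F"
  by (auto elim!: adjE intro!: subfield_C_closed)

text \<open>Any of the generators can be taken as the last one adjoined, so that each sign change of
  a generator becomes a single quadratic conjugation.\<close>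

lemma adj_commute: "adj (adj L s) t = adj (adj L t) s"
proof -
  have "adj (adj L s) t \<subseteq> adj (adj L t) s" for s t
  proof
    fix x assume "x \<in> adj (adj L s) t"
    then obtain a b c d where "a \<in> L" "b \<in> L" "c \<in> L" "d \<in> L" "x = a + b * s + (c + d * s) * t"
      by (auto elim!: adjE)
    moreover from this have "x = (a + c * t) + (b + d * t) * s" by (simp add: algebra_simps)
    ultimately show "x \<in> adj (adj L t) s" by (auto intro: adjI)
  qed
  thus ?thesis by blast
qed

lemma field_gen_eqI:
  assumes "subfield_C F" "S \<subseteq> F" "\<And>G. subfield_C G \<Longrightarrow> S \<subseteq> G \<Longrightarrow> F \<subseteq> G"
  shows "field_gen S = F"
  using assms unfolding field_gen_def by blast

lemma subfield_C_field_gen: "subfield_C (field_gen S)"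
  unfolding subfield_C_def field_gen_def by auto

section \<open>Automorphisms and quadratic conjugation\<close>

text \<open>Constrained only on \<open>L\<close>, so that the same function serves for
  \<open>K\<close> and for \<open>Kp\<close>. Sending 1 to 1 excludes the zero map.\<close>

definition field_aut :: "complex set \<Rightarrow> (complex \<Rightarrow> complex) \<Rightarrow> bool" where
  "field_aut L f \<longleftrightarrow> subfield_C L \<and> (\<forall>x\<in>L. f x \<in> L) \<and>
     (\<forall>x\<in>L. \<forall>y\<in>L. f (x + y) = f x + f y \<and> f (x * y) = f x * f y) \<and> f 1 = 1"

lemma field_autD:
  assumes "field_aut L f"
  shows field_aut_subfield: "subfield_C L"
    and field_aut_in: "\<And>x. x \<in> L \<Longrightarrow> f x \<in> L"
    and field_aut_add: "\<And>x y. x \<in> L \<Longrightarrow> y \<in> L \<Longrightarrow> f (x + y) = f x + f y"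
    and field_aut_mult: "\<And>x y. x \<in> L \<Longrightarrow> y \<in> L \<Longrightarrow> f (x * y) = f x * f y"
    and field_aut_1: "f 1 = 1"
  using assms by (auto simp: field_aut_def)

lemma field_aut_0: assumes "field_aut L f" shows "f 0 = 0"
  using field_aut_add[OF assms, of 0 0] subfield_C_0[OF field_aut_subfield[OF assms]] by simp

lemma field_aut_minus: assumes "field_aut L f" "x \<in> L" shows "f (- x) = - f x"
proof -
  note L = field_aut_subfield[OF assms(1)]
  have "f (x + - x) = f x + f (- x)" using assms L by (intro field_aut_add[OF assms(1)] subfield_C_closed)
  thus ?thesis by (simp add: field_aut_0[OF assms(1)] add_eq_0_iff)
qed

lemma field_aut_diff: assumes "field_aut L f" "x \<in> L" "y \<in> L" shows "f (x - y) = f x - f y"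
proof -
  note L = field_aut_subfield[OF assms(1)]
  have "f (x + - y) = f x + f (- y)" using assms L by (intro field_aut_add[OF assms(1)] subfield_C_closed)
  thus ?thesis using assms by (simp add: field_aut_minus)
qed

lemma field_aut_inverse: assumes "field_aut L f" "x \<in> L" shows "f (inverse x) = inverse (f x)"
proof (cases "x = 0")
  case True thus ?thesis by (simp add: field_aut_0[OF assms(1)])
next
  case False
  note L = field_aut_subfield[OF assms(1)]
  have "f (x * inverse x) = f x * f (inverse x)" using assms L by (intro field_aut_mult[OF assms(1)] subfield_C_closed)
  hence "f x * f (inverse x) = 1" using False by (simp add: field_aut_1[OF assms(1)])
  thus ?thesis by (metis inverse_unique)
qed

lemma field_aut_nonzero: assumes "field_aut L f" "x \<in> L" "x \<noteq> 0" shows "f x \<noteq> 0"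
proof
  assume "f x = 0"
  hence "f (x * inverse x) = 0"
    using assms field_aut_mult[OF assms(1), of x "inverse x"]
      subfield_C_inverse[OF field_aut_subfield[OF assms(1)]] by (simp del: right_inverse)
  thus False using assms by (simp add: field_aut_1[OF assms(1)])
qed

lemma field_aut_divide: assumes "field_aut L f" "x \<in> L" "y \<in> L" shows "f (x / y) = f x / f y"
  using field_aut_mult[OF assms(1,2), of "inverse y"] field_aut_inverse[OF assms(1,3)]
    subfield_C_inverse[OF field_aut_subfield[OF assms(1)] assms(3)] by (simp add: field_simps)

lemma field_aut_power: assumes "field_aut L f" "x \<in> L" shows "f (x ^ n) = f x ^ n"
  using assms field_aut_subfield[OF assms(1)]
  by (induction n) (auto simp: field_aut_1 field_aut_mult subfield_C_power)

lemma field_aut_of_nat: assumes "field_aut L f" shows "f (of_nat n) = of_nat n"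
  using field_aut_subfield[OF assms]
  by (induction n) (auto simp: field_aut_0[OF assms] field_aut_1[OF assms] field_aut_add[OF assms] subfield_C_of_nat subfield_C_1)

lemma field_aut_of_int: assumes "field_aut L f" shows "f (of_int n) = of_int n"
  using field_aut_subfield[OF assms] assms
  by (cases n rule: int_cases2) (auto simp: field_aut_minus field_aut_of_nat subfield_C_of_nat)

lemma field_aut_Rats: assumes "field_aut L f" "x \<in> \<rat>" shows "f x = x"
proof -
  from assms(2) obtain a b where "x = of_int a / of_int b" by (auto elim: Rats_cases')
  thus ?thesis using assms(1) field_aut_subfield[OF assms(1)]
    by (simp add: field_aut_divide field_aut_of_int subfield_C_of_int)
qed

text \<open>\<open>f\<close> fixes the integers, so it carries a root of an integer polynomial to a
  root of the same polynomial.\<close>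

lemma field_aut_algebraic_int:
  assumes f: "field_aut L f" "x \<in> L" "algebraic_int x" shows "algebraic_int (f x)"
proof -
  note L = field_aut_subfield[OF f(1)]
  have *: "poly (map_poly of_int p) x \<in> L \<and> f (poly (map_poly of_int p) x) = poly (map_poly of_int p) (f x)"
    for p :: "int poly"
  proof (induction p)
    case 0 thus ?case by (simp add: field_aut_0[OF f(1)] subfield_C_0[OF L])
  next
    case (pCons a p)
    have "of_int a \<in> L" "x * poly (map_poly of_int p) x \<in> L"
      using pCons f(2) L by (auto intro!: subfield_C_of_int subfield_C_mult)
    thus ?case using f pCons L
      by (auto simp: map_poly_pCons field_aut_add[OF f(1)] field_aut_mult[OF f(1)] field_aut_of_int[OF f(1)]
          intro!: subfield_C_add)
  qed
  from f(3) obtain p :: "int poly" where "poly (map_poly of_int p) x = 0" "lead_coeff p = 1"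
    by (auto simp: algebraic_int_altdef_ipoly)
  thus ?thesis using *[of p] field_aut_0[OF f(1)] by (auto simp: algebraic_int_altdef_ipoly)
qed

text \<open>Two automorphisms that agree on generators therefore agree on the generated field, which
  is how the commutation rules of the Galois group are checked.\<close>

lemma field_aut_fixed_subfield:
  assumes "field_aut L f" "field_aut L g" shows "subfield_C {x \<in> L. f x = g x}"
  unfolding subfield_C_def using assms field_aut_subfield[OF assms(1)]
  by (auto simp: field_aut_0 field_aut_1 field_aut_add field_aut_mult field_aut_minus field_aut_inverse
      intro: subfield_C_closed)

lemma field_aut_comp:
  assumes "field_aut L f" "field_aut L g" shows "field_aut L (\<lambda>x. f (g x))"
  using assms unfolding field_aut_def by auto

definition qconj :: "complex set \<Rightarrow> complex \<Rightarrow> complex \<Rightarrow> complex" where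
  "qconj L t x = (THE y. \<exists>a\<in>L. \<exists>b\<in>L. x = a + b * t \<and> y = a - b * t)"

lemma qconj_eq:
  assumes "subfield_C L" "t \<notin> L" "a \<in> L" "b \<in> L"
  shows "qconj L t (a + b * t) = a - b * t"
  unfolding qconj_def
proof (rule the_equality)
  show "\<exists>a'\<in>L. \<exists>b'\<in>L. a + b * t = a' + b' * t \<and> a - b * t = a' - b' * t" using assms by blast
qed (use adj_coords_unique[OF assms(1,2) assms(3,4)] in metis)

lemma field_aut_qconj:
  assumes L: "subfield_C L" and t: "t \<notin> L" and t2: "t\<^sup>2 \<in> L"
  shows "field_aut (adj L t) (qconj L t)"
  unfolding field_aut_def
proof (intro conjI ballI)
  show "subfield_C (adj L t)" by (rule subfield_adj[OF assms])
  show "qconj L t 1 = 1"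
    using qconj_eq[OF L t, of 1 0] subfield_C_0[OF L] subfield_C_1[OF L] by simp
next
  fix x assume "x \<in> adj L t"
  then obtain a b where ab: "a \<in> L" "b \<in> L" and x: "x = a + b * t" by (auto elim!: adjE)
  have "qconj L t x = a + (- b) * t" by (simp add: x qconj_eq[OF L t ab])
  thus "qconj L t x \<in> adj L t" using ab L adjI subfield_C_minus by metis
next
  fix x y assume "x \<in> adj L t" "y \<in> adj L t"
  then obtain a b c d where ab: "a \<in> L" "b \<in> L" "c \<in> L" "d \<in> L" and x: "x = a + b * t" and y: "y = c + d * t"
    by (auto elim!: adjE)
  have "x + y = (a + c) + (b + d) * t" by (simp add: x y algebra_simps)
  moreover have "a + c \<in> L" "b + d \<in> L" using ab L by (auto intro!: subfield_C_closed)
  ultimately have "qconj L t (x + y) = (a + c) - (b + d) * t"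
    using qconj_eq[OF L t] by metis
  thus "qconj L t (x + y) = qconj L t x + qconj L t y"
    using ab L t by (simp add: x y qconj_eq algebra_simps)
  have "x * y = (a * c + b * d * t\<^sup>2) + (a * d + b * c) * t"
    by (simp add: x y algebra_simps power2_eq_square)
  moreover have "a * c + b * d * t\<^sup>2 \<in> L" "a * d + b * c \<in> L"
    using ab L t2 by (auto intro!: subfield_C_add subfield_C_mult)
  ultimately have "qconj L t (x * y) = (a * c + b * d * t\<^sup>2) - (a * d + b * c) * t"
    using qconj_eq[OF L t] by metis
  thus "qconj L t (x * y) = qconj L t x * qconj L t y"
    using ab L t by (simp add: x y qconj_eq algebra_simps power2_eq_square)
qed

section \<open>Units\<close>

lemma units_of_field_iff:
  assumes "subfield_C L"
  shows "x \<in> units_of_field L \<longleftrightarrow> x \<in> L \<and> x \<noteq> 0 \<and> algebraic_int x \<and> algebraic_int (inverse x)"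
  using assms by (auto simp: units_of_field_def ints_of_def intro: subfield_C_inverse)

lemma units_mult: "subfield_C L \<Longrightarrow> x \<in> units_of_field L \<Longrightarrow> y \<in> units_of_field L \<Longrightarrow> x * y \<in> units_of_field L"
  by (auto simp: units_of_field_iff intro: subfield_C_closed algebraic_int_mult)

lemma units_1: "subfield_C L \<Longrightarrow> 1 \<in> units_of_field L"
  by (auto simp: units_of_field_iff intro: subfield_C_closed)

lemma units_minus: "subfield_C L \<Longrightarrow> x \<in> units_of_field L \<Longrightarrow> - x \<in> units_of_field L"
  by (auto simp: units_of_field_iff intro: subfield_C_closed)

lemma units_inverse: "subfield_C L \<Longrightarrow> x \<in> units_of_field L \<Longrightarrow> inverse x \<in> units_of_field L"
  by (auto simp: units_of_field_iff intro: subfield_C_closed)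

lemma units_divide: "subfield_C L \<Longrightarrow> x \<in> units_of_field L \<Longrightarrow> y \<in> units_of_field L \<Longrightarrow> x / y \<in> units_of_field L"
  using units_mult[of L x "inverse y"] units_inverse[of L y] by (simp add: field_simps)

lemma units_power: "subfield_C L \<Longrightarrow> x \<in> units_of_field L \<Longrightarrow> x ^ n \<in> units_of_field L"
  by (induction n) (auto intro: units_mult units_1)

lemma units_powi: "subfield_C L \<Longrightarrow> x \<in> units_of_field L \<Longrightarrow> x powi n \<in> units_of_field L"
  by (auto simp: power_int_def intro: units_power units_inverse)

lemma units_sqrt:
  assumes "subfield_C L" "x \<in> L" "x\<^sup>2 \<in> units_of_field L" shows "x \<in> units_of_field L"
  using assms algebraic_int_sqrtD[of x] algebraic_int_sqrtD[of "inverse x"]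
  by (auto simp: units_of_field_iff power_inverse)

lemma units_mono: "subfield_C L \<Longrightarrow> subfield_C M \<Longrightarrow> L \<subseteq> M \<Longrightarrow> x \<in> units_of_field L \<Longrightarrow> x \<in> units_of_field M"
  by (auto simp: units_of_field_iff)

lemma units_subfield: "subfield_C L \<Longrightarrow> subfield_C M \<Longrightarrow> x \<in> units_of_field M \<Longrightarrow> x \<in> L \<Longrightarrow> x \<in> units_of_field L"
  by (auto simp: units_of_field_iff)

lemma units_aut:
  assumes "field_aut L f" "x \<in> units_of_field L" shows "f x \<in> units_of_field L"
  using assms field_aut_subfield[OF assms(1)]
    field_aut_algebraic_int[OF assms(1), of x] field_aut_algebraic_int[OF assms(1), of "inverse x"]
  by (auto simp: units_of_field_iff field_aut_in field_aut_nonzero field_aut_inverse subfield_C_inverse)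

lemma units_in: "x \<in> units_of_field L \<Longrightarrow> x \<in> L"
  and units_nonzero: "x \<in> units_of_field L \<Longrightarrow> x \<noteq> 0"
  and units_algebraic_int: "x \<in> units_of_field L \<Longrightarrow> algebraic_int x"
  and units_algebraic_int_inverse: "x \<in> units_of_field L \<Longrightarrow> algebraic_int (inverse x)"
  by (auto simp: units_of_field_def ints_of_def)

section \<open>Squarefree multiples of rational squares\<close>

text \<open>For a fraction in lowest terms the square of the denominator has to divide
  \<open>d\<close>, so the denominator is 1.\<close>

lemma Rats_squarefree_mult_square:
  fixes a :: complex
  assumes "a \<in> \<rat>" "squarefree (d :: nat)" "of_nat d * a\<^sup>2 \<in> \<int>"
  shows "a \<in> \<int>"
proof -
  from assms(1) obtain m n :: int where mn: "n > 0" "coprime m n" "a = of_int m / of_int n"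
    by (auto elim: Rats_cases')
  from assms(3) obtain k where k: "of_nat d * a\<^sup>2 = of_int k" by (auto elim: Ints_cases)
  have "of_int (int d * m\<^sup>2) = (of_int (k * n\<^sup>2) :: complex)"
    using k mn by (simp add: field_simps)
  hence "int d * m\<^sup>2 = k * n\<^sup>2" by (simp only: of_int_eq_iff)
  hence "n\<^sup>2 dvd int d * m\<^sup>2" by simp
  moreover have "coprime (n\<^sup>2) (m\<^sup>2)" using mn by (simp add: coprime_commute)
  ultimately have "n\<^sup>2 dvd int d" by (simp add: coprime_dvd_mult_left_iff)
  hence "(nat n)\<^sup>2 dvd d" using mn(1) by (metis nat_dvd_iff int_nat_eq of_nat_dvd_iff of_nat_power order_less_imp_le)
  with assms(2) have "nat n = 1" using squarefreeD by fastforce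
  hence "n = 1" using mn(1) by linarith
  thus ?thesis using mn by simp
qed

lemma squarefree_nat_Rats_square:
  fixes a :: complex
  assumes "a \<in> \<rat>" "squarefree (d :: nat)" "of_nat d * a\<^sup>2 = 1" shows "d = 1"
proof -
  have "a \<in> \<int>" using Rats_squarefree_mult_square[of a d] assms by simp
  then obtain k where k: "a = of_int k" by (auto elim: Ints_cases)
  have "of_int (int d * k\<^sup>2) = (of_int 1 :: complex)" using assms(3) k by simp
  hence "int d * k\<^sup>2 = 1" by (simp only: of_int_eq_iff)
  hence "int d dvd 1" by (metis dvd_triv_left)
  thus ?thesis by simp
qed

section \<open>The biquadratic field and its quadratic subfields\<close>

abbreviation (input) rt :: "nat \<Rightarrow> complex" where
  "rt d \<equiv> complex_of_real (sqrt (real d))"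

lemma rt_square: "(rt d)\<^sup>2 = of_nat d"
  by (simp flip: of_real_power)

lemma rt_mult: "rt (d * e) = rt d * rt e"
  by (simp add: real_sqrt_mult)

lemma rt_nonzero: "d > 0 \<Longrightarrow> rt d \<noteq> 0"
  by simp

lemma rt_notin_Rats: assumes "squarefree d" "d > 1" shows "rt d \<notin> \<rat>"
proof
  assume *: "rt d \<in> \<rat>"
  have "of_nat d * (1 / rt d)\<^sup>2 = 1"
    using assms rt_nonzero[of d] by (simp add: power_divide rt_square)
  thus False using squarefree_nat_Rats_square[of "1 / rt d" d] assms * by simp
qed

lemma quad_field_eq: assumes "squarefree d" "d > 1" shows "quad_field (int d) = adj \<rat> (rt d)"
proof -
  have "field_gen {rt d} = adj \<rat> (rt d)"
    using rt_notin_Rats[OF assms] gen_in_adj[OF subfield_C_Rats_complex]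
    by (intro field_gen_eqI subfield_adj adj_subset subfield_C_Rats_complex subfield_C_Rats)
       (auto simp: rt_square simp del: of_real_power)
  thus ?thesis by (simp add: quad_field_def)
qed

text \<open>Squaring \<open>a + b * rt d\<close> and comparing coordinates gives
  \<open>a * b = 0\<close>. Then either \<open>rt (d * e)\<close> or \<open>rt e\<close> is
  rational, and both radicands are squarefree and above 1.\<close>

lemma rt_notin_adj:
  assumes de: "squarefree (d * e)" "d > 1" "e > 1"
  shows "rt e \<notin> adj \<rat> (rt d)"
proof
  assume "rt e \<in> adj \<rat> (rt d)"
  then obtain a b where ab: "a \<in> \<rat>" "b \<in> \<rat>" and eq: "rt e = a + b * rt d" by (auto elim: adjE)
  have sf: "squarefree d" "squarefree e" using de(1) squarefree_multD by blast+
  have "(rt e)\<^sup>2 = (a + b * rt d)\<^sup>2" by (simp add: eq)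
  hence *: "of_nat e + 0 * rt d = (a\<^sup>2 + b\<^sup>2 * of_nat d) + (2 * a * b) * rt d"
    unfolding rt_square[symmetric] by (simp add: power2_eq_square algebra_simps)
  have "of_nat e = a\<^sup>2 + b\<^sup>2 * of_nat d \<and> 0 = 2 * a * b"
    by (rule adj_coords_unique[OF subfield_C_Rats_complex rt_notin_Rats[OF sf(1) de(2)] _ _ _ _ *]) (use ab in auto)
  hence "a = 0 \<or> b = 0" by simp
  thus False
  proof
    assume "a = 0"
    hence "rt (d * e) = b * (rt d)\<^sup>2" by (simp only: rt_mult eq) (simp add: power2_eq_square)
    hence "rt (d * e) \<in> \<rat>" unfolding rt_square using ab by simp
    moreover have "d * e > 1" using less_1_mult[OF de(2,3)] .
    ultimately show False using rt_notin_Rats[OF de(1)] by blast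
  next
    assume "b = 0"
    thus False using eq ab rt_notin_Rats[OF sf(2) de(3)] by simp
  qed
qed

lemma adj_Reals: assumes "L \<subseteq> \<real>" "t \<in> \<real>" shows "adj L t \<subseteq> \<real>"
  using assms by (auto elim!: adjE intro!: Reals_add Reals_mult)

lemma adj_ii_Reals:
  assumes "L \<subseteq> \<real>" "x \<in> \<real>" "x \<in> adj L \<i>" shows "x \<in> L"
proof -
  obtain a b where ab: "a \<in> L" "b \<in> L" "x = a + b * \<i>" using assms(3) by (auto elim: adjE)
  hence "a \<in> \<real>" "b \<in> \<real>" using assms(1) by auto
  hence "b = 0" using ab assms(2) by (auto simp: complex_is_Real_iff complex_eq_iff)
  thus ?thesis using ab by simp
qed

text \<open>Distinctness of the primes keeps 2pq squarefree, so that R, S and R S generate three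
  different quadratic fields. Equal primes are treated by
  \<open>fund_unit_equal_primes\<close>.\<close>

locale biquad =
  fixes p q :: nat
  assumes p: "prime p" and q: "prime q" and p4: "p mod 4 = 1" and q4: "q mod 4 = 1" and pq: "p \<noteq> q"
begin

definition "R = rt p"
definition "S = rt (2 * q)"
definition "k1 = adj \<rat> R"
definition "k2 = adj \<rat> S"
definition "k3 = adj \<rat> (R * S)"
definition "Kp = adj k1 S"
definition "K = adj Kp \<i>"

lemma p5: "p \<ge> 5" and q5: "q \<ge> 5"
proof -
  have "n \<ge> 5" if "prime n" "n mod 4 = 1" for n :: nat
  proof (rule ccontr)
    assume "\<not> n \<ge> 5"
    hence "n \<in> {0, 1, 2, 3, 4}" by auto
    thus False using that by (auto simp: prime_nat_iff)
  qed
  thus "p \<ge> 5" "q \<ge> 5" using p q p4 q4 by auto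
qed

lemma odd_p: "odd p" and odd_q: "odd q"
  using p4 q4 by presburger+

lemma sf_2pq: "squarefree (p * (2 * q))"
proof -
  have 2: "prime (2::nat)" by simp
  have "coprime 2 q" using odd_q by simp
  hence "squarefree (2 * q)"
    by (metis squarefree_prime[OF 2] squarefree_prime[OF q] squarefree_mult_coprime)
  moreover have "coprime p (2 * q)"
    using odd_p primes_coprime[OF p q pq] by simp
  ultimately show ?thesis
    by (metis squarefree_prime[OF p] squarefree_mult_coprime)
qed

lemma sf_p: "squarefree p" and sf_2q: "squarefree (2 * q)"
  using sf_2pq squarefree_multD by blast+

lemma RS_eq: "R * S = rt (p * (2 * q))"
  unfolding R_def S_def by (rule rt_mult[symmetric])

lemma R2: "R\<^sup>2 = of_nat p" and S2: "S\<^sup>2 = of_nat (2 * q)"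
  unfolding R_def S_def by (rule rt_square)+

lemma R_Real: "R \<in> \<real>" and S_Real: "S \<in> \<real>"
  by (simp_all add: R_def S_def)

lemma R_nz: "R \<noteq> 0" and S_nz: "S \<noteq> 0"
  using p5 q5 by (simp_all add: R_def S_def)

lemma gt1: "p > 1" "2 * q > 1" "p * (2 * q) > 1"
  using p5 q5 less_1_mult[of p "2 * q"] by auto

lemma notin_Rats: "R \<notin> \<rat>" "S \<notin> \<rat>" "R * S \<notin> \<rat>"
  unfolding RS_eq unfolding R_def S_def
  by (rule rt_notin_Rats sf_p sf_2q sf_2pq gt1)+

lemma quad_fields: "quad_field (int p) = k1" "quad_field (int (2 * q)) = k2" "quad_field (int (p * (2 * q))) = k3"
  unfolding quad_field_eq[OF sf_p gt1(1)] quad_field_eq[OF sf_2q gt1(2)] quad_field_eq[OF sf_2pq gt1(3)]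
    k1_def k2_def k3_def RS_eq unfolding R_def S_def by (rule refl)+

lemma R2_Rats: "R\<^sup>2 \<in> \<rat>" and S2_Rats: "S\<^sup>2 \<in> \<rat>" and RS2_Rats: "(R * S)\<^sup>2 \<in> \<rat>"
  by (simp_all only: power_mult_distrib R2 S2) auto

lemma subfield_k: "subfield_C k1" "subfield_C k2" "subfield_C k3"
  unfolding k1_def k2_def k3_def
  by (intro subfield_adj subfield_C_Rats_complex notin_Rats R2_Rats S2_Rats RS2_Rats)+

lemma k_Reals: "k1 \<subseteq> \<real>" "k2 \<subseteq> \<real>" "k3 \<subseteq> \<real>"
proof -
  have "(\<rat> :: complex set) \<subseteq> \<real>" by (auto elim!: Rats_cases')
  thus "k1 \<subseteq> \<real>" "k2 \<subseteq> \<real>" "k3 \<subseteq> \<real>"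
    unfolding k1_def k2_def k3_def by (intro adj_Reals Reals_mult R_Real S_Real; assumption)+
qed

lemma Rats_k: "\<rat> \<subseteq> k1" "\<rat> \<subseteq> k2" "\<rat> \<subseteq> k3"
  using subfield_k subfield_C_Rats by blast+

lemma S_notin: "S \<notin> k1" and R_notin: "R \<notin> k2"
  using rt_notin_adj[OF sf_2pq gt1(1,2)] rt_notin_adj[OF sf_2pq[unfolded mult.commute[of p]] gt1(2,1)]
  unfolding k1_def k2_def R_def S_def by blast+

lemma subfield_Kp: "subfield_C Kp"
  unfolding Kp_def using Rats_k S2_Rats by (intro subfield_adj subfield_k S_notin) auto

lemma Kp_alt: "Kp = adj k2 R"
  unfolding Kp_def k1_def k2_def by (rule adj_commute)

lemma Kp_Reals: "Kp \<subseteq> \<real>"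
  unfolding Kp_def by (intro adj_Reals k_Reals S_Real)

lemma subfield_adj_ii:
  assumes "subfield_C L" "L \<subseteq> \<real>" shows "subfield_C (adj L \<i>)" "\<i> \<notin> L"
proof -
  show "\<i> \<notin> L" using assms(2) by (auto simp: complex_is_Real_iff)
  thus "subfield_C (adj L \<i>)"
    using assms subfield_C_minus[OF assms(1)] subfield_C_1[OF assms(1)] by (intro subfield_adj) auto
qed

lemma subfield_K: "subfield_C K"
  unfolding K_def by (intro subfield_adj_ii subfield_Kp Kp_Reals)

lemma Kp_sub_K: "Kp \<subseteq> K" unfolding K_def by (rule subset_adj[OF subfield_Kp])
lemma k1_sub_Kp: "k1 \<subseteq> Kp" unfolding Kp_def by (rule subset_adj[OF subfield_k(1)])
lemma k2_sub_Kp: "k2 \<subseteq> Kp" unfolding Kp_alt by (rule subset_adj[OF subfield_k(2)])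

lemma R_in: "R \<in> Kp" "R \<in> k1" and S_in: "S \<in> Kp" "S \<in> k2" and ii_in: "\<i> \<in> K"
  using k1_sub_Kp k2_sub_Kp gen_in_adj[OF subfield_C_Rats_complex] gen_in_adj[OF subfield_Kp]
  unfolding k1_def k2_def K_def by blast+

lemma k3_sub_Kp: "k3 \<subseteq> Kp"
  unfolding k3_def using R_in S_in subfield_C_Rats[OF subfield_Kp] subfield_Kp
  by (intro adj_subset subfield_C_mult) auto

lemma Kp_eq: "field_gen {R, S} = Kp"
proof (rule field_gen_eqI)
  fix G assume "subfield_C G" "{R, S} \<subseteq> G"
  thus "Kp \<subseteq> G" unfolding Kp_def k1_def by (intro adj_subset subfield_C_Rats) auto
qed (use subfield_Kp R_in S_in in auto)

lemma K_eq: "field_gen {R, S, \<i>} = K"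
proof (rule field_gen_eqI)
  fix G assume "subfield_C G" "{R, S, \<i>} \<subseteq> G"
  thus "K \<subseteq> G" unfolding K_def Kp_def k1_def by (intro adj_subset subfield_C_Rats) auto
qed (use subfield_K R_in S_in ii_in Kp_sub_K in auto)

lemma KpE:
  assumes "x \<in> Kp"
  obtains a b c d where "a \<in> \<rat>" "b \<in> \<rat>" "c \<in> \<rat>" "d \<in> \<rat>" "x = a + b * R + c * S + d * (R * S)"
proof -
  obtain a b c d where "a \<in> \<rat>" "b \<in> \<rat>" "c \<in> \<rat>" "d \<in> \<rat>" "x = (a + b * R) + (c + d * R) * S"
    using assms unfolding Kp_def k1_def by (auto elim!: adjE)
  thus ?thesis by (intro that[of a b c d]) (auto simp: algebra_simps)
qed

lemma coords_zero:
  assumes "a \<in> \<rat>" "b \<in> \<rat>" "c \<in> \<rat>" "d \<in> \<rat>" "a + b * R + c * S + d * (R * S) = 0"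
  shows "a = 0" "b = 0" "c = 0" "d = 0"
proof -
  have in1: "u + v * R \<in> k1" if "u \<in> \<rat>" "v \<in> \<rat>" for u v
    unfolding k1_def using that by (rule adjI)
  have "(a + b * R) + (c + d * R) * S = (0 + 0 * R) + (0 + 0 * R) * S"
    using assms(5) by (simp add: algebra_simps)
  from adj_coords_unique[OF subfield_k(1) S_notin in1[OF assms(1,2)] in1[OF assms(3,4)]
      in1[OF Rats_0 Rats_0] in1[OF Rats_0 Rats_0] this]
  have 1: "a + b * R = 0 + 0 * R" and 2: "c + d * R = 0 + 0 * R" by blast+
  show "a = 0" "b = 0"
    using adj_coords_unique[OF subfield_C_Rats_complex notin_Rats(1) assms(1,2) Rats_0 Rats_0 1] by simp_all
  show "c = 0" "d = 0"
    using adj_coords_unique[OF subfield_C_Rats_complex notin_Rats(1) assms(3,4) Rats_0 Rats_0 2] by simp_all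
qed

section \<open>The Galois group of \<open>K\<close>\<close>

lemma K_alt: "K = adj (adj k1 \<i>) S" "K = adj (adj k2 \<i>) R"
proof -
  show "K = adj (adj k1 \<i>) S" unfolding K_def Kp_def by (rule adj_commute)
  show "K = adj (adj k2 \<i>) R" unfolding K_def Kp_alt by (rule adj_commute)
qed

lemma notin_i: "S \<notin> adj k1 \<i>" "R \<notin> adj k2 \<i>"
  by (rule notI, drule adj_ii_Reals[OF k_Reals(1) S_Real], simp add: S_notin)
     (rule notI, drule adj_ii_Reals[OF k_Reals(2) R_Real], simp add: R_notin)

text \<open>Together with complex conjugation, \<open>sig\<close> and \<open>tau\<close> are
  commuting involutions that change the sign of one of the generators R, S, i each; they generate
  the Galois group of \<open>K\<close>.\<close>

definition sig :: "complex \<Rightarrow> complex" where "sig = qconj (adj k2 \<i>) R"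
definition tau :: "complex \<Rightarrow> complex" where "tau = qconj (adj k1 \<i>) S"

lemma field_aut_sig: "field_aut K sig"
  unfolding K_alt(2) sig_def using subsetD[OF subset_adj[OF subfield_k(2)] subsetD[OF Rats_k(2) R2_Rats]]
  by (intro field_aut_qconj subfield_adj_ii subfield_k k_Reals notin_i)

lemma field_aut_tau: "field_aut K tau"
  unfolding K_alt(1) tau_def using subsetD[OF subset_adj[OF subfield_k(1)] subsetD[OF Rats_k(1) S2_Rats]]
  by (intro field_aut_qconj subfield_adj_ii subfield_k k_Reals notin_i)

lemma sig_fix: "x \<in> adj k2 \<i> \<Longrightarrow> sig x = x" and sig_R: "sig R = - R"
  using qconj_eq[OF subfield_adj_ii(1)[OF subfield_k(2) k_Reals(2)] notin_i(2), of x 0]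
    qconj_eq[OF subfield_adj_ii(1)[OF subfield_k(2) k_Reals(2)] notin_i(2), of 0 1]
    subfield_CD(1,2)[OF subfield_adj_ii(1)[OF subfield_k(2) k_Reals(2)]]
  unfolding sig_def by auto

lemma tau_fix: "x \<in> adj k1 \<i> \<Longrightarrow> tau x = x" and tau_S: "tau S = - S"
  using qconj_eq[OF subfield_adj_ii(1)[OF subfield_k(1) k_Reals(1)] notin_i(1), of x 0]
    qconj_eq[OF subfield_adj_ii(1)[OF subfield_k(1) k_Reals(1)] notin_i(1), of 0 1]
    subfield_CD(1,2)[OF subfield_adj_ii(1)[OF subfield_k(1) k_Reals(1)]]
  unfolding tau_def by auto

lemma sig_S: "sig S = S" and sig_ii: "sig \<i> = \<i>" and tau_R: "tau R = R" and tau_ii: "tau \<i> = \<i>"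
  using sig_fix tau_fix subset_adj[OF subfield_k(2)] subset_adj[OF subfield_k(1)]
    gen_in_adj[OF subfield_k(1)] gen_in_adj[OF subfield_k(2)] R_in S_in by blast+

lemma field_aut_cnj: "field_aut K cnj"
  unfolding field_aut_def
proof (intro conjI ballI)
  fix x assume "x \<in> K"
  then obtain a b where ab: "a \<in> Kp" "b \<in> Kp" "x = a + b * \<i>" unfolding K_def by (auto elim: adjE)
  hence "cnj a = a" "cnj b = b" using Kp_Reals by (auto simp: Reals_cnj_iff)
  hence "cnj x = a + (- b) * \<i>" using ab by simp
  thus "cnj x \<in> K" unfolding K_def using ab subfield_C_minus[OF subfield_Kp] adjI by metis
qed (simp_all add: subfield_K)

lemma Kp_iff: "x \<in> Kp \<longleftrightarrow> x \<in> K \<and> x \<in> \<real>"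
  using Kp_Reals Kp_sub_K adj_ii_Reals[OF Kp_Reals] unfolding K_def by blast

lemma K_aut_eq:
  assumes "field_aut K f" "field_aut K g" "f R = g R" "f S = g S" "f \<i> = g \<i>" "x \<in> K"
  shows "f x = g x"
proof -
  have "{R, S, \<i>} \<subseteq> {x \<in> K. f x = g x}" using assms R_in S_in ii_in Kp_sub_K by auto
  hence "K \<subseteq> {x \<in> K. f x = g x}"
    using field_aut_fixed_subfield[OF assms(1,2)] unfolding K_eq[symmetric] field_gen_def by blast
  thus ?thesis using assms(6) by blast
qed

lemma field_aut_id: "field_aut K (\<lambda>x. x)"
  unfolding field_aut_def using subfield_K by auto

lemma in_K: "R \<in> K" "S \<in> K" "\<i> \<in> K" using R_in S_in ii_in Kp_sub_K by auto

lemmas aut_gens = sig_R sig_S sig_ii tau_R tau_S tau_ii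
  field_aut_minus[OF field_aut_sig in_K(1)] field_aut_minus[OF field_aut_tau in_K(2)]
  field_aut_minus[OF field_aut_sig in_K(2)] field_aut_minus[OF field_aut_tau in_K(1)]
  field_aut_minus[OF field_aut_sig in_K(3)] field_aut_minus[OF field_aut_tau in_K(3)]

lemma cnj_gens: "cnj R = R" "cnj S = S" by (simp_all add: R_def S_def)

lemma sig_sig: "x \<in> K \<Longrightarrow> sig (sig x) = x"
  by (rule K_aut_eq[OF field_aut_comp[OF field_aut_sig field_aut_sig] field_aut_id]) (simp_all add: aut_gens)
lemma tau_tau: "x \<in> K \<Longrightarrow> tau (tau x) = x"
  by (rule K_aut_eq[OF field_aut_comp[OF field_aut_tau field_aut_tau] field_aut_id]) (simp_all add: aut_gens)
lemma tau_sig: "x \<in> K \<Longrightarrow> tau (sig x) = sig (tau x)"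
  by (rule K_aut_eq[OF field_aut_comp[OF field_aut_tau field_aut_sig] field_aut_comp[OF field_aut_sig field_aut_tau]])
     (simp_all add: aut_gens)
lemma sig_cnj: "x \<in> K \<Longrightarrow> sig (cnj x) = cnj (sig x)"
  by (rule K_aut_eq[OF field_aut_comp[OF field_aut_sig field_aut_cnj] field_aut_comp[OF field_aut_cnj field_aut_sig]])
     (simp_all add: aut_gens cnj_gens)
lemma tau_cnj: "x \<in> K \<Longrightarrow> tau (cnj x) = cnj (tau x)"
  by (rule K_aut_eq[OF field_aut_comp[OF field_aut_tau field_aut_cnj] field_aut_comp[OF field_aut_cnj field_aut_tau]])
     (simp_all add: aut_gens cnj_gens)

lemma sig_Kp: assumes "x \<in> Kp" shows "sig x \<in> Kp"
  using assms sig_cnj[of x] field_aut_in[OF field_aut_sig, of x] by (auto simp: Kp_iff Reals_cnj_iff)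

lemma tau_Kp: assumes "x \<in> Kp" shows "tau x \<in> Kp"
  using assms tau_cnj[of x] field_aut_in[OF field_aut_tau, of x] by (auto simp: Kp_iff Reals_cnj_iff)

lemma field_aut_restrict: assumes "field_aut K f" "\<And>x. x \<in> Kp \<Longrightarrow> f x \<in> Kp" shows "field_aut Kp f"
  using assms Kp_sub_K subfield_Kp unfolding field_aut_def by blast

lemma sig_aut: "field_aut Kp sig" and tau_aut: "field_aut Kp tau"
  using field_aut_restrict[OF field_aut_sig sig_Kp] field_aut_restrict[OF field_aut_tau tau_Kp] by blast+

lemma aut_coords:
  assumes "field_aut Kp f" "a \<in> \<rat>" "b \<in> \<rat>" "c \<in> \<rat>" "d \<in> \<rat>"
  shows "f (a + b * R + c * S + d * (R * S)) = a + b * f R + c * f S + d * (f R * f S)"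
proof -
  have "a \<in> Kp" "b \<in> Kp" "c \<in> Kp" "d \<in> Kp" using assms subfield_C_Rats[OF subfield_Kp] by auto
  thus ?thesis using R_in(1) S_in(1) assms
    by (simp add: field_aut_add[OF assms(1)] field_aut_mult[OF assms(1)] field_aut_Rats[OF assms(1)]
        subfield_C_add[OF subfield_Kp] subfield_C_mult[OF subfield_Kp])
qed

lemma sig_coords:
  assumes "a \<in> \<rat>" "b \<in> \<rat>" "c \<in> \<rat>" "d \<in> \<rat>"
  shows "sig (a + b * R + c * S + d * (R * S)) = a - b * R + c * S - d * (R * S)"
    and "tau (a + b * R + c * S + d * (R * S)) = a + b * R - c * S - d * (R * S)"
  using aut_coords[OF sig_aut assms] aut_coords[OF tau_aut assms] by (simp_all add: aut_gens)

section \<open>Fixed fields and rational squares in \<open>Kp\<close>\<close>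

text \<open>The Galois correspondence by coordinates: subtracting or adding a conjugate cancels two
  of the four coordinates and doubles the other two, and vanishing kills these. The last four claims
  describe the common eigenspaces of \<open>sig\<close> and \<open>tau\<close>, one for each pair of
  signs.\<close>

lemma fixed_fields:
  assumes x: "x \<in> Kp"
  shows "tau x = x \<Longrightarrow> x \<in> k1" and "sig x = x \<Longrightarrow> x \<in> k2" and "sig (tau x) = x \<Longrightarrow> x \<in> k3"
    and "sig x = x \<Longrightarrow> tau x = x \<Longrightarrow> x \<in> \<rat>"
    and "sig x = x \<Longrightarrow> tau x = - x \<Longrightarrow> \<exists>a\<in>\<rat>. x = a * S"
    and "sig x = - x \<Longrightarrow> tau x = x \<Longrightarrow> \<exists>a\<in>\<rat>. x = a * R"
    and "sig x = - x \<Longrightarrow> tau x = - x \<Longrightarrow> \<exists>a\<in>\<rat>. x = a * (R * S)"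
proof -
  obtain a b c d where ab: "a \<in> \<rat>" "b \<in> \<rat>" "c \<in> \<rat>" "d \<in> \<rat>" and xe: "x = a + b * R + c * S + d * (R * S)"
    using KpE[OF x] .
  note 2 = sig_coords[OF ab, folded xe]
  have ts: "sig (tau x) = a - b * R - c * S + d * (R * S)"
    unfolding 2(2) using sig_coords(1)[of a b "- c" "- d"] ab by simp
  have mem: "u \<in> \<rat> \<Longrightarrow> v \<in> \<rat> \<Longrightarrow> u + v * t \<in> adj \<rat> t" for u v t by (rule adjI)
  have zero: "a' = 0 \<and> b' = 0 \<and> c' = 0 \<and> d' = 0"
    if "y = 2 * a' + 2 * b' * R + 2 * c' * S + 2 * d' * (R * S)" "y = 0"
      "a' \<in> \<rat>" "b' \<in> \<rat>" "c' \<in> \<rat>" "d' \<in> \<rat>" for y a' b' c' d'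
    using coords_zero[of "2 * a'" "2 * b'" "2 * c'" "2 * d'"] that by simp
  have "x - tau x = 2 * 0 + 2 * 0 * R + 2 * c * S + 2 * d * (R * S)"
    unfolding 2(2) by (simp add: xe)
  note t0' = zero[OF this]
  have t0: "c = 0" "d = 0" if "tau x = x" using t0' that ab by simp_all
  have "x - sig x = 2 * 0 + 2 * b * R + 2 * 0 * S + 2 * d * (R * S)"
    unfolding 2(1) by (simp add: xe)
  note s0' = zero[OF this]
  have s0: "b = 0" "d = 0" if "sig x = x" using s0' that ab by simp_all
  have "x - sig (tau x) = 2 * 0 + 2 * b * R + 2 * c * S + 2 * 0 * (R * S)"
    unfolding ts by (simp add: xe)
  note st0' = zero[OF this]
  have st0: "b = 0" "c = 0" if "sig (tau x) = x" using st0' that ab by simp_all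
  have "x + tau x = 2 * a + 2 * b * R + 2 * 0 * S + 2 * 0 * (R * S)"
    unfolding 2(2) by (simp add: xe)
  note tm' = zero[OF this]
  have tm: "a = 0" "b = 0" if "tau x = - x" using tm' that ab by simp_all
  have "x + sig x = 2 * a + 2 * 0 * R + 2 * c * S + 2 * 0 * (R * S)"
    unfolding 2(1) by (simp add: xe)
  note sm' = zero[OF this]
  have sm: "a = 0" "c = 0" if "sig x = - x" using sm' that ab by simp_all
  show "x \<in> k1" if "tau x = x" using t0[OF that] mem[OF ab(1,2)] by (simp add: xe k1_def)
  show "x \<in> k2" if "sig x = x" using s0[OF that] mem[OF ab(1,3)] by (simp add: xe k2_def)
  show "x \<in> k3" if "sig (tau x) = x" using st0[OF that] mem[OF ab(1,4)] by (simp add: xe k3_def)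
  show "x \<in> \<rat>" if "sig x = x" "tau x = x" using s0[OF that(1)] t0[OF that(2)] ab by (simp add: xe)
  show "\<exists>a\<in>\<rat>. x = a * S" if "sig x = x" "tau x = - x" using s0[OF that(1)] tm[OF that(2)] ab by (auto simp: xe)
  show "\<exists>a\<in>\<rat>. x = a * R" if "sig x = - x" "tau x = x" using sm[OF that(1)] t0[OF that(2)] ab by (auto simp: xe)
  show "\<exists>a\<in>\<rat>. x = a * (R * S)" if "sig x = - x" "tau x = - x" using sm[OF that(1)] tm[OF that(2)] ab by (auto simp: xe)
qed

lemma k_fixed:
  shows "x \<in> k1 \<Longrightarrow> tau x = x" and "x \<in> k2 \<Longrightarrow> sig x = x" and "x \<in> k3 \<Longrightarrow> tau x = sig x"
proof -
  show "x \<in> k1 \<Longrightarrow> tau x = x" "x \<in> k2 \<Longrightarrow> sig x = x"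
    using tau_fix sig_fix subset_adj[OF subfield_k(1)] subset_adj[OF subfield_k(2)] by blast+
  assume "x \<in> k3"
  then obtain a d where ad: "a \<in> \<rat>" "d \<in> \<rat>" and x: "x = a + d * (R * S)" unfolding k3_def by (auto elim: adjE)
  show "tau x = sig x" using sig_coords[of a 0 0 d] ad by (simp add: x)
qed

text \<open>An automorphism fixes the square of \<open>x\<close> and so maps \<open>x\<close> to
  \<open>x\<close> or \<open>- x\<close>. Hence \<open>x\<close> is a common eigenvector, and these
  are the rational multiples of 1, R, S and R S.\<close>

lemma sqrt_Rats_forms:
  assumes x: "x \<in> Kp" and x2: "x\<^sup>2 \<in> \<rat>"
  shows "x \<in> \<rat> \<or> (\<exists>a\<in>\<rat>. x = a * R) \<or> (\<exists>a\<in>\<rat>. x = a * S) \<or> (\<exists>a\<in>\<rat>. x = a * (R * S))"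
proof -
  have "(f x)\<^sup>2 = x\<^sup>2" if "field_aut Kp f" for f
    using field_aut_power[OF that x, of 2] field_aut_Rats[OF that x2] by simp
  from this[OF sig_aut] this[OF tau_aut] show ?thesis
    using fixed_fields(4-7)[OF x] by (auto simp: power2_eq_iff)
qed

end

section \<open>Fundamental units and logarithms\<close>

definition ell :: "complex \<Rightarrow> real" where "ell x = ln (cmod x)"

lemma ell_mult: "x \<noteq> 0 \<Longrightarrow> y \<noteq> 0 \<Longrightarrow> ell (x * y) = ell x + ell y"
  by (simp add: ell_def norm_mult ln_mult)

lemma ell_inverse: "ell (inverse x) = - ell x"
  by (cases "x = 0") (simp_all add: ell_def norm_inverse ln_inverse)

lemma ell_divide: "x \<noteq> 0 \<Longrightarrow> y \<noteq> 0 \<Longrightarrow> ell (x / y) = ell x - ell y"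
  by (simp add: ell_mult ell_inverse divide_inverse)

lemma ell_power: "x \<noteq> 0 \<Longrightarrow> ell (x ^ n) = of_nat n * ell x"
  by (simp add: ell_def norm_power ln_realpow)

lemma ell_powi: "x \<noteq> 0 \<Longrightarrow> ell (x powi n) = of_int n * ell x"
  by (auto simp: power_int_def ell_power ell_inverse)

lemma ell_eq_0_iff: "x \<noteq> 0 \<Longrightarrow> ell x = 0 \<longleftrightarrow> cmod x = 1"
  by (simp add: ell_def)

lemma roots_of_unity_norm: "z \<in> roots_of_unity L \<Longrightarrow> cmod z = 1"
  using power_eq_1_iff[of z] by (auto simp: roots_of_unity_def)

lemma FSU3_I:
  assumes L: "subfield_C L" and u: "u1 \<in> units_of_field L" "u2 \<in> units_of_field L" "u3 \<in> units_of_field L"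
    and rou: "\<And>z. z \<in> units_of_field L \<Longrightarrow> cmod z = 1 \<Longrightarrow> z \<in> roots_of_unity L"
    and indep: "\<And>a b c :: int. of_int a * ell u1 + of_int b * ell u2 + of_int c * ell u3 = 0 \<Longrightarrow> a = 0 \<and> b = 0 \<and> c = 0"
    and gen: "\<And>e. e \<in> units_of_field L \<Longrightarrow>
      \<exists>a b c :: int. ell e = of_int a * ell u1 + of_int b * ell u2 + of_int c * ell u3"
  shows "FSU L [u1, u2, u3]"
proof -
  have nz: "u1 \<noteq> 0" "u2 \<noteq> 0" "u3 \<noteq> 0" using u by (auto dest: units_nonzero)
  have prod: "(\<Prod>j<length [u1, u2, u3]. ([u1, u2, u3] ! j) powi ([a, b, c] ! j)) = u1 powi a * u2 powi b * u3 powi c" for a b c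
    by (simp add: numeral_3_eq_3 lessThan_Suc mult_ac)
  have iff: "e / (u1 powi a * u2 powi b * u3 powi c) \<in> roots_of_unity L \<longleftrightarrow>
      ell e = of_int a * ell u1 + of_int b * ell u2 + of_int c * ell u3" (is "?q \<in> _ \<longleftrightarrow> _")
    if e: "e \<in> units_of_field L" for e a b c
  proof -
    have q: "?q \<in> units_of_field L" using u e L by (intro units_divide units_mult units_powi)
    have "ell ?q = ell e - (of_int a * ell u1 + of_int b * ell u2 + of_int c * ell u3)"
      using nz units_nonzero[OF e] by (simp add: ell_divide ell_mult ell_powi)
    moreover have "?q \<in> roots_of_unity L \<longleftrightarrow> ell ?q = 0"
      using rou[OF q] roots_of_unity_norm[of ?q L] ell_eq_0_iff[OF units_nonzero[OF q]] by blast
    ultimately show ?thesis by simp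
  qed
  show ?thesis
    unfolding FSU_def
  proof (intro conjI ballI)
    show "set [u1, u2, u3] \<subseteq> units_of_field L" using u by simp
    fix e assume e: "e \<in> units_of_field L"
    obtain a b c :: int where abc: "ell e = of_int a * ell u1 + of_int b * ell u2 + of_int c * ell u3"
      using gen[OF e] by blast
    show "\<exists>!a. length a = length [u1, u2, u3] \<and>
        e / (\<Prod>j<length [u1, u2, u3]. ([u1, u2, u3] ! j) powi (a ! j)) \<in> roots_of_unity L"
    proof (intro ex1I conjI)
      show "length [a, b, c] = length [u1, u2, u3]" by simp
      show "e / (\<Prod>j<length [u1, u2, u3]. ([u1, u2, u3] ! j) powi ([a, b, c] ! j)) \<in> roots_of_unity L"
        unfolding prod using iff[OF e] abc by blast
      fix l :: "int list"
      assume l: "length l = length [u1, u2, u3] \<and>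
        e / (\<Prod>j<length [u1, u2, u3]. ([u1, u2, u3] ! j) powi (l ! j)) \<in> roots_of_unity L"
      then obtain a' b' c' where le: "l = [a', b', c']"
        by (auto simp: length_Suc_conv numeral_3_eq_3)
      have "ell e = of_int a' * ell u1 + of_int b' * ell u2 + of_int c' * ell u3"
        using l iff[OF e] unfolding le prod by blast
      with abc have "of_int (a' - a) * ell u1 + of_int (b' - b) * ell u2 + of_int (c' - c) * ell u3 = 0"
        by (simp add: algebra_simps)
      from indep[OF this] show "l = [a, b, c]" by (simp add: le)
    qed
  qed
qed

section \<open>Units of a real field with a fundamental unit\<close>

definition fundamental :: "complex set \<Rightarrow> real \<Rightarrow> bool" where
  "fundamental L e \<longleftrightarrow> complex_of_real e \<in> units_of_field L \<and> e > 1 \<and>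
     (\<forall>u::real. complex_of_real u \<in> units_of_field L \<and> u > 1 \<longrightarrow> e \<le> u)"

text \<open>Division by the power of \<open>e\<close> given by the floor of the logarithm brings the
  absolute value into the interval from 1 inclusive to \<open>e\<close> exclusive, where minimality
  of \<open>e\<close> leaves only 1.\<close>

lemma fundamental_powers:
  assumes L: "subfield_C L" "L \<subseteq> \<real>" and e: "fundamental L e" and u: "u \<in> units_of_field L"
  obtains n :: int where "u = of_real e powi n \<or> u = - (of_real e powi n)"
proof -
  have e1: "e > 1" and eu: "of_real e \<in> units_of_field L"
    and emin: "\<And>v. complex_of_real v \<in> units_of_field L \<Longrightarrow> v > 1 \<Longrightarrow> e \<le> v"
    using e by (auto simp: fundamental_def)
  obtain x where x: "u = of_real x" using L(2) units_in[OF u] by (auto elim!: Reals_cases dest!: subsetD)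
  have x0: "x \<noteq> 0" using units_nonzero[OF u] x by auto
  define n where "n = \<lfloor>log e \<bar>x\<bar>\<rfloor>"
  define y where "y = \<bar>x\<bar> / e powi n"
  have epos: "e powi n > 0" using e1 by simp
  have pw: "e powi k = e powr of_int k" for k
    using e1 by (subst powr_real_of_int') auto
  have xl: "\<bar>x\<bar> = e powr log e \<bar>x\<bar>" using x0 e1 by simp
  have "e powr of_int n \<le> e powr log e \<bar>x\<bar>"
    using e1 unfolding n_def by (intro powr_mono) auto
  hence y1: "y \<ge> 1" using xl epos by (simp add: y_def pw)
  have "e powr log e \<bar>x\<bar> < e powr (of_int n + 1)"
    using e1 unfolding n_def by (intro powr_less_mono) linarith+
  hence ye: "y < e" using xl epos e1 by (simp add: y_def pw powr_add field_simps)
  have "of_real \<bar>x\<bar> \<in> units_of_field L"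
    using u units_minus[OF L(1) u] unfolding x by (cases "x \<ge> 0") auto
  hence "of_real y \<in> units_of_field L"
    unfolding y_def using units_divide[OF L(1) _ units_powi[OF L(1) eu, of n]] by simp
  with emin[of y] ye y1 have "y = 1" by force
  hence "\<bar>x\<bar> = e powi n" using epos by (simp add: y_def field_simps)
  hence "x = e powi n \<or> x = - (e powi n)" by linarith
  thus ?thesis using that[of n] unfolding x by (auto simp flip: of_real_power_int of_real_minus)
qed

text \<open>A root would be, up to sign, a unit strictly between 1 and \<open>e\<close>.\<close>

lemma fundamental_not_square:
  assumes L: "subfield_C L" "L \<subseteq> \<real>" and e: "fundamental L e"
  shows "\<not> (\<exists>v\<in>L. v\<^sup>2 = of_real e)"
proof
  have e1: "e > 1" and eu: "of_real e \<in> units_of_field L"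
    and emin: "\<And>v. complex_of_real v \<in> units_of_field L \<Longrightarrow> v > 1 \<Longrightarrow> e \<le> v"
    using e by (auto simp: fundamental_def)
  assume "\<exists>v\<in>L. v\<^sup>2 = of_real e"
  then obtain v where v: "v \<in> L" "v\<^sup>2 = of_real e" by blast
  then obtain x where x: "v = of_real x" using L(2) by (auto elim!: Reals_cases dest!: subsetD)
  have "v \<in> units_of_field L" using units_sqrt[OF L(1) v(1)] v(2) eu by simp
  hence "of_real \<bar>x\<bar> \<in> units_of_field L"
    using units_minus[OF L(1)] unfolding x by (cases "x \<ge> 0") auto
  moreover have xe: "\<bar>x\<bar>\<^sup>2 = e" using v(2) unfolding x by (simp flip: of_real_power)
  moreover have "\<bar>x\<bar> > 1" using xe e1 by (metis abs_ge_zero linorder_not_le power_le_one)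
  ultimately have "e \<le> \<bar>x\<bar>" using emin by blast
  moreover have "\<bar>x\<bar> * 1 < \<bar>x\<bar> * \<bar>x\<bar>"
    by (intro mult_strict_left_mono) (use \<open>\<bar>x\<bar> > 1\<close> in linarith)+
  hence "\<bar>x\<bar> < \<bar>x\<bar>\<^sup>2" by (simp only: power2_eq_square mult_1_right)
  ultimately show False using xe by simp
qed

section \<open>Ramification\<close>

lemma squarefree_dvdI:
  fixes a b :: nat
  assumes "squarefree a" "b > 0" "\<And>r. prime r \<Longrightarrow> r dvd a \<Longrightarrow> r dvd b"
  shows "a dvd b"
proof (rule multiplicity_le_imp_dvd)
  have a0: "a \<noteq> 0" using assms(1) not_squarefree_0 by metis
  thus "a \<noteq> 0" .
  fix r :: nat assume r: "prime r"
  show "multiplicity r a \<le> multiplicity r b"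
  proof (cases "r dvd a")
    case True
    have "multiplicity r a \<le> 1" using assms(1) r squarefree_factorial_semiring''[OF a0] by blast
    moreover have "multiplicity r b > 0"
      using prime_multiplicity_gt_zero_iff[of r b] prime_imp_prime_elem[OF r] assms(2) assms(3)[OF r True] by blast
    ultimately show ?thesis by linarith
  qed (simp add: not_dvd_imp_multiplicity_0)
qed

context biquad
begin

text \<open>\<open>f\<close> fixes the rational number \<open>c\<close>, which therefore cancels:
  the square of the quotient is \<open>f eta / eta\<close>, a unit. So the automorphisms change
  \<open>w\<close> only by units although \<open>w\<close> itself need not be one, which is the mark
  of ramification.\<close>

lemma conjugate_quotient_integral:
  assumes f: "field_aut Kp f" and w: "w \<in> Kp" "w \<noteq> 0" and c: "c \<in> \<rat>"
    and eta: "eta \<in> units_of_field Kp" and eq: "w\<^sup>2 = c * eta"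
  shows "algebraic_int (f w / w)"
proof (rule algebraic_int_sqrtD)
  have "c \<noteq> 0" using w eq by auto
  have "c \<in> Kp" using c subfield_C_Rats[OF subfield_Kp] by blast
  have "(f w)\<^sup>2 = c * f eta"
    using field_aut_power[OF f w(1), of 2] field_aut_mult[OF f \<open>c \<in> Kp\<close> units_in[OF eta]] field_aut_Rats[OF f c] eq by simp
  hence "(f w / w)\<^sup>2 = f eta / eta" using eq \<open>c \<noteq> 0\<close> by (simp add: power_divide)
  moreover have "f eta / eta \<in> units_of_field Kp"
    by (rule units_divide[OF subfield_Kp units_aut[OF f eta] eta])
  ultimately show "algebraic_int ((f w / w)\<^sup>2)" by (simp add: units_algebraic_int)
qed

text \<open>\<open>z\<close> is rational and integral, hence an integer; as \<open>d\<close> is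
  squarefree, \<open>x\<close> is one too, and \<open>r\<close> divides \<open>d * x ^ 2\<close>. It
  will be applied with four times a coordinate of \<open>w\<close> in the place of
  \<open>x\<close>.\<close>

lemma integral_coordinate:
  fixes x z :: complex
  assumes "x \<in> \<rat>" "algebraic_int z" "of_nat d * x\<^sup>2 = of_nat m * z" "squarefree d" "prime r" "r dvd m" "m > 0"
  obtains k :: int where "x = of_int k" "r dvd d \<or> int r dvd k"
proof -
  have "z = of_nat d * x\<^sup>2 / of_nat m" using assms(3,7) by (simp add: field_simps)
  hence "z \<in> \<rat>" using assms(1) by simp
  hence "z \<in> \<int>" by (rule rational_algebraic_int_is_int[OF assms(2)])
  then obtain j where j: "z = of_int j" by (auto elim: Ints_cases)
  have "of_nat d * x\<^sup>2 \<in> \<int>" using assms(3) j by simp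
  hence "x \<in> \<int>" by (rule Rats_squarefree_mult_square[OF assms(1,4)])
  then obtain k where k: "x = of_int k" by (auto elim: Ints_cases)
  have "of_int (int d * k\<^sup>2) = (of_int (int m * j) :: complex)" using assms(3) by (simp add: j k)
  hence "int d * k\<^sup>2 = int m * j" by (simp only: of_int_eq_iff)
  hence "int r dvd int d * k\<^sup>2" using assms(6) by simp
  moreover have pr: "prime (int r)" using assms(5) by simp
  ultimately have "int r dvd int d \<or> int r dvd k\<^sup>2" by (simp only: prime_dvd_mult_iff)
  hence "r dvd d \<or> int r dvd k" using prime_dvd_power[OF pr] by (auto simp only: int_dvd_int_iff)
  with k show ?thesis by (rule that)
qed

text \<open>Every product of two conjugates of w is an integral multiple of m. The coordinates of w are,
  up to the factor 4, sums of conjugates, so their squares are divisible by r; unless r is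
  ramified in one of the occurring quadratic fields, r divides 4w and hence r^2 divides m.\<close>

lemma ramified_prime:
  assumes eta: "eta \<in> units_of_field Kp" and ab: "a \<in> \<rat>" "b \<in> \<rat>" "c \<in> \<rat>" "d \<in> \<rat>"
    and w: "w = a + b * R + c * S + d * (R * S)" and eq: "w\<^sup>2 = of_nat m * eta"
    and m: "squarefree m" and r: "prime r" "odd r" "r dvd m"
  shows "(b \<noteq> 0 \<and> r dvd p) \<or> (c \<noteq> 0 \<and> r dvd 2 * q) \<or> (d \<noteq> 0 \<and> r dvd p * (2 * q))"
proof (rule ccontr)
  assume contr: "\<not> ?thesis"
  have m0: "m > 0" using m by (cases m) auto
  have w0: "w \<noteq> 0" using eq m0 units_nonzero[OF eta] by auto
  have wKp: "w \<in> Kp" unfolding w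
    by (intro subfield_C_add[OF subfield_Kp] subfield_C_mult[OF subfield_Kp] R_in(1) S_in(1)
        subsetD[OF subfield_C_Rats[OF subfield_Kp]] ab)
  define r1 r2 r3 where "r1 = sig w / w" and "r2 = tau w / w" and "r3 = sig (tau w) / w"
  have int: "algebraic_int r1" "algebraic_int r2" "algebraic_int r3"
    using conjugate_quotient_integral[OF sig_aut wKp w0 _ eta eq] conjugate_quotient_integral[OF tau_aut wKp w0 _ eta eq]
      conjugate_quotient_integral[OF field_aut_comp[OF sig_aut tau_aut] wKp w0 _ eta eq]
    unfolding r1_def r2_def r3_def by simp_all
  have sw: "sig w = a - b * R + c * S - d * (R * S)" and tw: "tau w = a + b * R - c * S - d * (R * S)"
    unfolding w using sig_coords[OF ab] by simp_all
  have stw: "sig (tau w) = a - b * R - c * S + d * (R * S)"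
    unfolding tw using sig_coords(1)[of a b "- c" "- d"] ab by simp
  have rw: "r1 * w = sig w" "r2 * w = tau w" "r3 * w = sig (tau w)"
    using w0 by (simp_all add: r1_def r2_def r3_def)
  have sq: "of_nat k * (4 * x)\<^sup>2 = of_nat m * (eta * s\<^sup>2)" if "t\<^sup>2 = of_nat k" "4 * x * t = s * w" for x t s k
  proof -
    have "of_nat k * (4 * x)\<^sup>2 = (4 * x * t)\<^sup>2" by (simp add: power_mult_distrib flip: that(1))
    also have "\<dots> = of_nat m * (eta * s\<^sup>2)" by (simp add: that(2) power_mult_distrib eq)
    finally show ?thesis .
  qed
  have intx: "algebraic_int (eta * (1 + r1 + r2 + r3)\<^sup>2)" "algebraic_int (eta * (1 - r1 + r2 - r3)\<^sup>2)"
    "algebraic_int (eta * (1 + r1 - r2 - r3)\<^sup>2)" "algebraic_int (eta * (1 - r1 - r2 + r3)\<^sup>2)"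
    using int units_algebraic_int[OF eta]
    by (intro algebraic_int_mult algebraic_int_power algebraic_int_add algebraic_int_diff; simp)+
  have one: "(1 :: complex)\<^sup>2 = of_nat 1" by simp
  \<comment> \<open>The four sign patterns are the characters of the Galois group of
    \<open>Kp\<close>, each picking out one coordinate. The trivial one belongs to \<open>a\<close>,
    with 1 in the place of a square root, and no prime divides its radicand.\<close>
  have "4 * a * 1 = (1 + r1 + r2 + r3) * w" "4 * b * R = (1 - r1 + r2 - r3) * w"
    "4 * c * S = (1 + r1 - r2 - r3) * w" "4 * d * (R * S) = (1 - r1 - r2 + r3) * w"
    unfolding ring_distribs rw unfolding stw unfolding sw tw by (simp_all add: w algebra_simps)
  note sqs = sq[OF one this(1)] sq[OF R2 this(2)] sq[OF S2 this(3)]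
    sq[OF rt_square[of "p * (2 * q)", folded RS_eq] this(4)]
  have 4: "4 * a \<in> \<rat>" "4 * b \<in> \<rat>" "4 * c \<in> \<rat>" "4 * d \<in> \<rat>" using ab by auto
  obtain A where A: "4 * a = of_int A" "r dvd 1 \<or> int r dvd A"
    using integral_coordinate[OF 4(1) intx(1) sqs(1) squarefree_1 r(1,3) m0] by blast
  obtain B where B: "4 * b = of_int B" "r dvd p \<or> int r dvd B"
    using integral_coordinate[OF 4(2) intx(2) sqs(2) sf_p r(1,3) m0] by blast
  obtain C where C: "4 * c = of_int C" "r dvd 2 * q \<or> int r dvd C"
    using integral_coordinate[OF 4(3) intx(3) sqs(3) sf_2q r(1,3) m0] by blast
  obtain D where D: "4 * d = of_int D" "r dvd p * (2 * q) \<or> int r dvd D"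
    using integral_coordinate[OF 4(4) intx(4) sqs(4) sf_2pq r(1,3) m0] by blast
  have dvA: "int r dvd A" using A(2) prime_gt_1_nat[OF r(1)] by simp
  \<comment> \<open>If \<open>r\<close> divides the radicand, the negated claim makes the coordinate
    vanish; otherwise \<open>integral_coordinate\<close> already gives the divisibility.\<close>
  have dvB: "int r dvd B"
  proof (cases "r dvd p")
    case True
    with contr have "b = 0" by blast
    thus ?thesis using B(1) by simp
  qed (use B(2) in blast)
  have dvC: "int r dvd C"
  proof (cases "r dvd 2 * q")
    case True
    with contr have "c = 0" by blast
    thus ?thesis using C(1) by simp
  qed (use C(2) in blast)
  have dvD: "int r dvd D"
  proof (cases "r dvd p * (2 * q)")
    case True
    with contr have "d = 0" by blast
    thus ?thesis using D(1) by simp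
  qed (use D(2) in blast)
  obtain A' B' C' D' where dv: "A = int r * A'" "B = int r * B'" "C = int r * C'" "D = int r * D'"
    using dvA dvB dvC dvD unfolding dvd_def by metis
  \<comment> \<open>\<open>v\<close> is integral because R and S are, and
    \<open>4 * w = r * v\<close>; dividing the squares by \<open>eta\<close> gives an integer
    quotient of 16 m by the square of \<open>r\<close>.\<close>
  define v where "v = of_int A' + of_int B' * R + of_int C' * S + of_int D' * (R * S)"
  have "algebraic_int R" "algebraic_int S"
    by (rule algebraic_int_sqrtD, simp only: R2 S2 algebraic_int_of_nat)+
  hence vint: "algebraic_int v" unfolding v_def by (intro algebraic_int_add algebraic_int_mult; simp)
  have "4 * w = of_int A + of_int B * R + of_int C * S + of_int D * (R * S)"
    unfolding A(1)[symmetric] B(1)[symmetric] C(1)[symmetric] D(1)[symmetric] by (simp add: w algebra_simps)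
  hence "4 * w = of_nat r * v" by (simp add: dv v_def algebra_simps)
  hence "(4 * w)\<^sup>2 = (of_nat r * v)\<^sup>2" by simp
  hence e16: "16 * of_nat m * eta = (of_nat r)\<^sup>2 * v\<^sup>2" by (simp add: power_mult_distrib eq mult.assoc)
  define z where "z = v\<^sup>2 * inverse eta"
  have zint: "algebraic_int z" unfolding z_def
    using vint units_algebraic_int_inverse[OF eta] by (intro algebraic_int_mult algebraic_int_power)
  have e: "16 * of_nat m = (of_nat r)\<^sup>2 * z"
    using e16 units_nonzero[OF eta] by (simp add: z_def field_simps)
  have r0: "r > 0" using r(1) prime_gt_0_nat by blast
  have "z = 16 * of_nat m / (of_nat r)\<^sup>2" using e r0 by (simp add: field_simps)
  hence "z \<in> \<rat>" by simp
  hence "z \<in> \<int>" by (rule rational_algebraic_int_is_int[OF zint])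
  then obtain k where k: "z = of_int k" by (auto elim: Ints_cases)
  have "of_int (int (16 * m)) = (of_int ((int r)\<^sup>2 * k) :: complex)" using e k by simp
  hence "int (16 * m) = (int r)\<^sup>2 * k" by (simp only: of_int_eq_iff)
  hence "int (r\<^sup>2) dvd int (16 * m)" by simp
  hence dvd16: "r\<^sup>2 dvd 16 * m" by (simp only: int_dvd_int_iff)
  \<comment> \<open>Oddness of \<open>r\<close> removes the factor 16, the square of the 4 left over
    from summing four conjugates.\<close>
  have "coprime r 2" using r(2) by simp
  hence "coprime (r\<^sup>2) (2 ^ 4)" by (simp only: coprime_power_left_iff coprime_power_right_iff simp_thms)
  moreover have "(2 :: nat) ^ 4 = 16" by simp
  ultimately have "coprime (r\<^sup>2) 16" by metis
  hence "r\<^sup>2 dvd m" using coprime_dvd_mult_right_iff[of "r\<^sup>2" 16 m] dvd16 by blast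
  from squarefreeD[OF m this] r(1) show False by simp
qed

section \<open>Square classes of integers in \<open>Kp\<close>\<close>

text \<open>The odd prime factors of the squarefree part of \<open>m\<close> ramify, so this part
  divides 2pq. Since p and 2q are the squares of R and S, dividing by these elements leaves only the
  classes of 1 and 2.\<close>

lemma square_or_twice_square:
  assumes eta: "eta \<in> units_of_field Kp" and w: "w \<in> Kp" and m0: "m > 0" and eq: "w\<^sup>2 = of_nat m * eta"
  shows "(\<exists>v\<in>Kp. v\<^sup>2 = eta) \<or> (\<exists>v\<in>Kp. v\<^sup>2 = 2 * eta)"
proof -
  note L = subfield_Kp
  define n where "n = squarefree_part m"
  define s where "s = square_part m"
  have mn: "m = n * s\<^sup>2" unfolding n_def s_def by (rule squarefree_decompose)
  have s0: "s > 0"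
  proof (rule ccontr)
    assume "\<not> s > 0"
    with mn m0 show False by simp
  qed
  have nsf: "squarefree n" by (simp add: n_def)
  define v where "v = w / of_nat s"
  have v: "v \<in> Kp" unfolding v_def using w L by (intro subfield_C_divide subfield_C_of_nat)
  have veq: "v\<^sup>2 = of_nat n * eta" using eq s0 by (simp add: v_def mn power_divide)
  obtain a b c d where ab: "a \<in> \<rat>" "b \<in> \<rat>" "c \<in> \<rat>" "d \<in> \<rat>" "v = a + b * R + c * S + d * (R * S)"
    using KpE[OF v] .
  have "n dvd p * (2 * q)"
  proof (rule squarefree_dvdI[OF nsf])
    show "p * (2 * q) > 0" using gt1 by linarith
    fix r :: nat assume r: "prime r" "r dvd n"
    show "r dvd p * (2 * q)"
    proof (cases "odd r")
      case True
      from ramified_prime[OF eta ab veq nsf r(1) True r(2)] show ?thesis by auto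
    next
      case False
      hence "r = 2" using r(1) prime_odd_nat[of r] prime_ge_2_nat[of r] by fastforce
      thus ?thesis by simp
    qed
  qed
  then obtain x y where xy: "n = x * y" "x dvd p" "y dvd 2 * q" by (rule dvd_productE)
  from xy(3) obtain y1 y2 where yy: "y = y1 * y2" "y1 dvd 2" "y2 dvd q" by (rule dvd_productE)
  have x: "x = 1 \<or> x = p" using xy(2) p by (auto simp: prime_nat_iff)
  have y1: "y1 = 1 \<or> y1 = 2" using yy(2) by (metis prime_nat_iff two_is_prime_nat)
  have y2: "y2 = 1 \<or> y2 = q" using yy(3) q by (auto simp: prime_nat_iff)
  obtain u where u: "u \<in> Kp" "u\<^sup>2 = of_nat y * eta"
  proof (cases "x = 1")
    case True
    thus ?thesis using that[of v] v veq xy(1) by simp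
  next
    case False
    hence "(v / R)\<^sup>2 = of_nat y * eta" using x R_nz p5 veq xy(1) by (simp add: power_divide R2)
    thus ?thesis using that[of "v / R"] v L R_in(1) subfield_C_divide by blast
  qed
  consider "y = 1" | "y = 2" | "y = q" | "y = 2 * q" using y1 y2 yy(1) by auto
  thus ?thesis
  proof cases
    case 1
    thus ?thesis using u by auto
  next
    case 2
    thus ?thesis using u by auto
  next
    case 3
    \<comment> \<open>Modulo squares q is 2 times 2q, so division by S trades the factor q for
      2.\<close>
    hence "(2 * u / S)\<^sup>2 = 2 * eta" using u q5 by (simp add: power_divide power_mult_distrib S2)
    moreover have "2 * u / S \<in> Kp" using u S_in(1) L by (intro subfield_C_closed)
    ultimately show ?thesis by blast
  next
    case 4
    hence "(u / S)\<^sup>2 = eta" using u q5 by (simp add: power_divide S2)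
    moreover have "u / S \<in> Kp" using u S_in(1) L by (intro subfield_C_divide)
    ultimately show ?thesis by blast
  qed
qed

text \<open>A root of 2 would be a rational multiple of 1, R, S or R S, so 2 would be a rational
  square times 1, p, 2q or 2pq; the radicands being squarefree, none of these is possible.\<close>

lemma two_not_square: "\<not> (\<exists>v\<in>Kp. v\<^sup>2 = 2)"
proof
  assume "\<exists>v\<in>Kp. v\<^sup>2 = 2"
  then obtain v where v: "v \<in> Kp" "v\<^sup>2 = 2" by blast
  \<comment> \<open>From \<open>2 = d * a ^ 2\<close> follows
    \<open>2 * d * (a / 2) ^ 2 = 1\<close>, for the generators 1 and R. The companion
    \<open>no'\<close> treats S and R S, whose squares already contain the factor 2.\<close>
  have no: False if "t\<^sup>2 = of_nat d" "v = a * t" "a \<in> \<rat>" "squarefree (2 * d)" for a t d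
  proof -
    have "d > 0" using that(4) by (cases d) auto
    hence "of_nat (2 * d) * (a / 2 * of_nat d / of_nat d)\<^sup>2 = (a * t)\<^sup>2 / 2"
      by (simp add: power_divide power_mult_distrib that(1))
    also have "\<dots> = 1" using v(2) that(2) by simp
    finally have "of_nat (2 * d) * (a / 2)\<^sup>2 = 1" using \<open>d > 0\<close> by simp
    hence "2 * d = 1" using squarefree_nat_Rats_square[of "a / 2" "2 * d"] that by simp
    thus False by presburger
  qed
  have no': False if "t\<^sup>2 = of_nat (2 * d)" "v = a * t" "a \<in> \<rat>" "squarefree d" "d > 1" for a t d
  proof -
    have "of_nat d * a\<^sup>2 = (a * t)\<^sup>2 / 2" by (simp add: power_mult_distrib that(1))
    also have "\<dots> = 1" using v(2) that(2) by simp
    finally show False using squarefree_nat_Rats_square[of a d] that by simp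
  qed
  have "p * (2 * q) = 2 * p * q" "p * (2 * q) = q * (2 * p)" "p * (2 * q) = p * q * 2" by simp_all
  hence "2 * p dvd p * (2 * q)" "q dvd p * (2 * q)" "p * q dvd p * (2 * q)" by (metis dvd_triv_left)+
  hence sf: "squarefree (2 * p)" "squarefree q" "squarefree (p * q)"
    using squarefree_mono sf_2pq by blast+
  have RS2: "(R * S)\<^sup>2 = of_nat (2 * (p * q))" by (simp add: power_mult_distrib R2 S2)
  have "v\<^sup>2 \<in> \<rat>" using v(2) by simp
  from sqrt_Rats_forms[OF v(1) this] show False
  proof (elim disjE bexE)
    assume "v \<in> \<rat>"
    thus False using no[of 1 1 v] by (simp add: squarefree_prime)
  next
    fix a assume "a \<in> \<rat>" "v = a * R" thus False using no[OF R2 _ _ sf(1)] by metis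
  next
    fix a assume a: "a \<in> \<rat>" "v = a * S"
    show False using no'[OF S2 a(2,1) sf(2)] q5 by simp
  next
    fix a assume a: "a \<in> \<rat>" "v = a * (R * S)"
    show False using no'[OF RS2 a(2,1) sf(3)] p5 q5 less_1_mult[of p q] by simp
  qed
qed

end

section \<open>Units of absolute value one\<close>

context biquad
begin

lemma K_parts:
  assumes "x \<in> K" obtains u v where "u \<in> Kp" "v \<in> Kp" "x = u + v * \<i>"
  using assms unfolding K_def by (auto elim: adjE)

lemma sig_parts:
  assumes "u \<in> Kp" "v \<in> Kp"
  shows "sig (u + v * \<i>) = sig u + sig v * \<i>" "tau (u + v * \<i>) = tau u + tau v * \<i>"
    "cnj (u + v * \<i>) = u + (- v) * \<i>"
proof -
  have K: "u \<in> K" "v \<in> K" "v * \<i> \<in> K"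
    using assms Kp_sub_K ii_in subfield_C_mult[OF subfield_K] by blast+
  show "sig (u + v * \<i>) = sig u + sig v * \<i>" "tau (u + v * \<i>) = tau u + tau v * \<i>"
    using K ii_in by (simp_all add: field_aut_add[OF field_aut_sig] field_aut_mult[OF field_aut_sig] sig_ii
        field_aut_add[OF field_aut_tau] field_aut_mult[OF field_aut_tau] tau_ii)
  have "cnj u = u" "cnj v = v" using assms Kp_Reals by (auto simp: Reals_cnj_iff)
  thus "cnj (u + v * \<i>) = u + (- v) * \<i>" by simp
qed

lemma parts_unique:
  assumes "u \<in> Kp" "v \<in> Kp" "u' \<in> Kp" "v' \<in> Kp" "u + v * \<i> = u' + v' * \<i>"
  shows "u = u'" "v = v'"
  using adj_coords_unique[OF subfield_Kp subfield_adj_ii(2)[OF subfield_Kp Kp_Reals] assms] by auto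

text \<open>For the doubled coordinates A and B, norm 1 reads A^2 + d B^2 = 4. If d is at least 5,
  this forces B = 0, and d = 1 leaves only 1, -1, i, -i. The condition on \<open>d\<close> excludes
  Q(sqrt(-3)), where sixth roots of unity appear.\<close>

lemma imaginary_quadratic_unit:
  assumes ab: "a \<in> \<rat>" "b \<in> \<rat>" and t: "t \<in> \<real>" "t\<^sup>2 = of_nat d" and N: "N = a + b * t * \<i>"
    and int: "algebraic_int N" and norm: "N * cnj N = 1" and sf: "squarefree d" and d: "d = 1 \<or> d \<ge> 5"
  shows "N ^ 4 = 1"
proof -
  have real: "a \<in> \<real>" "b \<in> \<real>" using ab by (auto elim!: Rats_cases')
  hence cN: "cnj N = a - b * t * \<i>" using t by (simp add: N Reals_cnj_iff)
  have "algebraic_int (N + cnj N)" using int by (intro algebraic_int_add) auto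
  moreover have "N + cnj N = 2 * a" unfolding cN by (simp add: N)
  ultimately have "algebraic_int (2 * a)" by simp
  hence "2 * a \<in> \<int>" using ab by (intro rational_algebraic_int_is_int) auto
  then obtain A where A: "2 * a = of_int A" by (auto elim: Ints_cases)
  have "N * cnj N = a\<^sup>2 + b\<^sup>2 * t\<^sup>2"
    unfolding cN by (simp add: N algebra_simps power2_eq_square)
  hence n1: "a\<^sup>2 + of_nat d * b\<^sup>2 = 1" using norm t by (simp add: mult.commute)
  have "(2 * a)\<^sup>2 + of_nat d * (2 * b)\<^sup>2 = 4 * (a\<^sup>2 + of_nat d * b\<^sup>2)"
    by (simp add: power_mult_distrib algebra_simps)
  hence "(2 * a)\<^sup>2 + of_nat d * (2 * b)\<^sup>2 = 4" unfolding n1 by simp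
  hence eq: "of_nat d * (2 * b)\<^sup>2 = of_int (4 - A\<^sup>2)" unfolding A by (simp add: algebra_simps)
  hence "2 * b \<in> \<int>" using Rats_squarefree_mult_square[of "2 * b" d] ab sf by simp
  then obtain B where B: "2 * b = of_int B" by (auto elim: Ints_cases)
  have "of_int (int d * B\<^sup>2) = (of_int (4 - A\<^sup>2) :: complex)" using eq B by simp
  hence AB: "A\<^sup>2 + int d * B\<^sup>2 = 4" by (simp only: of_int_eq_iff)
  have a: "a = of_int A / 2" and b: "b = of_int B / 2" using A B by (simp_all add: eq_divide_eq mult.commute)
  have d0: "int d \<ge> 1" using d by auto
  have "B\<^sup>2 \<le> int d * B\<^sup>2" using d0 by (simp add: mult_le_cancel_right1)
  hence "A\<^sup>2 \<le> 4" "B\<^sup>2 \<le> 4" using AB zero_le_power2[of A] zero_le_power2[of B] by linarith+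
  hence "\<bar>A\<bar> \<le> 2" "\<bar>B\<bar> \<le> 2" using abs_le_square_iff[of A 2] abs_le_square_iff[of B 2] by simp_all
  hence "A \<in> {-2, -1, 0, 1, 2}" "B \<in> {-2, -1, 0, 1, 2}" by auto
  hence cases: "B = 0 \<and> (A = 2 \<or> A = -2) \<or> d = 1 \<and> A = 0 \<and> (B = 2 \<or> B = -2)"
    using AB d by auto
  thus ?thesis
  proof (elim disjE conjE)
    assume "B = 0" "A = 2" thus ?thesis by (simp add: N a b)
  next
    assume "B = 0" "A = -2" thus ?thesis by (simp add: N a b)
  next
    assume *: "d = 1" "A = 0" "B = 2"
    hence "N\<^sup>2 = -1" using t by (simp add: N a b power_mult_distrib)
    hence "(N\<^sup>2)\<^sup>2 = 1" by simp
    thus ?thesis by (simp flip: power_mult)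
  next
    assume *: "d = 1" "A = 0" "B = -2"
    hence "N\<^sup>2 = -1" using t by (simp add: N a b power_mult_distrib)
    hence "(N\<^sup>2)\<^sup>2 = 1" by simp
    thus ?thesis by (simp flip: power_mult)
  qed
qed

text \<open>The fourth power of z is the product of its twisted norms to the four imaginary quadratic
  subfields, whose units are roots of unity.\<close>

lemma norm_one_unit_power:
  assumes z: "z \<in> units_of_field K" and norm: "cmod z = 1"
  shows "z ^ 16 = 1"
proof -
  define z1 z2 z3 where "z1 = sig z" and "z2 = tau z" and "z3 = sig (tau z)"
  note zs = z1_def z2_def z3_def
  have zK: "z \<in> K" using z by (rule units_in)
  have u: "z1 \<in> units_of_field K" "z2 \<in> units_of_field K" "z3 \<in> units_of_field K"
    unfolding zs using z units_aut[OF field_aut_sig] units_aut[OF field_aut_tau] by auto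
  have inK: "z1 \<in> K" "z2 \<in> K" "z3 \<in> K" using u units_in by auto
  have nz: "z \<noteq> 0" "z1 \<noteq> 0" "z2 \<noteq> 0" "z3 \<noteq> 0" using u z units_nonzero by auto
  have s: "sig z1 = z" "sig z2 = z3" "sig z3 = z2" "tau z1 = z3" "tau z2 = z" "tau z3 = z1"
    using zK field_aut_in[OF field_aut_tau zK] field_aut_in[OF field_aut_sig zK]
    by (simp_all add: zs sig_sig tau_tau tau_sig)
  have zc: "z * cnj z = 1" using norm by (simp add: complex_norm_square[symmetric])
  have cz: "cnj x = inverse x" if "x * cnj x = 1" for x using that by (metis inverse_unique)
  \<comment> \<open>Automorphisms commute with complex conjugation, so every conjugate of
    \<open>z\<close> lies on the unit circle as well.\<close>
  have c1: "f z * cnj (f z) = 1" if "field_aut K f" "f (cnj z) = cnj (f z)" for f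
    using field_aut_mult[OF that(1) zK field_aut_in[OF field_aut_cnj zK]] that zc by (simp add: field_aut_1[OF that(1)])
  have cj: "cnj z = inverse z" "cnj z1 = inverse z1" "cnj z2 = inverse z2" "cnj z3 = inverse z3"
    using cz[OF zc] cz[OF c1[OF field_aut_sig sig_cnj[OF zK]]] cz[OF c1[OF field_aut_tau tau_cnj[OF zK]]]
      cz[OF c1[OF field_aut_comp[OF field_aut_sig field_aut_tau]]]
      tau_cnj[OF zK] sig_cnj[OF field_aut_in[OF field_aut_tau zK]] by (simp_all add: zs)
  \<comment> \<open>Norms to Q(i), Q(sqrt(-p)), Q(sqrt(-2q)) and Q(sqrt(-2pq)): on the unit circle
    dividing by a conjugate amounts to multiplying by its complex conjugate. In the product of all
    four the powers of \<open>z1\<close>, \<open>z2\<close> and \<open>z3\<close> cancel.\<close>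
  define N0 N1 N2 N3 where "N0 = z * z1 * z2 * z3" and "N1 = (z * z2) / (z1 * z3)"
    and "N2 = (z * z1) / (z2 * z3)" and "N3 = (z * z3) / (z1 * z2)"
  note Ns = N0_def N1_def N2_def N3_def
  have NU: "N0 \<in> units_of_field K" "N1 \<in> units_of_field K" "N2 \<in> units_of_field K" "N3 \<in> units_of_field K"
    unfolding Ns using u z subfield_K by (auto intro!: units_mult units_divide)
  have NK: "N0 \<in> K" "N1 \<in> K" "N2 \<in> K" "N3 \<in> K" using NU units_in by auto
  have NI: "algebraic_int N0" "algebraic_int N1" "algebraic_int N2" "algebraic_int N3"
    using NU units_algebraic_int by auto
  have m: "x * y \<in> K" if "x \<in> K" "y \<in> K" for x y using that subfield_K by (rule_tac subfield_C_mult)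
  have Nc: "N0 * cnj N0 = 1" "N1 * cnj N1 = 1" "N2 * cnj N2 = 1" "N3 * cnj N3 = 1"
    using nz by (simp_all add: Ns cj field_simps)
  have cN: "cnj N0 = inverse N0" "cnj N1 = inverse N1" "cnj N2 = inverse N2" "cnj N3 = inverse N3"
    using Nc cz by auto
  note hom = field_aut_mult[OF field_aut_sig] field_aut_mult[OF field_aut_tau]
    field_aut_divide[OF field_aut_sig] field_aut_divide[OF field_aut_tau]
  have sN: "sig N0 = N0" "tau N0 = N0" "sig N1 = cnj N1" "tau N1 = N1"
    "sig N2 = N2" "tau N2 = cnj N2" "sig N3 = cnj N3" "tau N3 = cnj N3"
    unfolding cN unfolding Ns using zK inK by (simp_all add: hom m s z1_def[symmetric] z2_def[symmetric] mult_ac)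
  have "N0 ^ 4 = 1"
  proof -
    obtain u v where uv: "u \<in> Kp" "v \<in> Kp" "N0 = u + v * \<i>" using K_parts[OF NK(1)] .
    have "sig u = u" "sig v = v"
      using parts_unique[OF sig_Kp[OF uv(1)] sig_Kp[OF uv(2)] uv(1,2)] sig_parts(1)[OF uv(1,2)] sN(1) uv(3) by auto
    moreover have "tau u = u" "tau v = v"
      using parts_unique[OF tau_Kp[OF uv(1)] tau_Kp[OF uv(2)] uv(1,2)] sig_parts(2)[OF uv(1,2)] sN(2) uv(3) by auto
    ultimately have "u \<in> \<rat>" "v \<in> \<rat>" using fixed_fields(4) uv by auto
    thus ?thesis using imaginary_quadratic_unit[of u v 1 1 N0] uv NI(1) Nc(1) by simp
  qed
  moreover have "N1 ^ 4 = 1"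
  proof -
    obtain u v where uv: "u \<in> Kp" "v \<in> Kp" "N1 = u + v * \<i>" using K_parts[OF NK(2)] .
    note mv = subfield_C_minus[OF subfield_Kp uv(2)]
    \<comment> \<open>On \<open>N1\<close> the automorphism \<open>sig\<close> acts as complex
      conjugation, so it fixes the real part and negates the imaginary part, while
      \<open>tau\<close> fixes both; hence the imaginary part is a rational multiple of R. The next
      two norms are treated alike.\<close>
    have "sig u = u" "sig v = - v"
      using parts_unique[OF sig_Kp[OF uv(1)] sig_Kp[OF uv(2)] uv(1) mv] sig_parts(1,3)[OF uv(1,2)] sN(3) uv(3) by auto
    moreover have "tau u = u" "tau v = v"
      using parts_unique[OF tau_Kp[OF uv(1)] tau_Kp[OF uv(2)] uv(1,2)] sig_parts(2)[OF uv(1,2)] sN(4) uv(3) by auto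
    ultimately have "u \<in> \<rat>" "\<exists>a\<in>\<rat>. v = a * R" using fixed_fields(4,6) uv by auto
    thus ?thesis using imaginary_quadratic_unit[of u _ R p N1] R_Real R2 uv NI(2) Nc(2) sf_p p5 by auto
  qed
  moreover have "N2 ^ 4 = 1"
  proof -
    obtain u v where uv: "u \<in> Kp" "v \<in> Kp" "N2 = u + v * \<i>" using K_parts[OF NK(3)] .
    note mv = subfield_C_minus[OF subfield_Kp uv(2)]
    have "sig u = u" "sig v = v"
      using parts_unique[OF sig_Kp[OF uv(1)] sig_Kp[OF uv(2)] uv(1,2)] sig_parts(1)[OF uv(1,2)] sN(5) uv(3) by auto
    moreover have "tau u = u" "tau v = - v"
      using parts_unique[OF tau_Kp[OF uv(1)] tau_Kp[OF uv(2)] uv(1) mv] sig_parts(2,3)[OF uv(1,2)] sN(6) uv(3) by auto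
    ultimately have "u \<in> \<rat>" "\<exists>a\<in>\<rat>. v = a * S" using fixed_fields(4,5) uv by auto
    thus ?thesis using imaginary_quadratic_unit[of u _ S "2 * q" N2] S_Real S2 uv NI(3) Nc(3) sf_2q q5 by auto
  qed
  moreover have "N3 ^ 4 = 1"
  proof -
    obtain u v where uv: "u \<in> Kp" "v \<in> Kp" "N3 = u + v * \<i>" using K_parts[OF NK(4)] .
    note mv = subfield_C_minus[OF subfield_Kp uv(2)]
    have "sig u = u" "sig v = - v"
      using parts_unique[OF sig_Kp[OF uv(1)] sig_Kp[OF uv(2)] uv(1) mv] sig_parts(1,3)[OF uv(1,2)] sN(7) uv(3) by auto
    moreover have "tau u = u" "tau v = - v"
      using parts_unique[OF tau_Kp[OF uv(1)] tau_Kp[OF uv(2)] uv(1) mv] sig_parts(2,3)[OF uv(1,2)] sN(8) uv(3) by auto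
    ultimately have uQ: "u \<in> \<rat>" and "\<exists>a\<in>\<rat>. v = a * (R * S)" using fixed_fields(4,7) uv by auto
    then obtain a where a: "a \<in> \<rat>" "v = a * (R * S)" by blast
    have "p * (2 * q) \<ge> 5" using p5 q5 mult_le_mono[of 5 p 1 "2 * q"] by simp
    thus ?thesis
      using imaginary_quadratic_unit[OF uQ a(1) _ _ _ NI(4) Nc(4) sf_2pq, of "R * S"] R_Real S_Real uv(3) a(2)
        rt_square[of "p * (2 * q)", folded RS_eq] by simp
  qed
  moreover have "z ^ 4 = N0 * N1 * N2 * N3"
    using nz by (simp add: Ns field_simps power4_eq_xxxx)
  hence "(z ^ 4) ^ 4 = N0 ^ 4 * N1 ^ 4 * N2 ^ 4 * N3 ^ 4" by (simp only: power_mult_distrib)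
  ultimately have "(z ^ 4) ^ 4 = 1" by simp
  thus ?thesis by (simp flip: power_mult)
qed

section \<open>The roots of unity of \<open>K\<close> and the shape of its units\<close>

text \<open>For a primitive eighth root of unity \<open>u\<close>, the sum of \<open>u\<close> and
  its inverse is a real square root of 2, which would then lie in \<open>Kp\<close>.\<close>

lemma no_primitive_eighth_root:
  assumes "u \<in> K" shows "u ^ 4 \<noteq> -1"
proof
  assume u4: "u ^ 4 = -1"
  hence u0: "u \<noteq> 0" by auto
  define v where "v = u + inverse u"
  have "u\<^sup>2 * u\<^sup>2 = u ^ (2 + 2)" by (simp only: power_add)
  hence "u\<^sup>2 * - (u\<^sup>2) = 1" using u4 by simp
  hence iu: "(inverse u)\<^sup>2 = - (u\<^sup>2)" unfolding power_inverse by (rule inverse_unique)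
  have "v\<^sup>2 = u\<^sup>2 + 2 * (u * inverse u) + (inverse u)\<^sup>2" by (simp add: v_def power2_eq_square algebra_simps)
  hence v2: "v\<^sup>2 = 2" using u0 iu by simp
  have "(v - rt 2) * (v + rt 2) = 0" using v2 rt_square[of 2] by (simp add: algebra_simps power2_eq_square)
  hence "v \<in> \<real>" by (auto simp: add_eq_0_iff2)
  moreover have "v \<in> K" unfolding v_def using assms subfield_K by (auto intro: subfield_C_closed)
  ultimately show False using two_not_square v2 Kp_iff by blast
qed

text \<open>The exponent 16 is halved twice: a value -1 of \<open>z ^ 8\<close> or
  \<open>z ^ 4\<close> would make \<open>z ^ 2\<close> or \<open>z\<close> a primitive eighth root
  of unity.\<close>

lemma norm_one_unit:
  assumes z: "z \<in> units_of_field K" "cmod z = 1"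
  shows "z = 1 \<or> z = -1 \<or> z = \<i> \<or> z = -\<i>"
proof -
  have zK: "z \<in> K" "z\<^sup>2 \<in> K" using units_in[OF z(1)] subfield_C_power[OF subfield_K] by auto
  have sq: "x = 1 \<or> x = -1" if "x\<^sup>2 = 1" for x :: complex using that by (simp add: power2_eq_1_iff)
  have "(z ^ 8)\<^sup>2 = 1" using norm_one_unit_power[OF z] by (simp flip: power_mult)
  moreover have "z ^ 8 \<noteq> -1" using no_primitive_eighth_root[OF zK(2)] by (simp flip: power_mult)
  ultimately have "z ^ 8 = 1" using sq by blast
  hence "(z ^ 4)\<^sup>2 = 1" by (simp flip: power_mult)
  hence "z ^ 4 = 1" using no_primitive_eighth_root[OF zK(1)] sq by blast
  hence "(z\<^sup>2)\<^sup>2 = 1" by (simp flip: power_mult)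
  hence "z\<^sup>2 = 1 \<or> z\<^sup>2 = -1" using sq by blast
  thus ?thesis
  proof
    assume "z\<^sup>2 = -1"
    hence "z\<^sup>2 = \<i>\<^sup>2" by simp
    thus ?thesis by (simp only: power2_eq_iff) auto
  qed (use sq in auto)
qed

lemma roots_of_unity_K: "z \<in> units_of_field K \<Longrightarrow> cmod z = 1 \<Longrightarrow> z \<in> roots_of_unity K"
  unfolding roots_of_unity_def using norm_one_unit_power[of z] units_in[of z K] by (auto intro: exI[of _ 16])

lemma roots_of_unity_Kp:
  assumes "z \<in> units_of_field Kp" "cmod z = 1" shows "z \<in> roots_of_unity Kp"
  unfolding roots_of_unity_def
  using norm_one_unit_power[OF units_mono[OF subfield_Kp subfield_K Kp_sub_K assms(1)] assms(2)] units_in[OF assms(1)]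
  by (auto intro: exI[of _ 16])

text \<open>The unit \<open>e / cnj e\<close> has absolute value 1 and is therefore 1, -1, i or -i.
  The last two values put \<open>e\<close> on a diagonal of the complex plane, from which 1 - i or 1
  + i turns it to the real axis; the squared modulus of these factors is the 2 in the
  statement.\<close>

lemma unit_conj_cases:
  assumes e: "e \<in> units_of_field K"
  shows "e\<^sup>2 \<in> \<real> \<or> cnj (e\<^sup>2) = - (e\<^sup>2) \<and> (\<exists>w\<in>Kp. w\<^sup>2 = 2 * (e * cnj e))"
proof -
  have eK: "e \<in> K" and e0: "e \<noteq> 0" using e units_in units_nonzero by auto
  have ce: "cnj e \<in> units_of_field K" by (rule units_aut[OF field_aut_cnj e])
  have "e / cnj e \<in> units_of_field K" using units_divide[OF subfield_K e ce] .
  moreover have "cmod (e / cnj e) = 1" using e0 by (simp add: norm_divide)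
  ultimately have "e / cnj e = 1 \<or> e / cnj e = -1 \<or> e / cnj e = \<i> \<or> e / cnj e = -\<i>" by (rule norm_one_unit)
  hence "e = cnj e \<or> e = - cnj e \<or> e = \<i> * cnj e \<or> e = - \<i> * cnj e"
    using e0 by (auto simp: field_simps)
  thus ?thesis
  proof (elim disjE)
    assume "e = cnj e"
    hence "e \<in> \<real>" by (simp add: Reals_cnj_iff)
    thus ?thesis by simp
  next
    assume "e = - cnj e"
    hence "cnj (e\<^sup>2) = e\<^sup>2" by (metis complex_cnj_power power2_minus)
    thus ?thesis by (simp add: Reals_cnj_iff)
  next
    assume *: "e = \<i> * cnj e"
    define w where "w = (1 - \<i>) * e"
    have "cnj w = w" unfolding w_def by (subst (2) *) (simp add: algebra_simps)
    moreover have "w \<in> K" unfolding w_def using eK ii_in subfield_K by (auto intro!: subfield_C_closed)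
    ultimately have "w \<in> Kp" by (simp add: Kp_iff Reals_cnj_iff)
    moreover have "w\<^sup>2 = -2 * \<i> * e * e" by (simp add: w_def power2_eq_square algebra_simps)
    hence "w\<^sup>2 = 2 * (e * cnj e)" by (subst (asm) (2) *) (simp add: algebra_simps)
    moreover have "cnj (e\<^sup>2) = - (e\<^sup>2)" by (subst (2) *) (simp add: power_mult_distrib)
    ultimately show ?thesis by blast
  next
    assume *: "e = - \<i> * cnj e"
    define w where "w = (1 + \<i>) * e"
    have "cnj w = w" unfolding w_def by (subst (2) *) (simp add: algebra_simps)
    moreover have "w \<in> K" unfolding w_def using eK ii_in subfield_K by (auto intro!: subfield_C_closed)
    ultimately have "w \<in> Kp" by (simp add: Kp_iff Reals_cnj_iff)
    moreover have "w\<^sup>2 = 2 * \<i> * e * e" by (simp add: w_def power2_eq_square algebra_simps)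
    hence "w\<^sup>2 = 2 * (e * cnj e)" by (subst (asm) (2) *) (simp add: algebra_simps)
    moreover have "cnj (e\<^sup>2) = - (e\<^sup>2)" by (subst (2) *) (simp add: power_mult_distrib)
    ultimately show ?thesis by blast
  qed
qed

text \<open>A real square leaves \<open>e\<close> real or purely imaginary, and in the second case
  the root of unity -i is split off.\<close>

lemma real_square_unit:
  assumes e: "e \<in> units_of_field K" "e\<^sup>2 \<in> \<real>"
  obtains w u where "w \<in> roots_of_unity K" "u \<in> units_of_field Kp" "e = w * u"
proof -
  have eK: "e \<in> K" using e units_in by auto
  have ii: "\<i> \<in> units_of_field K" using ii_in by (simp add: units_of_field_iff[OF subfield_K])
  have rou: "1 \<in> roots_of_unity K" "- \<i> \<in> roots_of_unity K"
    using roots_of_unity_K units_1[OF subfield_K] units_minus[OF subfield_K ii] by auto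
  have "Re e = 0 \<or> Im e = 0" using e(2) by (auto simp: complex_is_Real_iff power2_eq_square)
  thus ?thesis
  proof
    assume "Im e = 0"
    hence "e \<in> Kp" using eK by (simp add: Kp_iff complex_is_Real_iff)
    hence "e \<in> units_of_field Kp" using units_subfield[OF subfield_Kp subfield_K e(1)] by simp
    thus ?thesis using that[OF rou(1)] by simp
  next
    assume *: "Re e = 0"
    have "\<i> * e \<in> units_of_field K" using units_mult[OF subfield_K ii e(1)] .
    moreover have "\<i> * e \<in> Kp" using * units_in[OF calculation] by (simp add: Kp_iff complex_is_Real_iff)
    ultimately have "\<i> * e \<in> units_of_field Kp" using units_subfield[OF subfield_Kp subfield_K] by blast
    thus ?thesis using that[OF rou(2)] by simp
  qed
qed

lemma roots_of_unity_units:
  assumes "subfield_C L" "w \<in> roots_of_unity L" shows "w \<in> units_of_field L"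
proof -
  obtain n where n: "n > 0" "w ^ n = 1" "w \<in> L" using assms(2) by (auto simp: roots_of_unity_def)
  hence inv: "inverse w ^ n = 1" by (simp add: power_inverse)
  have "algebraic_int x" if "x ^ n = 1" for x :: complex
    by (rule algebraic_int_root[of 1 "monom 1 n"]) (use n that in \<open>auto simp: poly_monom degree_monom_eq\<close>)
  with n inv show ?thesis by (auto simp: units_of_field_iff[OF assms(1)] power_0_left)
qed

section \<open>The Hasse unit index\<close>

text \<open>A description of the subgroup by squares, which turns equality of cosets into a question
  about the square of a quotient.\<close>

lemma units_generated_eq:
  "{w * u | w u. w \<in> roots_of_unity K \<and> u \<in> units_of_field Kp} = {e \<in> units_of_field K. e\<^sup>2 \<in> \<real>}"
proof (intro equalityI subsetI)
  fix e assume "e \<in> {w * u | w u. w \<in> roots_of_unity K \<and> u \<in> units_of_field Kp}"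
  then obtain w u where e: "e = w * u" and w: "w \<in> roots_of_unity K" and u: "u \<in> units_of_field Kp" by blast
  have wU: "w \<in> units_of_field K" using roots_of_unity_units[OF subfield_K w] .
  have "w\<^sup>2 = 1 \<or> w\<^sup>2 = -1" using norm_one_unit[OF wU roots_of_unity_norm[OF w]] by auto
  moreover have "u \<in> \<real>" using u units_in Kp_Reals by blast
  ultimately have "e\<^sup>2 \<in> \<real>" by (auto simp: e power_mult_distrib)
  moreover have "e \<in> units_of_field K"
    unfolding e by (rule units_mult[OF subfield_K wU units_mono[OF subfield_Kp subfield_K Kp_sub_K u]])
  ultimately show "e \<in> {e \<in> units_of_field K. e\<^sup>2 \<in> \<real>}" by blast
next
  fix e assume "e \<in> {e \<in> units_of_field K. e\<^sup>2 \<in> \<real>}"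
  thus "e \<in> {w * u | w u. w \<in> roots_of_unity K \<and> u \<in> units_of_field Kp}"
    using real_square_unit[of e] by blast
qed

lemma coset_real_square:
  assumes t: "t \<in> units_of_field K"
  shows "(*) t ` {e \<in> units_of_field K. e\<^sup>2 \<in> \<real>} = {e \<in> units_of_field K. (e / t)\<^sup>2 \<in> \<real>}"
proof (intro equalityI subsetI)
  fix e assume "e \<in> (*) t ` {e \<in> units_of_field K. e\<^sup>2 \<in> \<real>}"
  thus "e \<in> {e \<in> units_of_field K. (e / t)\<^sup>2 \<in> \<real>}"
    using units_mult[OF subfield_K t] units_nonzero[OF t] by auto
next
  fix e assume "e \<in> {e \<in> units_of_field K. (e / t)\<^sup>2 \<in> \<real>}"
  thus "e \<in> (*) t ` {e \<in> units_of_field K. e\<^sup>2 \<in> \<real>}"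
    using units_divide[OF subfield_K _ t] units_nonzero[OF t] by (intro image_eqI[of _ _ "e / t"]) auto
qed

lemma hasse_index_1:
  assumes "\<And>e. e \<in> units_of_field K \<Longrightarrow> e\<^sup>2 \<in> \<real>"
  shows "hasse_unit_index K Kp = 1"
proof -
  have "(*) t ` {e \<in> units_of_field K. e\<^sup>2 \<in> \<real>} = units_of_field K" if "t \<in> units_of_field K" for t
    unfolding coset_real_square[OF that] using assms units_divide[OF subfield_K _ that] by blast
  hence "(\<lambda>t. (*) t ` {e \<in> units_of_field K. e\<^sup>2 \<in> \<real>}) ` units_of_field K = {units_of_field K}"
    using units_1[OF subfield_K] by auto
  thus ?thesis unfolding hasse_unit_index_def units_generated_eq by simp
qed

text \<open>Squares of units of \<open>K\<close> are real or purely imaginary, and the quotient of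
  two imaginary ones is real. So there are at most two cosets, and \<open>t\<close> exhibits the
  second.\<close>

lemma hasse_index_2:
  assumes t: "t \<in> units_of_field K" "t\<^sup>2 \<notin> \<real>"
  shows "hasse_unit_index K Kp = 2"
proof -
  define H where "H = {e \<in> units_of_field K. e\<^sup>2 \<in> \<real>}"
  have imag: "cnj (e\<^sup>2) = - (e\<^sup>2)" if "e \<in> units_of_field K" "e\<^sup>2 \<notin> \<real>" for e
    using unit_conj_cases[OF that(1)] that(2) by blast
  have coset: "(*) e ` H = {x \<in> units_of_field K. x\<^sup>2 \<in> \<real> \<longleftrightarrow> e\<^sup>2 \<in> \<real>}" if e: "e \<in> units_of_field K" for e
  proof -
    have "(x / e)\<^sup>2 \<in> \<real> \<longleftrightarrow> (x\<^sup>2 \<in> \<real> \<longleftrightarrow> e\<^sup>2 \<in> \<real>)" if x: "x \<in> units_of_field K" for x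
    proof -
      have nz: "e\<^sup>2 \<noteq> 0" "x\<^sup>2 \<noteq> 0" using e x units_nonzero by auto
      have d: "(x / e)\<^sup>2 = x\<^sup>2 / e\<^sup>2" by (simp add: power_divide)
      have R: "z \<in> \<real> \<longleftrightarrow> cnj z = z" for z by (simp add: Reals_cnj_iff)
      have ng: "- z \<noteq> z" if "z \<noteq> 0" for z :: complex using that by simp
      show ?thesis
        using imag[OF e] imag[OF x] ng[OF nz(1)] ng[OF nz(2)] nz unfolding d R complex_cnj_divide
        by (cases "cnj (e\<^sup>2) = e\<^sup>2"; cases "cnj (x\<^sup>2) = x\<^sup>2") (simp_all del: complex_cnj_power)
    qed
    thus ?thesis unfolding H_def coset_real_square[OF e] by blast
  qed
  have one: "1 \<in> units_of_field K" by (rule units_1[OF subfield_K])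
  define A B where "A = {x \<in> units_of_field K. x\<^sup>2 \<in> \<real>}" and "B = {x \<in> units_of_field K. x\<^sup>2 \<notin> \<real>}"
  have c: "(*) e ` H = (if e\<^sup>2 \<in> \<real> then A else B)" if "e \<in> units_of_field K" for e
    unfolding coset[OF that] A_def B_def by auto
  have "(\<lambda>e. (*) e ` H) ` units_of_field K = {A, B}"
  proof (intro equalityI subsetI)
    fix X assume "X \<in> {A, B}"
    moreover have "A = (*) 1 ` H" using c[OF one] by simp
    moreover have "B = (*) t ` H" using c[OF t(1)] t(2) by simp
    ultimately show "X \<in> (\<lambda>e. (*) e ` H) ` units_of_field K" using one t(1) by blast
  qed (use c in auto)
  moreover have "A \<noteq> B" using t unfolding A_def B_def by blast
  ultimately show ?thesis unfolding hasse_unit_index_def units_generated_eq H_def[symmetric] by simp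
qed

end

section \<open>Squares modulo the fundamental units\<close>

lemma units_Rats: assumes "x \<in> units_of_field L" "x \<in> \<rat>" shows "x = 1 \<or> x = -1"
proof -
  have "x \<in> \<int>" "inverse x \<in> \<int>"
    using assms units_algebraic_int[OF assms(1)] units_algebraic_int_inverse[OF assms(1)]
    by (auto intro!: rational_algebraic_int_is_int)
  then obtain j k where jk: "x = of_int j" "inverse x = of_int k" by (auto elim!: Ints_cases)
  have "of_int (j * k) = (of_int 1 :: complex)" using jk units_nonzero[OF assms(1)] by (metis of_int_1 of_int_mult right_inverse)
  hence "j * k = 1" by (simp only: of_int_eq_iff)
  hence "j = 1 \<or> j = -1" using zmult_eq_1_iff by blast
  thus ?thesis using jk by auto
qed

text \<open>Squares are 0 or 1 modulo 4 and \<open>p\<close> is 1, so X^2 - p Y^2 is never 2 modulo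
  4.\<close>

lemma no_square_difference_two:
  fixes X Y :: int
  assumes "p mod 4 = (1 :: nat)"
  shows "X\<^sup>2 \<noteq> int p * Y\<^sup>2 + 2" "int p * Y\<^sup>2 \<noteq> X\<^sup>2 + 2"
proof -
  have sq: "Z\<^sup>2 mod 4 = 0 \<or> Z\<^sup>2 mod 4 = 1" for Z :: int
  proof (cases "even Z")
    case True
    then obtain k where "Z = 2 * k" by blast
    thus ?thesis by (simp add: power_mult_distrib)
  next
    case False
    then obtain k where "Z = 2 * k + 1" by (elim oddE)
    hence "Z\<^sup>2 = 4 * (k\<^sup>2 + k) + 1" by (simp add: power2_eq_square algebra_simps)
    thus ?thesis by presburger
  qed
  have "int p mod 4 = 1" using assms by presburger
  hence "(int p * Y\<^sup>2) mod 4 = Y\<^sup>2 mod 4" by (metis mod_mult_left_eq mult_1)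
  with sq[of X] sq[of Y] show "X\<^sup>2 \<noteq> int p * Y\<^sup>2 + 2" "int p * Y\<^sup>2 \<noteq> X\<^sup>2 + 2" by presburger+
qed

context biquad
begin

section \<open>The fundamental unit of Q(sqrt p) has norm -1\<close>

text \<open>Norm 1 would make (E + 1)^2 a positive integer multiple of E, and by ramification the
  squarefree part of the multiplier divides 2p. If that part is odd, E is a square in
  \<open>k1\<close>, against minimality; if it is even, X^2 - p Y^2 takes the value 2 or -2,
  impossible modulo 4.\<close>

lemma fundamental_norm_k1:
  assumes e: "fundamental k1 e"
  shows "of_real e * sig (of_real e) = -1"
proof -
  define E where "E = complex_of_real e"
  have e1: "e > 1" and EU: "E \<in> units_of_field k1" using e by (auto simp: fundamental_def E_def)
  have Ek: "E \<in> k1" using units_in EU by auto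
  have EKp: "E \<in> Kp" using Ek k1_sub_Kp by blast
  have EUp: "E \<in> units_of_field Kp" using units_mono[OF subfield_k(1) subfield_Kp k1_sub_Kp EU] .
  obtain \<alpha> \<beta> where ab: "\<alpha> \<in> \<rat>" "\<beta> \<in> \<rat>" "E = \<alpha> + \<beta> * R" using Ek unfolding k1_def by (auto elim: adjE)
  have sE: "sig E = \<alpha> - \<beta> * R" using sig_coords(1)[of \<alpha> \<beta> 0 0] ab by simp
  have "E * sig E = \<alpha>\<^sup>2 - \<beta>\<^sup>2 * R\<^sup>2" unfolding sE by (simp add: ab(3) algebra_simps power2_eq_square)
  hence "E * sig E \<in> \<rat>" using ab R2_Rats by simp
  moreover have "E * sig E \<in> units_of_field Kp" using units_mult[OF subfield_Kp EUp units_aut[OF sig_aut EUp]] .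
  ultimately have "E * sig E = 1 \<or> E * sig E = -1" using units_Rats by blast
  moreover have "E * sig E \<noteq> 1"
  proof
    assume N: "E * sig E = 1"
    have tr: "E + sig E = 2 * \<alpha>" unfolding sE by (simp add: ab(3))
    have "algebraic_int (E + sig E)"
      using units_algebraic_int[OF EUp] units_algebraic_int[OF units_aut[OF sig_aut EUp]] by (rule algebraic_int_add)
    hence "2 * \<alpha> \<in> \<int>" unfolding tr using ab by (intro rational_algebraic_int_is_int) auto
    then obtain k where k: "2 * \<alpha> = of_int k" by (auto elim: Ints_cases)
    have iE: "sig E = inverse E" using N by (metis inverse_unique)
    have "complex_of_real (e + inverse e) = of_real (real_of_int k)" using tr iE k by (simp add: E_def)
    hence ke: "e + inverse e = of_int k" by (simp only: of_real_eq_iff)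
    have k0: "k > 0"
    proof -
      have "e + inverse e > 0" using e1 by (simp add: add_pos_pos)
      thus ?thesis unfolding ke by simp
    qed
    \<comment> \<open>The trace plus 2: as \<open>E * sig E = 1\<close>, the square of
      \<open>E + 1\<close> is \<open>E\<close> times \<open>E + sig E + 2\<close>.\<close>
    define m where "m = nat (k + 2)"
    have m: "int m = k + 2" "m > 0" using k0 by (auto simp: m_def)
    have mc: "of_nat m = (of_int (k + 2) :: complex)" using m(1) by (metis of_int_of_nat_eq)
    have plus: "(E + 1)\<^sup>2 = of_nat m * E"
    proof -
      have "of_nat m * E = (E + sig E) * E + 2 * E" using tr k by (simp add: mc algebra_simps)
      thus ?thesis using N by (simp add: power2_eq_square algebra_simps)
    qed
    define n where "n = squarefree_part m"
    define s where "s = square_part m"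
    have mn: "m = n * s\<^sup>2" unfolding n_def s_def by (rule squarefree_decompose)
    have s0: "s > 0"
    proof (rule ccontr)
      assume "\<not> s > 0"
      with mn m(2) show False by simp
    qed
    have nsf: "squarefree n" by (simp add: n_def)
    define v where "v = (E + 1) / of_nat s"
    have vk: "v \<in> k1" unfolding v_def
      using Ek subfield_k(1) by (intro subfield_C_divide subfield_C_add subfield_C_of_nat subfield_C_1)
    have veq: "v\<^sup>2 = of_nat n * E" unfolding v_def power_divide plus using s0 by (simp add: mn)
    obtain a b where v: "a \<in> \<rat>" "b \<in> \<rat>" "v = a + b * R" using vk unfolding k1_def by (auto elim: adjE)
    have n2p: "n dvd 2 * p"
    proof (rule squarefree_dvdI[OF nsf])
      show "2 * p > 0" using p5 by simp
      fix r :: nat assume r: "prime r" "r dvd n"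
      show "r dvd 2 * p"
      proof (cases "odd r")
        case True
        from ramified_prime[OF EUp v(1,2) Rats_0 Rats_0 _ veq nsf r(1) True r(2)] v(3) show ?thesis by simp
      next
        case False
        hence "r = 2" using r(1) prime_odd_nat[of r] prime_ge_2_nat[of r] by fastforce
        thus ?thesis by simp
      qed
    qed
    then obtain x y where xy: "n = x * y" "x dvd 2" "y dvd p" by (rule dvd_productE)
    have x: "x = 1 \<or> x = 2" using xy(2) by (metis prime_nat_iff two_is_prime_nat)
    have y: "y = 1 \<or> y = p" using xy(3) p by (auto simp: prime_nat_iff)
    have "x \<noteq> 1"
    proof
      assume x1: "x = 1"
      have "\<exists>u\<in>k1. u\<^sup>2 = E" using y
      proof
        assume "y = 1"
        thus ?thesis using vk veq xy(1) x1 by auto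
      next
        assume "y = p"
        hence "(v / R)\<^sup>2 = E" using p5 unfolding power_divide veq R2 by (simp add: xy(1) x1)
        thus ?thesis using subfield_C_divide[OF subfield_k(1) vk R_in(2)] by blast
      qed
      thus False using fundamental_not_square[OF subfield_k(1) k_Reals(1) e] by (simp add: E_def)
    qed
    hence x2: "x = 2" using x by blast
    \<comment> \<open>The discriminant trace^2 - 4 factors as m (m - 4). Inserting m = 2 s^2 or m =
      2 p s^2 turns the second factor into twice a difference from 2.\<close>
    have "(E - sig E)\<^sup>2 = (E + sig E)\<^sup>2 - 4 * (E * sig E)" by (simp add: power2_eq_square algebra_simps)
    moreover have "E - sig E = 2 * \<beta> * R" unfolding sE by (simp add: ab(3))
    ultimately have "(2 * \<beta> * R)\<^sup>2 = (of_int k)\<^sup>2 - 4" unfolding tr k N by simp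
    moreover have "(2 * \<beta> * R)\<^sup>2 = 4 * (of_nat p * \<beta>\<^sup>2)" by (simp add: power_mult_distrib R2)
    moreover have "(of_int k)\<^sup>2 - 4 = (of_nat m * (of_nat m - 4) :: complex)"
      unfolding mc by (simp add: algebra_simps power2_eq_square)
    ultimately have disc: "4 * (of_nat p * \<beta>\<^sup>2) = of_nat m * (of_nat m - 4)" by simp
    \<comment> \<open>The coordinate \<open>\<beta>\<close> may be half an integer. After division
      by \<open>s\<close> the equation itself shows that \<open>g\<close> is an integer.\<close>
    define g where "g = \<beta> / of_nat s"
    have gQ: "g \<in> \<rat>" using ab by (simp add: g_def)
    have bg: "\<beta> = g * of_nat s" using s0 by (simp add: g_def)
    show False using y
    proof
      assume "y = 1"
      hence ms: "(of_nat m :: complex) = 2 * (of_nat s)\<^sup>2" by (simp add: mn xy(1) x2)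
      have "4 * (of_nat s)\<^sup>2 * (of_nat p * g\<^sup>2) = 4 * (of_nat s)\<^sup>2 * ((of_nat s)\<^sup>2 - 2 :: complex)"
        using disc unfolding ms bg by (simp add: power_mult_distrib algebra_simps)
      hence gg: "of_nat p * g\<^sup>2 = (of_nat s)\<^sup>2 - 2" using s0 by simp
      hence "of_nat p * g\<^sup>2 \<in> \<int>" by simp
      then obtain j where j: "g = of_int j" using Rats_squarefree_mult_square[OF gQ sf_p] by (auto elim: Ints_cases)
      have "(of_int ((int s)\<^sup>2) :: complex) = of_int (int p * j\<^sup>2 + 2)" using gg by (simp add: j)
      thus False using no_square_difference_two(1)[OF p4, of "int s" j] by (simp only: of_int_eq_iff)
    next
      assume "y = p"
      hence ms: "(of_nat m :: complex) = 2 * of_nat p * (of_nat s)\<^sup>2" by (simp add: mn xy(1) x2)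
      have "4 * of_nat p * (of_nat s)\<^sup>2 * g\<^sup>2 = 4 * of_nat p * (of_nat s)\<^sup>2 * (of_nat p * (of_nat s)\<^sup>2 - 2 :: complex)"
        using disc unfolding ms bg by (simp add: power_mult_distrib algebra_simps)
      hence gg: "g\<^sup>2 = of_nat p * (of_nat s)\<^sup>2 - 2" using s0 p5 by simp
      hence "of_nat 1 * g\<^sup>2 \<in> \<int>" by simp
      then obtain j where j: "g = of_int j" using Rats_squarefree_mult_square[OF gQ squarefree_1] by (auto elim: Ints_cases)
      have "(of_int (int p * (int s)\<^sup>2) :: complex) = of_int (j\<^sup>2 + 2)" using gg by (simp add: j)
      thus False using no_square_difference_two(2)[OF p4, of "int s" j] by (simp only: of_int_eq_iff)
    qed
  qed
  ultimately show ?thesis by (simp add: E_def)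
qed

text \<open>The quotient is rational and integral, hence an integer, and it is positive because
  \<open>w\<close> is real and \<open>eta\<close> positive. So only rationality has to be verified
  for the special elements \<open>w\<close> used later.\<close>

lemma square_or_twice_square_rational:
  assumes eta: "eta \<in> units_of_field Kp" "eta = of_real y" "y > 0"
    and w: "w \<in> Kp" "algebraic_int w" "w \<noteq> 0" and c: "w\<^sup>2 / eta \<in> \<rat>"
  shows "(\<exists>v\<in>Kp. v\<^sup>2 = eta) \<or> (\<exists>v\<in>Kp. v\<^sup>2 = 2 * eta)"
proof -
  have "algebraic_int (w\<^sup>2 * inverse eta)"
    using w(2) units_algebraic_int_inverse[OF eta(1)] by (intro algebraic_int_mult algebraic_int_power)
  hence "w\<^sup>2 / eta \<in> \<int>" using c by (intro rational_algebraic_int_is_int) (auto simp: divide_inverse)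
  then obtain k where k: "w\<^sup>2 / eta = of_int k" by (auto elim: Ints_cases)
  obtain x where x: "w = of_real x" using w(1) Kp_Reals by (auto elim!: Reals_cases dest!: subsetD)
  have "complex_of_real (x\<^sup>2 / y) = of_real (of_int k)" using k unfolding x eta(2) by simp
  hence "x\<^sup>2 / y = of_int k" by (simp only: of_real_eq_iff)
  moreover have "x\<^sup>2 / y > 0" using w(3) eta(3) x by simp
  ultimately have "k > 0" by simp
  then obtain m where m: "k = int m" "m > 0" by (metis gr0I of_nat_0_less_iff zero_less_imp_eq_int)
  have "w\<^sup>2 = of_nat m * eta" using k units_nonzero[OF eta(1)] by (simp add: m field_simps)
  thus ?thesis using square_or_twice_square[OF eta(1) w(1) m(2)] by blast
qed

end

lemma field_aut_powi:
  assumes "field_aut L f" "x \<in> L" shows "f (x powi n) = f x powi n"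
  using assms field_aut_power[OF assms] field_aut_inverse[OF assms(1)] subfield_C_power[OF field_aut_subfield[OF assms(1)] assms(2)]
  by (auto simp: power_int_def power_inverse field_aut_power field_aut_inverse subfield_C_inverse[OF field_aut_subfield[OF assms(1)]])

lemma sign_powi: "n = 1 \<or> n = -1 \<Longrightarrow> (of_int n :: real) powi b = (if n = 1 \<or> even b then 1 else -1)"
  by (auto simp: power_int_minus_left)

section \<open>Monomials in the fundamental units\<close>

text \<open>Conjugation is \<open>tau\<close> on \<open>k2\<close> and \<open>sig\<close> on
  \<open>k3\<close>, so \<open>n2\<close> and \<open>n3\<close> are the norms of \<open>e2\<close>
  and \<open>e3\<close>. The norm of \<open>e1\<close> gets no parameter, being -1 by
  \<open>fundamental_norm_k1\<close>.\<close>

locale biquad_units = biquad +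
  fixes e1 e2 e3 :: real and n2 n3 :: int
  assumes fund: "fundamental k1 e1" "fundamental k2 e2" "fundamental k3 e3"
    and n2: "of_real e2 * tau (of_real e2) = of_int n2" "n2 = 1 \<or> n2 = -1"
    and n3: "of_real e3 * sig (of_real e3) = of_int n3" "n3 = 1 \<or> n3 = -1"
begin

definition "E1 = complex_of_real e1"
definition "E2 = complex_of_real e2"
definition "E3 = complex_of_real e3"

lemma e_gt: "e1 > 1" "e2 > 1" "e3 > 1"
  using fund by (auto simp: fundamental_def)

lemma E_units_k: "E1 \<in> units_of_field k1" "E2 \<in> units_of_field k2" "E3 \<in> units_of_field k3"
  using fund by (auto simp: fundamental_def E1_def E2_def E3_def)

lemma E_units: "E1 \<in> units_of_field Kp" "E2 \<in> units_of_field Kp" "E3 \<in> units_of_field Kp"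
  using E_units_k units_mono[OF subfield_k(1) subfield_Kp k1_sub_Kp]
    units_mono[OF subfield_k(2) subfield_Kp k2_sub_Kp] units_mono[OF subfield_k(3) subfield_Kp k3_sub_Kp] by auto

lemma E_in: "E1 \<in> Kp" "E2 \<in> Kp" "E3 \<in> Kp" using E_units units_in by auto
lemma E_nz: "E1 \<noteq> 0" "E2 \<noteq> 0" "E3 \<noteq> 0" using E_units units_nonzero by auto

lemma E_conj: "tau E1 = E1" "sig E2 = E2" "tau E3 = sig E3"
  "E1 * sig E1 = -1" "E2 * tau E2 = of_int n2" "E3 * sig E3 = of_int n3"
  using k_fixed(1)[OF units_in[OF E_units_k(1)]] k_fixed(2)[OF units_in[OF E_units_k(2)]]
    k_fixed(3)[OF units_in[OF E_units_k(3)]] fundamental_norm_k1[OF fund(1)] n2 n3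
  by (simp_all add: E1_def E2_def E3_def)

lemma E_conj': "sig E1 = - inverse E1" "tau E2 = of_int n2 * inverse E2" "sig E3 = of_int n3 * inverse E3"
  "tau E3 = of_int n3 * inverse E3"
  using E_conj E_nz by (simp_all add: field_simps)

definition mon :: "int \<Rightarrow> int \<Rightarrow> int \<Rightarrow> complex" where
  "mon a b c = E1 powi a * E2 powi b * E3 powi c"

lemma mon_unit: "mon a b c \<in> units_of_field Kp"
  unfolding mon_def using E_units subfield_Kp by (intro units_mult units_powi)

lemma mon_pos: obtains y where "mon a b c = of_real y" "y > 0"
proof -
  have "e1 powi a * e2 powi b * e3 powi c > 0" using e_gt by (intro mult_pos_pos zero_less_power_int) auto
  thus ?thesis using that[of "e1 powi a * e2 powi b * e3 powi c"] by (simp add: mon_def E1_def E2_def E3_def)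
qed

lemma mon_add: "mon (a + a') (b + b') (c + c') = mon a b c * mon a' b' c'"
  using E_nz by (simp add: mon_def power_int_add mult_ac)

lemma ell_mon: "ell (mon a b c) = of_int a * ell E1 + of_int b * ell E2 + of_int c * ell E3"
  using E_nz by (simp add: mon_def ell_mult ell_powi)

lemma ell_pos: "ell E1 > 0" "ell E2 > 0" "ell E3 > 0"
  using e_gt by (simp_all add: ell_def E1_def E2_def E3_def)

lemma aut_mon:
  assumes "field_aut Kp f" shows "f (mon a b c) = f E1 powi a * f E2 powi b * f E3 powi c"
  unfolding mon_def using E_in subfield_Kp
  by (simp add: field_aut_mult[OF assms] field_aut_powi[OF assms] subfield_C_powi subfield_C_mult)

text \<open>The relative norm \<open>w * f w\<close> is a nonzero real number, and its square is
  \<open>k ^ 2\<close> times the product of the relative norms of the three factors.\<close>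

lemma norm_sign:
  assumes f: "field_aut Kp f" and w: "w \<in> Kp" "w\<^sup>2 = of_nat k * mon a b c" "k > 0"
    and x: "E1 * f E1 = of_real x1" "E2 * f E2 = of_real x2" "E3 * f E3 = of_real x3"
  shows "x1 powi a * x2 powi b * x3 powi c > 0"
proof -
  have w0: "w \<noteq> 0" using w units_nonzero[OF mon_unit] by auto
  have kKp: "of_nat k \<in> Kp" by (rule subfield_C_of_nat[OF subfield_Kp])
  define g where "g = w * f w"
  have "g \<in> Kp" unfolding g_def using w field_aut_in[OF f] subfield_C_mult[OF subfield_Kp] by blast
  then obtain y where y: "g = of_real y" using Kp_Reals by (auto elim!: Reals_cases dest!: subsetD)
  have g0: "g \<noteq> 0" unfolding g_def using w0 field_aut_nonzero[OF f w(1)] by simp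
  have fw: "(f w)\<^sup>2 = of_nat k * f (mon a b c)"
    using field_aut_power[OF f w(1), of 2] field_aut_mult[OF f kKp units_in[OF mon_unit]] field_aut_of_nat[OF f]
    by (simp add: w(2))
  have "g\<^sup>2 = (of_nat k)\<^sup>2 * (mon a b c * f (mon a b c))"
    unfolding g_def power_mult_distrib w(2) fw by (simp add: power2_eq_square)
  also have "mon a b c * f (mon a b c) = (E1 * f E1) powi a * (E2 * f E2) powi b * (E3 * f E3) powi c"
    unfolding aut_mon[OF f] by (simp add: mon_def power_int_mult_distrib mult_ac)
  finally have "complex_of_real (y\<^sup>2) = of_real ((real k)\<^sup>2 * (x1 powi a * x2 powi b * x3 powi c))"
    unfolding x y by simp
  hence "y\<^sup>2 = (real k)\<^sup>2 * (x1 powi a * x2 powi b * x3 powi c)" by (simp only: of_real_eq_iff)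
  moreover have "y\<^sup>2 > 0" using g0 y by simp
  ultimately show ?thesis using w(3) by (simp add: zero_less_mult_iff)
qed

section \<open>Which monomials are squares or twice squares\<close>

text \<open>Only the parities of the exponents matter, see \<open>SQ_mod\<close>. With
  \<open>k = 1\<close> a root of the monomial lies in \<open>Kp\<close>; with \<open>k = 2\<close> a
  root of i times the monomial lies in \<open>K\<close>; two of the latter kind multiply to
  \<open>k = 4\<close>.\<close>

definition SQ :: "nat \<Rightarrow> int \<Rightarrow> int \<Rightarrow> int \<Rightarrow> bool" where
  "SQ k a b c \<longleftrightarrow> (\<exists>w\<in>Kp. w\<^sup>2 = of_nat k * mon a b c)"

lemma sig_tau_aut: "field_aut Kp (\<lambda>x. sig (tau x))"
  by (rule field_aut_comp[OF sig_aut tau_aut])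

text \<open>The automorphisms \<open>tau\<close>, \<open>sig\<close> and their composite fix
  \<open>E1\<close>, \<open>E2\<close> and \<open>E3\<close> respectively. The relative norm of the
  fixed unit is a positive square, so positivity in \<open>norm_sign\<close> links the parities of
  the other two exponents.\<close>

lemma SQ_parity:
  assumes "SQ k a b c" "k > 0"
  shows "(n2 = 1 \<or> even b) \<longleftrightarrow> (n3 = 1 \<or> even c)" "even a \<longleftrightarrow> (n3 = 1 \<or> even c)" "even a \<longleftrightarrow> (n2 = 1 \<or> even b)"
proof -
  obtain w where w: "w \<in> Kp" "w\<^sup>2 = of_nat k * mon a b c" using assms(1) unfolding SQ_def by blast
  have pos: "(e1\<^sup>2) powi a > 0" "(e2\<^sup>2) powi b > 0" "(e3\<^sup>2) powi c > 0" using e_gt by auto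
  have m1: "(-1 :: real) powi a = (if even a then 1 else -1)" by (simp add: power_int_minus_left)
  have sq: "E1 * E1 = of_real (e1\<^sup>2)" "E2 * E2 = of_real (e2\<^sup>2)" "E3 * E3 = of_real (e3\<^sup>2)"
    by (simp_all add: E1_def E2_def E3_def power2_eq_square)
  have st: "sig (tau E1) = sig E1" "sig (tau E2) = tau E2" "sig (sig E3) = E3"
    using E_conj tau_sig[of E2] sig_sig[of E3] E_in Kp_sub_K by auto
  have "(e1\<^sup>2) powi a * (of_int n2) powi b * (of_int n3) powi c > 0"
    by (rule norm_sign[OF tau_aut w assms(2)]) (simp_all add: E_conj sq)
  thus "(n2 = 1 \<or> even b) \<longleftrightarrow> (n3 = 1 \<or> even c)"
    using pos unfolding sign_powi[OF n2(2)] sign_powi[OF n3(2)] by (auto simp: zero_less_mult_iff split: if_splits)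
  have "(-1) powi a * (e2\<^sup>2) powi b * (of_int n3) powi c > 0"
    by (rule norm_sign[OF sig_aut w assms(2)]) (simp_all add: E_conj sq)
  thus "even a \<longleftrightarrow> (n3 = 1 \<or> even c)"
    using pos unfolding sign_powi[OF n3(2)] m1 by (auto simp: zero_less_mult_iff split: if_splits)
  have "(-1) powi a * (of_int n2) powi b * (e3\<^sup>2) powi c > 0"
    by (rule norm_sign[OF sig_tau_aut w assms(2)]) (simp_all add: E_conj sq st)
  thus "even a \<longleftrightarrow> (n2 = 1 \<or> even b)"
    using pos unfolding sign_powi[OF n2(2)] m1 by (auto simp: zero_less_mult_iff split: if_splits)
qed

lemma SQ_shift:
  assumes "SQ k (a + 2 * a') (b + 2 * b') (c + 2 * c')" shows "SQ k a b c"
proof -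
  obtain w where w: "w \<in> Kp" "w\<^sup>2 = of_nat k * mon (a + 2 * a') (b + 2 * b') (c + 2 * c')"
    using assms unfolding SQ_def by blast
  define m where "m = mon a' b' c'"
  have m: "m \<in> Kp" "m \<noteq> 0" unfolding m_def using units_in[OF mon_unit] units_nonzero[OF mon_unit] by auto
  have "mon (2 * a') (2 * b') (2 * c') = m\<^sup>2"
    unfolding m_def power2_eq_square mon_add[symmetric] by simp
  hence "w\<^sup>2 = of_nat k * mon a b c * m\<^sup>2" unfolding w(2) mon_add by simp
  hence "(w / m)\<^sup>2 = of_nat k * mon a b c" using m by (simp add: power_divide)
  thus ?thesis unfolding SQ_def using subfield_C_divide[OF subfield_Kp w(1) m(1)] by blast
qed

lemma SQ_mod: "SQ k a b c \<Longrightarrow> SQ k (a mod 2) (b mod 2) (c mod 2)"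
  by (rule SQ_shift[of k _ "a div 2" _ "b div 2" _ "c div 2"]) simp

lemma SQ_mult:
  assumes "SQ k a b c" "SQ l a' b' c'" shows "SQ (k * l) (a + a') (b + b') (c + c')"
proof -
  obtain v w where "v \<in> Kp" "v\<^sup>2 = of_nat k * mon a b c" "w \<in> Kp" "w\<^sup>2 = of_nat l * mon a' b' c'"
    using assms unfolding SQ_def by blast
  hence "(v * w)\<^sup>2 = of_nat (k * l) * mon (a + a') (b + b') (c + c')" "v * w \<in> Kp"
    by (simp_all add: power_mult_distrib mon_add subfield_C_mult[OF subfield_Kp])
  thus ?thesis unfolding SQ_def by blast
qed

lemma SQ_4: assumes "SQ 4 a b c" shows "SQ 1 a b c"
proof -
  obtain v where v: "v \<in> Kp" "v\<^sup>2 = of_nat 4 * mon a b c" using assms unfolding SQ_def by blast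
  hence "(v / 2)\<^sup>2 = of_nat 1 * mon a b c" by (simp add: power_divide)
  thus ?thesis unfolding SQ_def
    using subfield_C_divide[OF subfield_Kp v(1) subfield_C_numeral[OF subfield_Kp]] by blast
qed

lemma not_SQ2_trivial: "\<not> SQ 2 0 0 0"
  using two_not_square by (simp add: SQ_def mon_def)

lemma SQ_1_or_2:
  assumes "w \<in> Kp" "algebraic_int w" "w \<noteq> 0" "w\<^sup>2 / mon a b c \<in> \<rat>"
  shows "SQ 1 a b c \<or> SQ 2 a b c"
proof -
  obtain y where "mon a b c = of_real y" "y > 0" using mon_pos .
  from square_or_twice_square_rational[OF mon_unit this assms] show ?thesis by (simp add: SQ_def)
qed

text \<open>A root \<open>v\<close> is mapped by \<open>sig\<close> to \<open>v\<close> or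
  \<open>- v\<close>. In the first case it lies in \<open>k2\<close>, against minimality; in the
  second \<open>R * v\<close> does, so p times \<open>E2\<close> is a square there, although p does
  not ramify in \<open>k2\<close>.\<close>

lemma not_SQ_E2: "\<not> SQ 1 0 1 0"
proof
  assume "SQ 1 0 1 0"
  then obtain v where v: "v \<in> Kp" "v\<^sup>2 = E2" by (auto simp: SQ_def mon_def)
  have "(sig v)\<^sup>2 = v\<^sup>2" using field_aut_power[OF sig_aut v(1), of 2] by (simp add: v(2) E_conj)
  hence "sig v = v \<or> sig v = - v" by (simp add: power2_eq_iff)
  thus False
  proof
    assume "sig v = v"
    hence "v \<in> k2" using fixed_fields(2)[OF v(1)] by blast
    thus False using fundamental_not_square[OF subfield_k(2) k_Reals(2) fund(2)] v(2) by (auto simp: E2_def)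
  next
    assume *: "sig v = - v"
    define w where "w = R * v"
    have wKp: "w \<in> Kp" unfolding w_def using v(1) R_in(1) subfield_Kp by (intro subfield_C_mult)
    have "sig w = w" unfolding w_def using * field_aut_mult[OF sig_aut R_in(1) v(1)] by (simp add: sig_R)
    hence "w \<in> k2" using fixed_fields(2)[OF wKp] by blast
    then obtain a b where ab: "a \<in> \<rat>" "b \<in> \<rat>" "w = a + b * S" unfolding k2_def by (auto elim: adjE)
    have weq: "w\<^sup>2 = of_nat p * E2" by (simp add: w_def power_mult_distrib R2 v(2))
    have "w = a + 0 * R + b * S + 0 * (R * S)" by (simp add: ab)
    \<comment> \<open>Only the coordinates at 1 and S are present, which leaves 2q as the sole
      radicand that p could divide.\<close>
    from ramified_prime[OF E_units(2) ab(1) Rats_0 ab(2) Rats_0 this weq sf_p p odd_p dvd_refl]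
    have "p dvd 2 * q" by simp
    hence "p dvd 2 \<or> p dvd q" using p by (simp add: prime_dvd_mult_iff)
    thus False using pq p q p5 by (auto simp: primes_dvd_imp_eq dest: dvd_imp_le)
  qed
qed

text \<open>Norm 1 makes the trace invariant under both automorphisms, so
  \<open>(E2 + 1) ^ 2 / E2\<close> is rational; of the two resulting alternatives
  \<open>not_SQ_E2\<close> leaves the second.\<close>

lemma SQ2_E2: assumes "n2 = 1" shows "SQ 2 0 1 0"
proof -
  have t: "tau E2 = inverse E2" using E_conj'(2) assms by simp
  have "E2 + inverse E2 \<in> \<rat>"
  proof (rule fixed_fields(4))
    show "E2 + inverse E2 \<in> Kp" using E_in subfield_Kp by (intro subfield_C_add subfield_C_inverse)
    have "f (E2 + inverse E2) = f E2 + inverse (f E2)" if "field_aut Kp f" for f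
      using field_aut_add[OF that] field_aut_inverse[OF that] E_in subfield_C_inverse[OF subfield_Kp] by simp
    from this[OF sig_aut] this[OF tau_aut]
    show "sig (E2 + inverse E2) = E2 + inverse E2" "tau (E2 + inverse E2) = E2 + inverse E2"
      by (simp_all add: E_conj t)
  qed
  hence "E2 + inverse E2 + 2 \<in> \<rat>" by simp
  moreover have "(E2 + 1)\<^sup>2 / mon 0 1 0 = E2 + inverse E2 + 2"
    using E_nz by (simp add: mon_def power2_eq_square field_simps)
  moreover have "E2 + 1 \<in> Kp" using E_in subfield_Kp by (intro subfield_C_add subfield_C_1)
  moreover have "algebraic_int (E2 + 1)" using units_algebraic_int[OF E_units(2)] by (intro algebraic_int_add) auto
  moreover have "E2 + 1 \<noteq> 0" using e_gt(2) by (simp add: E2_def complex_eq_iff)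
  ultimately show ?thesis using SQ_1_or_2[of "E2 + 1" 0 1 0] not_SQ_E2 by simp
qed

lemma SQ_E3: assumes "n3 = 1" shows "SQ 1 0 0 1 \<or> SQ 2 0 0 1"
proof -
  have t: "sig E3 = inverse E3" "tau E3 = inverse E3" using E_conj' assms by simp_all
  have "E3 + inverse E3 \<in> \<rat>"
  proof (rule fixed_fields(4))
    show "E3 + inverse E3 \<in> Kp" using E_in subfield_Kp by (intro subfield_C_add subfield_C_inverse)
    have "f (E3 + inverse E3) = f E3 + inverse (f E3)" if "field_aut Kp f" for f
      using field_aut_add[OF that] field_aut_inverse[OF that] E_in subfield_C_inverse[OF subfield_Kp] by simp
    from this[OF sig_aut] this[OF tau_aut]
    show "sig (E3 + inverse E3) = E3 + inverse E3" "tau (E3 + inverse E3) = E3 + inverse E3"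
      by (simp_all add: t)
  qed
  hence "E3 + inverse E3 + 2 \<in> \<rat>" by simp
  moreover have "(E3 + 1)\<^sup>2 / mon 0 0 1 = E3 + inverse E3 + 2"
    using E_nz by (simp add: mon_def power2_eq_square field_simps)
  moreover have "E3 + 1 \<in> Kp" using E_in subfield_Kp by (intro subfield_C_add subfield_C_1)
  moreover have "algebraic_int (E3 + 1)" using units_algebraic_int[OF E_units(3)] by (intro algebraic_int_add) auto
  moreover have "E3 + 1 \<noteq> 0" using e_gt(3) by (simp add: E3_def complex_eq_iff)
  ultimately show ?thesis using SQ_1_or_2[of "E3 + 1" 0 0 1] by simp
qed

text \<open>As (E3 + 1)^2 is 2(x + 1) times \<open>E3\<close>, the unit is a square exactly if 2(x +
  1) is one in \<open>Kp\<close>, that is, has the class of 1, p, 2q or 2pq. The classes of 1 and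
  2pq would put the root into \<open>k3\<close>; the class of 2q for x + 1 amounts to the class of p
  for x - 1.\<close>

lemma SQ_E3_iff:
  assumes "n3 = 1" and xy: "e3 = real_of_int x + real_of_int y * sqrt (real (p * (2 * q)))"
  shows "SQ 1 0 0 1 \<longleftrightarrow> (\<exists>n::nat. 2 * int p * (x + 1) = int (n\<^sup>2) \<or> 2 * int p * (x - 1) = int (n\<^sup>2))"
proof -
  define T where "T = R * S"
  have E3: "E3 = of_int x + of_int y * T"
  proof -
    have "E3 = complex_of_real (real_of_int x + real_of_int y * sqrt (real (p * (2 * q))))" unfolding E3_def by (simp only: xy)
    also have "\<dots> = of_int x + of_int y * rt (p * (2 * q))" by simp
    finally show ?thesis unfolding T_def RS_eq .
  qed
  have sE: "sig E3 = of_int x - of_int y * T"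
    using sig_coords(1)[of "of_int x" 0 0 "of_int y"] by (simp add: E3 T_def)
  have N: "E3 * sig E3 = 1" using E_conj(6) assms(1) by simp
  hence iE: "inverse E3 = sig E3" by (rule inverse_unique)
  have plus: "(E3 + 1)\<^sup>2 = of_int (2 * (x + 1)) * E3" and minus: "(E3 - 1)\<^sup>2 = of_int (2 * (x - 1)) * E3"
  proof -
    have "of_int (2 * x) * E3 = (E3 + sig E3) * E3" by (simp add: sE) (simp add: E3)
    also have "\<dots> = E3\<^sup>2 + 1" using N by (simp add: power2_eq_square algebra_simps)
    finally have *: "of_int (2 * x) * E3 = E3\<^sup>2 + 1" .
    have "of_int (2 * (x + 1)) * E3 = of_int (2 * x) * E3 + 2 * E3" by (simp add: algebra_simps)
    thus "(E3 + 1)\<^sup>2 = of_int (2 * (x + 1)) * E3" unfolding * by (simp add: power2_eq_square algebra_simps)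
    have "of_int (2 * (x - 1)) * E3 = of_int (2 * x) * E3 - 2 * E3" by (simp add: algebra_simps)
    thus "(E3 - 1)\<^sup>2 = of_int (2 * (x - 1)) * E3" unfolding * by (simp add: power2_eq_square algebra_simps)
  qed
  have En: "E3 + 1 \<noteq> 0" "E3 - 1 \<noteq> 0" using e_gt(3) by (auto simp: E3_def complex_eq_iff)
  have EKp: "E3 + 1 \<in> Kp" "E3 - 1 \<in> Kp" using E_in subfield_Kp by (intro subfield_C_add subfield_C_diff subfield_C_1; simp)+
  have sqI: "SQ 1 0 0 1" if "2 * int p * z = int (n\<^sup>2)" "w\<^sup>2 = of_int (2 * z) * E3" "w \<noteq> 0" "w \<in> Kp" for z n w
  proof -
    have pz: "of_nat p * of_int (2 * z) = ((of_nat n)\<^sup>2 :: complex)"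
    proof -
      have "(of_int (2 * int p * z) :: complex) = of_int (int (n\<^sup>2))" by (simp only: that(1))
      thus ?thesis by (simp add: mult_ac)
    qed
    \<comment> \<open>The statement admits the square 0, but then \<open>z\<close> and with it
      \<open>w\<close> would vanish.\<close>
    have n0: "n \<noteq> 0"
    proof
      assume "n = 0"
      with that(1) p5 have "z = 0" by simp
      with that(2,3) show False by simp
    qed
    have "(w * R / of_nat n)\<^sup>2 = w\<^sup>2 * of_nat p / (of_nat n)\<^sup>2" by (simp add: power_divide power_mult_distrib R2)
    also have "\<dots> = E3 * (of_nat p * of_int (2 * z)) / (of_nat n)\<^sup>2" unfolding that(2) by (simp add: mult_ac)
    also have "\<dots> = E3" unfolding pz using n0 by simp
    finally have "(w * R / of_nat n)\<^sup>2 = of_nat 1 * mon 0 0 1" by (simp add: mon_def)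
    moreover have "w * R / of_nat n \<in> Kp"
      using that(4) R_in(1) subfield_Kp by (intro subfield_C_divide subfield_C_mult subfield_C_of_nat)
    ultimately show ?thesis unfolding SQ_def by blast
  qed
  \<comment> \<open>From \<open>2 * z = p * a ^ 2\<close> the integer with square
    \<open>2 * p * z\<close> is \<open>p * a\<close>, up to sign.\<close>
  have fin: "\<exists>n::nat. 2 * int p * z = int (n\<^sup>2)" if "a \<in> \<rat>" "of_int (2 * z) = (a * R)\<^sup>2" for a z
  proof -
    have "(of_nat p * a)\<^sup>2 = of_nat p * (a\<^sup>2 * of_nat p)" by (simp add: power2_eq_square mult_ac)
    also have "a\<^sup>2 * of_nat p = of_int (2 * z)" unfolding that(2) by (simp add: power_mult_distrib R2)
    finally have eq: "(of_nat p * a)\<^sup>2 = of_int (2 * int p * z)" by (simp add: mult_ac)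
    have "of_nat 1 * (of_nat p * a)\<^sup>2 \<in> \<int>" unfolding eq by simp
    hence "of_nat p * a \<in> \<int>" using Rats_squarefree_mult_square[of "of_nat p * a" 1] that(1) by simp
    then obtain k where k: "of_nat p * a = of_int k" by (auto elim: Ints_cases)
    have "(of_int (k\<^sup>2) :: complex) = of_int (2 * int p * z)" using eq unfolding k by simp
    hence "k\<^sup>2 = 2 * int p * z" by (simp only: of_int_eq_iff)
    hence "2 * int p * z = int ((nat \<bar>k\<bar>)\<^sup>2)" by simp
    thus ?thesis by blast
  qed
  show ?thesis
  proof
    assume "\<exists>n::nat. 2 * int p * (x + 1) = int (n\<^sup>2) \<or> 2 * int p * (x - 1) = int (n\<^sup>2)"
    thus "SQ 1 0 0 1" using sqI[OF _ plus En(1) EKp(1)] sqI[OF _ minus En(2) EKp(2)] by blast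
  next
    assume "SQ 1 0 0 1"
    then obtain v where v: "v \<in> Kp" "v\<^sup>2 = E3" by (auto simp: SQ_def mon_def)
    have v0: "v \<noteq> 0" using v E_nz by auto
    define g h where "g = (E3 + 1) / v" and "h = (E3 - 1) / v"
    have gh: "g\<^sup>2 = of_int (2 * (x + 1))" "h\<^sup>2 = of_int (2 * (x - 1))"
      unfolding g_def h_def power_divide plus minus v(2) using E_nz by simp_all
    have gKp: "g \<in> Kp" unfolding g_def using EKp v subfield_Kp by (intro subfield_C_divide)
    have g0: "g \<noteq> 0" using En v0 by (simp add: g_def)
    \<comment> \<open>The product ties the two radicands together: if \<open>g\<close> is a rational
      multiple of S, then \<open>h\<close> is one of R.\<close>
    have "g * h = (E3\<^sup>2 - 1) / E3" by (simp add: g_def h_def power2_eq_square algebra_simps flip: v(2))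
    also have "\<dots> = E3 - inverse E3" using E_nz by (simp add: power2_eq_square field_simps)
    also have "\<dots> = 2 * of_int y * T" unfolding iE sE by (simp add: E3)
    finally have ghT: "g * h = 2 * of_int y * T" .
    have notk3: "g \<notin> k3"
    proof
      assume "g \<in> k3"
      moreover have "v = (E3 + 1) / g" using g0 v0 by (simp add: g_def)
      moreover have "E3 + 1 \<in> k3" using units_in[OF E_units_k(3)] subfield_k(3) by (intro subfield_C_add subfield_C_1)
      ultimately have "v \<in> k3" using subfield_C_divide[OF subfield_k(3)] by blast
      thus False using fundamental_not_square[OF subfield_k(3) k_Reals(3) fund(3)] v(2) by (auto simp: E3_def)
    qed
    have "g\<^sup>2 \<in> \<rat>" unfolding gh by simp
    from sqrt_Rats_forms[OF gKp this]
    show "\<exists>n::nat. 2 * int p * (x + 1) = int (n\<^sup>2) \<or> 2 * int p * (x - 1) = int (n\<^sup>2)"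
    proof (elim disjE bexE)
      assume "g \<in> \<rat>"
      thus ?thesis using notk3 Rats_k by blast
    next
      fix a assume "a \<in> \<rat>" "g = a * (R * S)"
      hence "g = 0 + a * (R * S)" by simp
      hence "g \<in> k3" unfolding k3_def using adjI[OF Rats_0 \<open>a \<in> \<rat>\<close>] by metis
      thus ?thesis using notk3 by blast
    next
      fix a assume a: "a \<in> \<rat>" "g = a * R"
      thus ?thesis using fin[OF a(1), of "x + 1"] gh(1) by auto
    next
      fix a assume a: "a \<in> \<rat>" "g = a * S"
      have "a \<noteq> 0" using g0 a by auto
      hence "h = (2 * of_int y / a) * R" using ghT S_nz by (simp add: a T_def field_simps)
      moreover have "2 * of_int y / a \<in> \<rat>" using a by simp
      ultimately show ?thesis using fin[of "2 * of_int y / a" "x - 1"] gh(2) by auto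
    qed
  qed
qed

end

section \<open>The unit lattices\<close>

context biquad_units
begin

lemma conjugates:
  assumes "x \<in> Kp"
  shows "sig (sig x) = x" "tau (tau x) = x" "tau (sig x) = sig (tau x)"
  using assms sig_sig tau_tau tau_sig Kp_sub_K by auto

lemma fixed_products:
  assumes x: "x \<in> Kp"
  shows "x * tau x \<in> k1" "x * sig x \<in> k2" "x * sig (tau x) \<in> k3"
proof -
  note Kp = x sig_Kp[OF x] tau_Kp[OF x] sig_Kp[OF tau_Kp[OF x]]
  note m = subfield_C_mult[OF subfield_Kp Kp(1)]
  show "x * tau x \<in> k1"
    by (rule fixed_fields(1)[OF m[OF Kp(3)]]) (simp add: field_aut_mult[OF tau_aut] Kp conjugates[OF x])
  show "x * sig x \<in> k2"
    by (rule fixed_fields(2)[OF m[OF Kp(2)]]) (simp add: field_aut_mult[OF sig_aut] Kp conjugates[OF x])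
  show "x * sig (tau x) \<in> k3"
  proof (rule fixed_fields(3)[OF m[OF Kp(4)]])
    have "sig (tau (sig (tau x))) = x"
      using conjugates[OF Kp(3)] conjugates[OF x] by simp
    thus "sig (tau (x * sig (tau x))) = x * sig (tau x)"
      using field_aut_mult[OF sig_tau_aut Kp(1) Kp(4)] by simp
  qed
qed

lemma tau_E3_power: "tau (E3 powi c) = (of_int n3) powi c * E3 powi (- c)"
  using field_aut_powi[OF tau_aut E_in(3)] by (simp add: E_conj' power_int_mult_distrib power_int_minus flip: power_int_inverse)

text \<open>In \<open>u ^ 2 = (u * tau u) * (u * sig u) / (tau u * sig u)\<close> the numerator
  consists of the relative norms to \<open>k1\<close> and \<open>k2\<close>, and the denominator is
  a conjugate of the relative norm to \<open>k3\<close>.\<close>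

lemma unit_square:
  assumes u: "u \<in> units_of_field Kp"
  obtains a b c where "u\<^sup>2 = mon a b c"
proof -
  have uK: "u \<in> Kp" and u0: "u \<noteq> 0" using u units_in units_nonzero by auto
  note cu = units_aut[OF tau_aut u] units_aut[OF sig_aut u] units_aut[OF sig_tau_aut u]
  note mul = units_mult[OF subfield_Kp u]
  obtain a where a: "u * tau u = E1 powi a \<or> u * tau u = - (E1 powi a)"
    using fundamental_powers[OF subfield_k(1) k_Reals(1) fund(1)
        units_subfield[OF subfield_k(1) subfield_Kp mul[OF cu(1)] fixed_products(1)[OF uK]]] unfolding E1_def .
  obtain b where b: "u * sig u = E2 powi b \<or> u * sig u = - (E2 powi b)"
    using fundamental_powers[OF subfield_k(2) k_Reals(2) fund(2)
        units_subfield[OF subfield_k(2) subfield_Kp mul[OF cu(2)] fixed_products(2)[OF uK]]] unfolding E2_def .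
  obtain c where c: "u * sig (tau u) = E3 powi c \<or> u * sig (tau u) = - (E3 powi c)"
    using fundamental_powers[OF subfield_k(3) k_Reals(3) fund(3)
        units_subfield[OF subfield_k(3) subfield_Kp mul[OF cu(3)] fixed_products(3)[OF uK]]] unfolding E3_def .
  have E3p: "E3 powi c \<in> Kp" using E_in(3) subfield_Kp by (rule_tac subfield_C_powi)
  have "tau u * sig u = tau (u * sig (tau u))"
    using field_aut_mult[OF tau_aut uK sig_Kp[OF tau_Kp[OF uK]]] conjugates[OF uK] conjugates(3)[OF tau_Kp[OF uK]] by simp
  also have "\<dots> = tau (E3 powi c) \<or> \<dots> = - tau (E3 powi c)"
    using c field_aut_minus[OF tau_aut E3p] by auto
  finally have ts: "tau u * sig u = E3 powi (- c) \<or> tau u * sig u = - (E3 powi (- c))"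
    unfolding tau_E3_power using n3(2) by (auto simp: power_int_minus_left split: if_splits)
  have nz: "tau u \<noteq> 0" "sig u \<noteq> 0" using cu units_nonzero by auto
  have "u\<^sup>2 = (u * tau u) * (u * sig u) / (tau u * sig u)"
    using nz by (simp add: power2_eq_square)
  also have "\<dots> = mon a b c \<or> \<dots> = - mon a b c"
  proof -
    obtain s1 s2 s3 :: complex where s: "s1 = 1 \<or> s1 = -1" "s2 = 1 \<or> s2 = -1" "s3 = 1 \<or> s3 = -1"
      and eqs: "u * tau u = s1 * E1 powi a" "u * sig u = s2 * E2 powi b" "tau u * sig u = s3 * E3 powi (- c)"
      using a b ts by (metis mult_1 mult_minus1)
    have "(u * tau u) * (u * sig u) / (tau u * sig u) = (s1 * s2 / s3) * mon a b c"
      unfolding eqs by (simp add: mon_def power_int_minus divide_inverse mult_ac)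
    moreover have "s1 * s2 / s3 = 1 \<or> s1 * s2 / s3 = -1" using s by auto
    ultimately show ?thesis by (metis mult_1 mult_minus1)
  qed
  finally have sq: "u\<^sup>2 = mon a b c \<or> u\<^sup>2 = - mon a b c" .
  obtain x where x: "u = of_real x" using uK Kp_Reals by (auto elim!: Reals_cases dest!: subsetD)
  obtain y where y: "mon a b c = of_real y" "y > 0" using mon_pos .
  \<comment> \<open>\<open>u\<close> is real and monomials are positive, which settles the sign left
    open by the three relative norms.\<close>
  have "u\<^sup>2 \<noteq> - mon a b c"
  proof
    assume "u\<^sup>2 = - mon a b c"
    hence "complex_of_real (x\<^sup>2) = of_real (- y)" by (simp add: x y(1))
    hence "x\<^sup>2 = - y" by (simp only: of_real_eq_iff)
    thus False using y(2) zero_le_power2[of x] by linarith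
  qed
  thus ?thesis using sq that by blast
qed

text \<open>If twice a positive unit is a square, its relative norms to the quadratic subfields are
  squares there, which forces the unit itself to be a monomial in the fundamental units.\<close>

lemma twice_square_unit:
  assumes eta: "eta \<in> units_of_field Kp" and w: "w \<in> Kp" "w\<^sup>2 = 2 * eta"
  obtains a b c where "eta = mon a b c"
proof -
  have etaK: "eta \<in> Kp" using eta units_in by auto
  have two: "2 \<in> Kp" by (rule subfield_C_numeral[OF subfield_Kp])
  \<comment> \<open>The conjugate of \<open>w\<close> contributes a second factor 2, so division by
    2 leaves a root of the relative norm of \<open>eta\<close>. This is why the exponents below are
    even.\<close>
  have root: "(w * f w / 2)\<^sup>2 = eta * f eta" if f: "field_aut Kp f" for f
  proof -
    have "f 2 = 2" using field_aut_of_nat[OF f, of 2] by simp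
    hence "(f w)\<^sup>2 = 2 * f eta"
      using field_aut_power[OF f w(1), of 2] field_aut_mult[OF f two etaK] w(2) by simp
    thus ?thesis by (simp add: power_divide power_mult_distrib w(2))
  qed
  have norm: "\<exists>n::int. eta * f eta = of_real e powi (2 * n)"
    if f: "field_aut Kp f" and k: "subfield_C k" "k \<subseteq> \<real>" "fundamental k e" "w * f w \<in> k" "eta * f eta \<in> k" for f k e
  proof -
    have "eta * f eta \<in> units_of_field k"
      using units_subfield[OF k(1) subfield_Kp units_mult[OF subfield_Kp eta units_aut[OF f eta]] k(5)] .
    hence "(w * f w / 2)\<^sup>2 \<in> units_of_field k" unfolding root[OF f] .
    hence "w * f w / 2 \<in> units_of_field k"
      by (rule units_sqrt[OF k(1) subfield_C_divide[OF k(1,4) subfield_C_numeral[OF k(1)]]])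
    then obtain n where "w * f w / 2 = of_real e powi n \<or> w * f w / 2 = - (of_real e powi n)"
      using fundamental_powers[OF k(1-3)] by blast
    hence "(w * f w / 2)\<^sup>2 = (of_real e powi n)\<^sup>2" by auto
    also have "\<dots> = of_real e powi (2 * n)" by (simp add: power_int_mult mult.commute[of 2])
    finally show ?thesis unfolding root[OF f] by blast
  qed
  obtain a where a: "eta * tau eta = E1 powi (2 * a)"
    using norm[OF tau_aut subfield_k(1) k_Reals(1) fund(1) fixed_products(1)[OF w(1)] fixed_products(1)[OF etaK]]
    unfolding E1_def by blast
  obtain b where b: "eta * sig eta = E2 powi (2 * b)"
    using norm[OF sig_aut subfield_k(2) k_Reals(2) fund(2) fixed_products(2)[OF w(1)] fixed_products(2)[OF etaK]]
    unfolding E2_def by blast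
  obtain c where c: "eta * sig (tau eta) = E3 powi (2 * c)"
    using norm[OF sig_tau_aut subfield_k(3) k_Reals(3) fund(3) fixed_products(3)[OF w(1)] fixed_products(3)[OF etaK]]
    unfolding E3_def by blast
  have "tau eta * sig eta = tau (eta * sig (tau eta))"
    using field_aut_mult[OF tau_aut etaK sig_Kp[OF tau_Kp[OF etaK]]] conjugates[OF etaK] conjugates(3)[OF tau_Kp[OF etaK]] by simp
  also have "\<dots> = E3 powi (- (2 * c))"
    unfolding c tau_E3_power using n3(2) by (auto simp: power_int_minus_left)
  finally have ts: "tau eta * sig eta = E3 powi (- (2 * c))" .
  have nz: "tau eta \<noteq> 0" "sig eta \<noteq> 0"
    using units_nonzero units_aut[OF tau_aut eta] units_aut[OF sig_aut eta] by auto
  have "eta\<^sup>2 = (eta * tau eta) * (eta * sig eta) / (tau eta * sig eta)"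
    using nz by (simp add: power2_eq_square)
  also have "\<dots> = mon (2 * a) (2 * b) (2 * c)"
    unfolding a b ts by (simp add: mon_def power_int_minus divide_inverse)
  also have "\<dots> = (mon a b c)\<^sup>2" unfolding power2_eq_square mon_add[symmetric] by simp
  finally have sq: "eta = mon a b c \<or> eta = - mon a b c" by (simp add: power2_eq_iff)
  obtain x where x: "w = of_real x" using w(1) Kp_Reals by (auto elim!: Reals_cases dest!: subsetD)
  obtain y where y: "mon a b c = of_real y" "y > 0" using mon_pos .
  have "eta \<noteq> - mon a b c"
  proof
    assume "eta = - mon a b c"
    hence "complex_of_real (x\<^sup>2) = of_real (- 2 * y)" using w(2) by (simp add: x y(1))
    hence "x\<^sup>2 = - 2 * y" by (simp only: of_real_eq_iff)
    thus False using y(2) zero_le_power2[of x] by linarith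
  qed
  thus ?thesis using sq that by blast
qed

section \<open>Logarithms of units and lattices\<close>

text \<open>A relation forces the monomial to be 1. Conjugation inverts a fundamental unit up to
  sign, so applying \<open>tau\<close> and \<open>sig\<close> gives two more relations with changed
  signs, and their combinations isolate each term.\<close>

lemma independent:
  fixes a b c :: int
  assumes "of_int a * ell E1 + of_int b * ell E2 + of_int c * ell E3 = 0"
  shows "a = 0 \<and> b = 0 \<and> c = 0"
proof -
  have "ell (mon a b c) = 0" using assms by (simp add: ell_mon)
  hence cm: "cmod (mon a b c) = 1" using ell_eq_0_iff[OF units_nonzero[OF mon_unit]] by simp
  obtain y where "mon a b c = of_real y" "y > 0" using mon_pos .
  with cm have one: "mon a b c = 1" by simp
  have l: "ell (of_int n * inverse x) = - ell x" if "n = 1 \<or> n = -1" for n x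
    using that by (auto simp: ell_def norm_inverse ln_inverse norm_mult)
  have gen: "of_int a * ell (f E1) + of_int b * ell (f E2) + of_int c * ell (f E3) = 0" if f: "field_aut Kp f" for f
  proof -
    have "f E1 \<noteq> 0" "f E2 \<noteq> 0" "f E3 \<noteq> 0" using field_aut_nonzero[OF f] E_in E_nz by auto
    moreover have "f E1 powi a * f E2 powi b * f E3 powi c = 1"
      using aut_mon[OF f, of a b c] one field_aut_1[OF f] by simp
    hence "ell (f E1 powi a * f E2 powi b * f E3 powi c) = 0" by (simp add: ell_def)
    ultimately show ?thesis by (simp add: ell_mult ell_powi)
  qed
  have lm: "ell (- x) = ell x" for x by (simp add: ell_def)
  have t: "of_int a * ell E1 - of_int b * ell E2 - of_int c * ell E3 = 0"
    using gen[OF tau_aut] unfolding E_conj(1) E_conj' l[OF n2(2)] l[OF n3(2)] by simp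
  have s: "- (of_int a * ell E1) + of_int b * ell E2 - of_int c * ell E3 = 0"
    using gen[OF sig_aut] unfolding E_conj(2) E_conj' l[OF n2(2)] l[OF n3(2)] lm ell_inverse by simp
  have "of_int a * ell E1 = 0" "of_int b * ell E2 = 0" "of_int c * ell E3 = 0" using assms s t by linarith+
  thus ?thesis using ell_pos by auto
qed

text \<open>Logarithms are doubled so that square roots of monomials get integer coordinates.
  \<open>P\<close> bounds the lattice from outside; the other inclusion comes from explicit units in
  \<open>FSU_lattice\<close>.\<close>

definition lattice :: "complex set \<Rightarrow> (int \<Rightarrow> int \<Rightarrow> int \<Rightarrow> bool) \<Rightarrow> bool" where
  "lattice L P \<longleftrightarrow> (\<forall>e\<in>units_of_field L. \<exists>a b c. 2 * ell e = of_int a * ell E1 + of_int b * ell E2 + of_int c * ell E3 \<and> P a b c)"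

lemma lattice_mono: "lattice L P \<Longrightarrow> (\<And>a b c. P a b c \<Longrightarrow> Q a b c) \<Longrightarrow> lattice L Q"
  unfolding lattice_def by blast

lemma lattice_Kp: "lattice Kp (SQ 1)"
  unfolding lattice_def
proof
  fix u assume u: "u \<in> units_of_field Kp"
  obtain a b c where abc: "u\<^sup>2 = mon a b c" using unit_square[OF u] .
  have "2 * ell u = ell (u\<^sup>2)" using units_nonzero[OF u] by (simp add: ell_power)
  hence "2 * ell u = of_int a * ell E1 + of_int b * ell E2 + of_int c * ell E3" by (simp add: abc ell_mon)
  moreover have "SQ 1 a b c" unfolding SQ_def using abc units_in[OF u] by auto
  ultimately show "\<exists>a b c. 2 * ell u = of_int a * ell E1 + of_int b * ell E2 + of_int c * ell E3 \<and> SQ 1 a b c" by blast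
qed

lemma norm_unit_Kp:
  assumes e: "e \<in> units_of_field K" shows "e * cnj e \<in> units_of_field Kp"
proof -
  have "e * cnj e \<in> units_of_field K" using units_mult[OF subfield_K e units_aut[OF field_aut_cnj e]] .
  moreover have "e * cnj e \<in> Kp" using units_in[OF calculation] by (simp add: Kp_iff Reals_cnj_iff mult.commute)
  ultimately show ?thesis using units_subfield[OF subfield_Kp subfield_K] by blast
qed

lemma imaginary_unit:
  assumes e: "e \<in> units_of_field K" "e\<^sup>2 \<notin> \<real>"
  obtains a b c where "e * cnj e = mon a b c" "SQ 2 a b c"
proof -
  obtain w where w: "w \<in> Kp" "w\<^sup>2 = 2 * (e * cnj e)" using unit_conj_cases[OF e(1)] e(2) by blast
  obtain a b c where abc: "e * cnj e = mon a b c" using twice_square_unit[OF norm_unit_Kp[OF e(1)] w] .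
  moreover from this have "SQ 2 a b c" unfolding SQ_def using w by auto
  ultimately show ?thesis by (rule that)
qed

text \<open>Roots of unity do not contribute to \<open>ell\<close>. For a unit with imaginary square
  the exponents are read off \<open>e * cnj e\<close>, whose \<open>ell\<close> is also twice that
  of \<open>e\<close>.\<close>

lemma lattice_K: "lattice K (\<lambda>a b c. SQ 1 a b c \<or> SQ 2 a b c)"
  unfolding lattice_def
proof
  fix e assume e: "e \<in> units_of_field K"
  have e0: "e \<noteq> 0" using e units_nonzero by auto
  show "\<exists>a b c. 2 * ell e = of_int a * ell E1 + of_int b * ell E2 + of_int c * ell E3 \<and> (SQ 1 a b c \<or> SQ 2 a b c)"
  proof (cases "e\<^sup>2 \<in> \<real>")
    case True
    obtain w u where wu: "w \<in> roots_of_unity K" "u \<in> units_of_field Kp" "e = w * u" using real_square_unit[OF e True] .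
    have "ell e = ell u" using roots_of_unity_norm[OF wu(1)] by (simp add: wu(3) ell_def norm_mult)
    thus ?thesis using lattice_Kp wu(2) unfolding lattice_def by metis
  next
    case False
    obtain a b c where abc: "e * cnj e = mon a b c" "SQ 2 a b c" using imaginary_unit[OF e False] .
    have "ell (e * cnj e) = ell e + ell (cnj e)" using e0 by (intro ell_mult) auto
    also have "ell (cnj e) = ell e" by (simp add: ell_def)
    finally have "2 * ell e = of_int a * ell E1 + of_int b * ell E2 + of_int c * ell E3"
      using abc(1) ell_mon by simp
    thus ?thesis using abc(2) by blast
  qed
qed

lemma hasse_1_if: assumes "\<And>a b c. \<not> SQ 2 a b c" shows "hasse_unit_index K Kp = 1"
  by (rule hasse_index_1) (use assms imaginary_unit in blast)

text \<open>If \<open>w ^ 2\<close> is twice the monomial, then \<open>(1 + \<i>) * w / 2\<close>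
  squares to \<open>\<i>\<close> times it. Any other root differs by a sign, so the claims hold for
  both choices.\<close>

lemma imaginary_root:
  assumes "SQ 2 a b c" "s\<^sup>2 = \<i> * mon a b c"
  shows "s \<in> units_of_field K" "2 * ell s = of_int a * ell E1 + of_int b * ell E2 + of_int c * ell E3" "s\<^sup>2 \<notin> \<real>"
proof -
  obtain w where w: "w \<in> Kp" "w\<^sup>2 = 2 * mon a b c" using assms(1) by (auto simp: SQ_def)
  define t where "t = (1 + \<i>) * w / 2"
  have "w \<in> K" using w(1) Kp_sub_K by blast
  hence tK: "t \<in> K" unfolding t_def
    using ii_in subfield_K by (intro subfield_C_divide subfield_C_mult subfield_C_add subfield_C_1 subfield_C_numeral)
  have "(1 + \<i>)\<^sup>2 = 2 * \<i>" by (simp add: power2_eq_square algebra_simps)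
  hence "t\<^sup>2 = \<i> * mon a b c" by (simp add: t_def power_divide power_mult_distrib w(2))
  hence "s\<^sup>2 = t\<^sup>2" using assms(2) by simp
  hence "s = t \<or> s = - t" by (simp only: power2_eq_iff)
  hence sK: "s \<in> K" using tK subfield_C_minus[OF subfield_K] by auto
  have ii: "\<i> \<in> units_of_field K" using ii_in by (simp add: units_of_field_iff[OF subfield_K])
  have "s\<^sup>2 \<in> units_of_field K"
    unfolding assms(2) by (rule units_mult[OF subfield_K ii units_mono[OF subfield_Kp subfield_K Kp_sub_K mon_unit]])
  thus sU: "s \<in> units_of_field K" by (rule units_sqrt[OF subfield_K sK])
  have "2 * ell s = ell (s\<^sup>2)" using units_nonzero[OF sU] by (simp add: ell_power)
  also have "\<dots> = ell (mon a b c)" unfolding assms(2) by (simp add: ell_def norm_mult)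
  finally show "2 * ell s = of_int a * ell E1 + of_int b * ell E2 + of_int c * ell E3" by (simp add: ell_mon)
  obtain y where "mon a b c = of_real y" "y > 0" using mon_pos .
  thus "s\<^sup>2 \<notin> \<real>" unfolding assms(2) by (simp add: complex_is_Real_iff)
qed

lemma real_root:
  assumes "SQ 1 a b c" "s\<^sup>2 = mon a b c"
  shows "s \<in> units_of_field Kp" "2 * ell s = of_int a * ell E1 + of_int b * ell E2 + of_int c * ell E3"
proof -
  obtain w where w: "w \<in> Kp" "w\<^sup>2 = mon a b c" using assms(1) by (auto simp: SQ_def)
  hence "s = w \<or> s = - w" using assms(2) by (simp flip: power2_eq_iff)
  hence sK: "s \<in> Kp" using w(1) subfield_C_minus[OF subfield_Kp] by auto
  show sU: "s \<in> units_of_field Kp" using units_sqrt[OF subfield_Kp sK] assms(2) mon_unit by simp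
  have "2 * ell s = ell (s\<^sup>2)" using units_nonzero[OF sU] by (simp add: ell_power)
  thus "2 * ell s = of_int a * ell E1 + of_int b * ell E2 + of_int c * ell E3" by (simp add: assms(2) ell_mon)
qed

lemma hasse_2_if: assumes "SQ 2 a b c" shows "hasse_unit_index K Kp = 2"
proof -
  have "(csqrt (\<i> * mon a b c))\<^sup>2 = \<i> * mon a b c" by simp
  from imaginary_root[OF assms this] show ?thesis using hasse_index_2 by blast
qed

lemma units_Kp_K: "u \<in> units_of_field Kp \<Longrightarrow> u \<in> units_of_field K"
  by (rule units_mono[OF subfield_Kp subfield_K Kp_sub_K])

text \<open>The rows of the numbers \<open>x\<close>, \<open>y\<close>, \<open>z\<close> are the
  doubled logarithmic coordinates of the candidates. By \<open>gen\<close> they span everything that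
  \<open>P\<close> allows, and by \<open>indep\<close> they are independent, so the question becomes
  one about a 3 by 3 integer matrix.\<close>

lemma FSU_lattice:
  assumes L: "L = Kp \<or> L = K"
    and u: "u1 \<in> units_of_field L" "u2 \<in> units_of_field L" "u3 \<in> units_of_field L"
    and l: "2 * ell u1 = of_int x1 * ell E1 + of_int y1 * ell E2 + of_int z1 * ell E3"
      "2 * ell u2 = of_int x2 * ell E1 + of_int y2 * ell E2 + of_int z2 * ell E3"
      "2 * ell u3 = of_int x3 * ell E1 + of_int y3 * ell E2 + of_int z3 * ell E3"
    and lat: "lattice L P"
    and gen: "\<And>a b c. P a b c \<Longrightarrow> \<exists>i j k. a = i * x1 + j * x2 + k * x3 \<and> b = i * y1 + j * y2 + k * y3 \<and> c = i * z1 + j * z2 + k * z3"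
    and indep: "\<And>i j k. i * x1 + j * x2 + k * x3 = 0 \<Longrightarrow> i * y1 + j * y2 + k * y3 = 0 \<Longrightarrow> i * z1 + j * z2 + k * z3 = 0 \<Longrightarrow>
      i = 0 \<and> j = 0 \<and> k = 0"
  shows "FSU L [u1, u2, u3]"
proof (rule FSU3_I[OF _ u])
  show "subfield_C L" using L subfield_Kp subfield_K by auto
  show "z \<in> roots_of_unity L" if "z \<in> units_of_field L" "cmod z = 1" for z
    using L that roots_of_unity_Kp roots_of_unity_K by auto
  have comb: "2 * (of_int i * ell u1 + of_int j * ell u2 + of_int k * ell u3) =
      of_int (i * x1 + j * x2 + k * x3) * ell E1 + of_int (i * y1 + j * y2 + k * y3) * ell E2
        + of_int (i * z1 + j * z2 + k * z3) * ell E3" for i j k :: int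
  proof -
    have "2 * (of_int i * ell u1 + of_int j * ell u2 + of_int k * ell u3) =
        of_int i * (2 * ell u1) + of_int j * (2 * ell u2) + of_int k * (2 * ell u3)" by (simp add: algebra_simps)
    thus ?thesis unfolding l by (simp add: algebra_simps)
  qed
  show "i = 0 \<and> j = 0 \<and> k = 0" if "of_int i * ell u1 + of_int j * ell u2 + of_int k * ell u3 = 0" for i j k :: int
    using independent[OF comb[of i j k, unfolded that mult_zero_right, symmetric]] indep by blast
  show "\<exists>i j k :: int. ell e = of_int i * ell u1 + of_int j * ell u2 + of_int k * ell u3" if e: "e \<in> units_of_field L" for e
  proof -
    obtain a b c where abc: "2 * ell e = of_int a * ell E1 + of_int b * ell E2 + of_int c * ell E3" "P a b c"
      using lat e unfolding lattice_def by blast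
    obtain i j k where "a = i * x1 + j * x2 + k * x3" "b = i * y1 + j * y2 + k * y3" "c = i * z1 + j * z2 + k * z3"
      using gen[OF abc(2)] by blast
    hence "2 * ell e = 2 * (of_int i * ell u1 + of_int j * ell u2 + of_int k * ell u3)" using abc(1) comb[of i j k] by metis
    hence "ell e = of_int i * ell u1 + of_int j * ell u2 + of_int k * ell u3" by simp
    thus ?thesis by blast
  qed
qed

lemma ell_E: "2 * ell E1 = of_int 2 * ell E1 + of_int 0 * ell E2 + of_int 0 * ell E3"
  "2 * ell E2 = of_int 0 * ell E1 + of_int 2 * ell E2 + of_int 0 * ell E3"
  "2 * ell E3 = of_int 0 * ell E1 + of_int 0 * ell E2 + of_int 2 * ell E3"
  by simp_all

section \<open>Lower bounds for fundamental units of norm -1\<close>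

text \<open>Norm -1 makes \<open>e - inverse e\<close> a positive integer, and the value 1 would
  give \<open>d * (2 * \<beta>) ^ 2 = 5\<close>, impossible for even \<open>d\<close>. The bound
  keeps the element \<open>w\<close> in \<open>SQ_E123\<close> away from zero.\<close>

lemma even_unit_ge_2:
  assumes ab: "\<alpha> \<in> \<rat>" "\<beta> \<in> \<rat>" and E: "complex_of_real e = \<alpha> + \<beta> * t" and N: "(\<alpha> + \<beta> * t) * (\<alpha> - \<beta> * t) = -1"
    and int: "algebraic_int (\<alpha> + \<beta> * t)" "algebraic_int (\<alpha> - \<beta> * t)"
    and t: "t\<^sup>2 = of_nat d" and d: "squarefree d" "even d" and e1: "e > 1"
  shows "e \<ge> 2"
proof -
  have "algebraic_int (\<alpha> + \<beta> * t + (\<alpha> - \<beta> * t))" using int by (rule algebraic_int_add)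
  moreover have s: "\<alpha> + \<beta> * t + (\<alpha> - \<beta> * t) = 2 * \<alpha>" by simp
  ultimately have "2 * \<alpha> \<in> \<int>" using ab by (intro rational_algebraic_int_is_int) auto
  then obtain k where k: "2 * \<alpha> = of_int k" by (auto elim: Ints_cases)
  have "(\<alpha> + \<beta> * t) * - (\<alpha> - \<beta> * t) = 1" unfolding mult_minus_right N by simp
  hence iv: "- (\<alpha> - \<beta> * t) = inverse (complex_of_real e)" unfolding E by (metis inverse_unique)
  have "complex_of_real e - inverse (complex_of_real e) = of_int k"
    unfolding iv[symmetric] k[symmetric] unfolding E by simp
  hence "complex_of_real (e - inverse e) = of_real (of_int k)" by simp
  hence ke: "e - inverse e = of_int k" by (simp only: of_real_eq_iff)
  have "inverse e < 1" using e1 by (simp add: inverse_less_1_iff)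
  hence "of_int k > (0 :: real)" using ke e1 by linarith
  hence k0: "k > 0" by simp
  have "k \<noteq> 1"
  proof
    assume k1: "k = 1"
    have "\<alpha>\<^sup>2 - of_nat d * \<beta>\<^sup>2 = -1" using N by (simp add: power2_eq_square algebra_simps flip: t)
    moreover have "of_nat d * (2 * \<beta>)\<^sup>2 = (2 * \<alpha>)\<^sup>2 - 4 * (\<alpha>\<^sup>2 - of_nat d * \<beta>\<^sup>2)" by (simp add: power_mult_distrib)
    ultimately have db: "of_nat d * (2 * \<beta>)\<^sup>2 = 5" unfolding k k1 by simp
    hence "2 * \<beta> \<in> \<int>" using Rats_squarefree_mult_square[of "2 * \<beta>" d] ab d by simp
    then obtain j where j: "2 * \<beta> = of_int j" by (auto elim: Ints_cases)
    have "(of_int (int d * j\<^sup>2) :: complex) = of_int 5" using db unfolding j by simp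
    hence "int d * j\<^sup>2 = 5" by (simp only: of_int_eq_iff)
    moreover have "even (int d * j\<^sup>2)" using d(2) by simp
    ultimately show False by simp
  qed
  hence "k \<ge> 2" using k0 by simp
  hence "e - inverse e \<ge> 2" unfolding ke by simp
  moreover have "inverse e > 0" using e1 by simp
  ultimately show ?thesis by linarith
qed

text \<open>Again \<open>e1 - inverse e1\<close> is a positive integer, but for an odd radicand it
  may be 1, as for p = 5. So \<open>e1\<close> is at least the golden ratio, and 3/2 is a convenient
  rational number below it.\<close>

lemma e1_ge: "e1 \<ge> 3 / 2"
proof -
  have inv: "sig E1 = - inverse E1" by (rule E_conj'(1))
  have "E1 + sig E1 \<in> \<rat>"
  proof (rule fixed_fields(4))
    show "E1 + sig E1 \<in> Kp" using E_in sig_Kp subfield_C_add[OF subfield_Kp] by blast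
    show "sig (E1 + sig E1) = E1 + sig E1" "tau (E1 + sig E1) = E1 + sig E1"
      using conjugates[OF E_in(1)] E_conj(1) sig_Kp[OF E_in(1)] E_in(1)
      by (simp_all add: field_aut_add[OF sig_aut] field_aut_add[OF tau_aut])
  qed
  moreover have "algebraic_int (E1 + sig E1)"
    using units_algebraic_int[OF E_units(1)] units_algebraic_int[OF units_aut[OF sig_aut E_units(1)]] by (rule algebraic_int_add)
  ultimately have "E1 + sig E1 \<in> \<int>" by (intro rational_algebraic_int_is_int)
  then obtain k where k: "E1 + sig E1 = of_int k" by (auto elim: Ints_cases)
  have "complex_of_real (e1 - inverse e1) = of_real (of_int k)" using k unfolding inv by (simp add: E1_def)
  hence ke: "e1 - inverse e1 = of_int k" by (simp only: of_real_eq_iff)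
  have "inverse e1 < 1" using e_gt(1) by (simp add: inverse_less_1_iff)
  hence "of_int k > (0 :: real)" using ke e_gt(1) by linarith
  hence "k \<ge> 1" by simp
  hence k1: "e1 - inverse e1 \<ge> 1" unfolding ke by simp
  show ?thesis
  proof (rule ccontr)
    assume "\<not> e1 \<ge> 3 / 2"
    hence "inverse (3 / 2) < inverse e1" using e_gt(1) by (intro less_imp_inverse_less) auto
    thus False using k1 \<open>\<not> e1 \<ge> 3 / 2\<close> by simp
  qed
qed

lemma e23_ge:
  shows "n2 = -1 \<Longrightarrow> e2 \<ge> 2" and "n3 = -1 \<Longrightarrow> e3 \<ge> 2"
proof -
  assume n: "n2 = -1"
  obtain a b where ab: "a \<in> \<rat>" "b \<in> \<rat>" "E2 = a + b * S" using units_in[OF E_units_k(2)] unfolding k2_def by (auto elim: adjE)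
  have t: "tau E2 = a - b * S" using sig_coords(2)[of a 0 b 0] ab by simp
  have u: "tau E2 \<in> units_of_field Kp" by (rule units_aut[OF tau_aut E_units(2)])
  show "e2 \<ge> 2"
    by (rule even_unit_ge_2[OF ab(1,2) _ _ _ _ S2 sf_2q _ e_gt(2)])
       (use ab(3) t E_conj(5) n units_algebraic_int[OF u] units_algebraic_int[OF E_units(2)] in \<open>simp_all flip: E2_def\<close>)
next
  assume n: "n3 = -1"
  obtain a b where ab: "a \<in> \<rat>" "b \<in> \<rat>" "E3 = a + b * (R * S)" using units_in[OF E_units_k(3)] unfolding k3_def by (auto elim: adjE)
  have t: "sig E3 = a - b * (R * S)" using sig_coords(1)[of a 0 0 b] ab by simp
  have u: "sig E3 \<in> units_of_field Kp" by (rule units_aut[OF sig_aut E_units(3)])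
  have RS2: "(R * S)\<^sup>2 = of_nat (p * (2 * q))" by (simp add: power_mult_distrib R2 S2)
  show "e3 \<ge> 2"
    by (rule even_unit_ge_2[OF ab(1,2) _ _ _ _ RS2 sf_2pq _ e_gt(3)])
       (use ab(3) t E_conj(6) n units_algebraic_int[OF u] units_algebraic_int[OF E_units(3)] in \<open>simp_all flip: E3_def\<close>)
qed

text \<open>For norms -1, Hilbert 90 applied to the cocycle built from the relative norms of
  E1 E2 E3 produces the element w below.\<close>

lemma SQ_E123:
  assumes n: "n2 = -1" "n3 = -1" shows "SQ 1 1 1 1 \<or> SQ 2 1 1 1"
proof (rule SQ_1_or_2)
  \<comment> \<open>The twisted trace of \<open>E1 * E2 * E3\<close>: the identity contributes the
    product itself, and \<open>sig\<close>, \<open>tau\<close> and their composite, weighted by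
    \<open>- E1 * E3\<close>, \<open>- E2 * E3\<close> and \<open>- E1 * E2\<close>, contribute
    \<open>- E2\<close>, \<open>- E1\<close> and \<open>- E3\<close>.\<close>
  define w where "w = E1 * E2 * E3 - E1 - E2 - E3"
  define eta where "eta = E1 * E2 * E3"
  have m: "mon 1 1 1 = eta" by (simp add: mon_def eta_def)
  show wK: "w \<in> Kp" unfolding w_def using E_in subfield_Kp by (intro subfield_C_diff subfield_C_mult)
  show "algebraic_int w" unfolding w_def
    using units_algebraic_int[OF E_units(1)] units_algebraic_int[OF E_units(2)] units_algebraic_int[OF E_units(3)]
    by (intro algebraic_int_diff algebraic_int_mult)
  show "w \<noteq> 0"
  proof
    assume "w = 0"
    hence "complex_of_real (e1 * e2 * e3 - e1 - e2 - e3) = of_real 0" by (simp add: w_def E1_def E2_def E3_def)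
    hence z: "e1 * e2 * e3 - e1 - e2 - e3 = 0" by (simp only: of_real_eq_iff)
    have ge: "e2 \<ge> 2" "e3 \<ge> 2" using e23_ge n by auto
    \<comment> \<open>Vanishing of \<open>w\<close> means
      \<open>e1 * (e2 * e3 - 1) = e2 + e3\<close>. By the lower bounds the left side is at least
      \<open>3 * (e2 + e3) - 15 / 2\<close>, which exceeds the right side because
      \<open>e2 + e3\<close> is at least 4.\<close>
    have "0 \<le> (e2 - 2) * (e3 - 2)" using ge by simp
    hence 1: "e2 * e3 \<ge> 2 * e2 + 2 * e3 - 4" by (simp add: algebra_simps)
    hence "e2 * e3 - 1 > 0" using ge by linarith
    hence "3 / 2 * (e2 * e3 - 1) \<le> e1 * (e2 * e3 - 1)" using e1_ge by (intro mult_right_mono) auto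
    moreover have "e1 * (e2 * e3 - 1) = e2 + e3" using z by (simp add: algebra_simps)
    ultimately show False using 1 ge by (simp add: algebra_simps)
  qed
  have inv: "sig E1 = - inverse E1" "tau E2 = - inverse E2" "sig E3 = - inverse E3" "tau E3 = - inverse E3"
    using E_conj' n by simp_all
  have etaK: "eta \<in> Kp" unfolding eta_def using E_in subfield_Kp by (intro subfield_C_mult)
  have app: "f w = f E1 * f E2 * f E3 - f E1 - f E2 - f E3" "f eta = f E1 * f E2 * f E3" if f: "field_aut Kp f" for f
    unfolding w_def eta_def using E_in subfield_Kp
    by (simp_all add: field_aut_diff[OF f] field_aut_mult[OF f] subfield_C_mult subfield_C_diff)
  \<comment> \<open>\<open>w\<close> is divided by \<open>E1 * E3\<close> up to sign and
    \<open>eta\<close> by its square, so that \<open>w ^ 2 / eta\<close> is invariant.\<close>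
  have sw: "sig w = - w / (E1 * E3)" "sig eta = eta / (E1 * E3)\<^sup>2"
    unfolding app[OF sig_aut] inv E_conj unfolding w_def eta_def using E_nz by (simp_all add: field_simps power2_eq_square)
  have tw: "tau w = - w / (E2 * E3)" "tau eta = eta / (E2 * E3)\<^sup>2"
    unfolding app[OF tau_aut] inv E_conj unfolding w_def eta_def using E_nz by (simp_all add: field_simps power2_eq_square)
  show "w\<^sup>2 / mon 1 1 1 \<in> \<rat>" unfolding m
  proof (rule fixed_fields(4))
    show "w\<^sup>2 / eta \<in> Kp" using wK etaK subfield_Kp by (intro subfield_C_divide subfield_C_power)
    have fd: "f (w\<^sup>2 / eta) = (f w)\<^sup>2 / f eta" if f: "field_aut Kp f" for f
      using field_aut_divide[OF f subfield_C_power[OF subfield_Kp wK] etaK] field_aut_power[OF f wK] by simp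
    show "sig (w\<^sup>2 / eta) = w\<^sup>2 / eta" unfolding fd[OF sig_aut] sw using E_nz by (simp add: power_divide)
    show "tau (w\<^sup>2 / eta) = w\<^sup>2 / eta" unfolding fd[OF tau_aut] tw using E_nz by (simp add: power_divide)
  qed
qed

end

section \<open>The four cases\<close>

context biquad_units
begin

lemma SQ_mod_cases:
  assumes "SQ k a b c"
  shows "SQ k (of_bool (odd a)) (of_bool (odd b)) (of_bool (odd c))"
  using SQ_mod[OF assms] by (simp only: mod_2_eq_odd)

lemma E_units_K: "E1 \<in> units_of_field K" "E2 \<in> units_of_field K" "E3 \<in> units_of_field K"
  using E_units units_Kp_K by auto

lemma FSU_E:
  assumes "lattice Kp (\<lambda>a b c. even a \<and> even b \<and> even c)" shows "FSU Kp [E1, E2, E3]"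
  by (rule FSU_lattice[OF _ E_units ell_E assms]) (simp_all; presburger)+

text \<open>The vectors (2, 0, 0), (0, 2, 0), (1, 1, 1) span exactly the integer triples with
  entries of equal parity. The companions below check the other coordinate matrices in the same
  way.\<close>

lemma FSU_root_E123:
  assumes L: "L = Kp \<or> L = K" and s: "s \<in> units_of_field L" "2 * ell s = of_int 1 * ell E1 + of_int 1 * ell E2 + of_int 1 * ell E3"
    and lat: "lattice L (\<lambda>a b c. even a = even b \<and> even a = even c)"
  shows "FSU L [E1, E2, s]"
proof (rule FSU_lattice[OF L _ _ s(1) ell_E(1,2) s(2) lat])
  show "E1 \<in> units_of_field L" "E2 \<in> units_of_field L" using L E_units E_units_K by auto
qed (simp_all; presburger)+

lemma FSU_root_E3:
  assumes L: "L = Kp \<or> L = K" and s: "s \<in> units_of_field L" "2 * ell s = of_int 0 * ell E1 + of_int 0 * ell E2 + of_int 1 * ell E3"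
    and lat: "lattice L (\<lambda>a b c. even a \<and> even b)"
  shows "FSU L [E1, E2, s]"
proof (rule FSU_lattice[OF L _ _ s(1) ell_E(1,2) s(2) lat])
  show "E1 \<in> units_of_field L" "E2 \<in> units_of_field L" using L E_units E_units_K by auto
qed (simp_all; presburger)+

lemma FSU_root_E2:
  assumes s: "s \<in> units_of_field K" "2 * ell s = of_int 0 * ell E1 + of_int 1 * ell E2 + of_int 0 * ell E3"
    and lat: "lattice K (\<lambda>a b c. even a \<and> even c)"
  shows "FSU K [E1, s, E3]"
  by (rule FSU_lattice[OF _ E_units_K(1) s(1) E_units_K(3) ell_E(1) s(2) ell_E(3) lat]) (simp_all; presburger)+

lemma FSU_root_E2_E3:
  assumes s: "s \<in> units_of_field K" "2 * ell s = of_int 0 * ell E1 + of_int 1 * ell E2 + of_int 0 * ell E3"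
    and t: "t \<in> units_of_field K" "2 * ell t = of_int 0 * ell E1 + of_int 0 * ell E2 + of_int 1 * ell E3"
    and lat: "lattice K (\<lambda>a b c. even a)"
  shows "FSU K [E1, s, t]"
  by (rule FSU_lattice[OF _ E_units_K(1) s(1) t(1) ell_E(1) s(2) t(2) lat]) (simp_all; presburger)+

lemma FSU_root_E23:
  assumes s: "s \<in> units_of_field Kp" "2 * ell s = of_int 0 * ell E1 + of_int 1 * ell E2 + of_int 1 * ell E3"
    and lat: "lattice Kp (\<lambda>a b c. even a \<and> even b = even c)"
  shows "FSU Kp [E1, E2, s]"
  by (rule FSU_lattice[OF _ E_units(1,2) s(1) ell_E(1,2) s(2) lat]) (simp_all; presburger)+

lemma FSU_root_E23_E3:
  assumes s: "s \<in> units_of_field K" "2 * ell s = of_int 0 * ell E1 + of_int 1 * ell E2 + of_int 1 * ell E3"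
    and t: "t \<in> units_of_field K" "2 * ell t = of_int 0 * ell E1 + of_int 0 * ell E2 + of_int 1 * ell E3"
    and lat: "lattice K (\<lambda>a b c. even a)"
  shows "FSU K [E1, s, t]"
  by (rule FSU_lattice[OF _ E_units_K(1) s(1) t(1) ell_E(1) s(2) t(2) lat]) (simp_all; presburger)+

lemma mon_E: "E1 * E2 * E3 = mon 1 1 1" "E2 * E3 = mon 0 1 1" "\<i> * E1 * E2 * E3 = \<i> * mon 1 1 1"
  "\<i> * E2 = \<i> * mon 0 1 0" "\<i> * E3 = \<i> * mon 0 0 1" "E3 = mon 0 0 1"
  by (simp_all add: mon_def)

lemma square_E123_iff: "(\<exists>s\<in>Kp. s\<^sup>2 = E1 * E2 * E3) \<longleftrightarrow> SQ 1 1 1 1"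
  by (simp add: SQ_def mon_E(1))

text \<open>Equal parities leave only the class of \<open>E1 * E2 * E3\<close>, which is a square or
  twice a square. The basis of \<open>K\<close> has the same logarithms in both situations; the
  index tells whether its last member is already real.\<close>

lemma case_neg_neg:
  assumes n: "n2 = -1" "n3 = -1"
  shows "SQ 1 1 1 1 \<Longrightarrow> s\<^sup>2 = E1 * E2 * E3 \<Longrightarrow> FSU Kp [E1, E2, s] \<and> FSU K [E1, E2, s]"
    and "SQ 1 1 1 1 \<Longrightarrow> hasse_unit_index K Kp = 1"
    and "\<not> SQ 1 1 1 1 \<Longrightarrow> FSU Kp [E1, E2, E3]"
    and "\<not> SQ 1 1 1 1 \<Longrightarrow> s\<^sup>2 = \<i> * E1 * E2 * E3 \<Longrightarrow> FSU K [E1, E2, s]"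
    and "\<not> SQ 1 1 1 1 \<Longrightarrow> hasse_unit_index K Kp = 2"
proof -
  have par: "even a = even b \<and> even a = even c" if "SQ k a b c" "k > 0" for k a b c
    using SQ_parity[OF that] n by auto
  have par12: "even a = even b \<and> even a = even c" if "SQ 1 a b c \<or> SQ 2 a b c" for a b c
    using that par[of 1 a b c] par[of 2 a b c] by auto
  have latp: "lattice Kp (\<lambda>a b c. even a = even b \<and> even a = even c)"
    by (rule lattice_mono[OF lattice_Kp par12[OF disjI1]])
  have lat: "lattice K (\<lambda>a b c. even a = even b \<and> even a = even c)"
    by (rule lattice_mono[OF lattice_K par12])
  have odds: "SQ k 0 0 0 \<or> SQ k 1 1 1" if "SQ k a b c" "k > 0" for k a b c
    using SQ_mod_cases[OF that(1)] par[OF that] by (cases "even a") simp_all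
  show "FSU Kp [E1, E2, s] \<and> FSU K [E1, E2, s]" if "SQ 1 1 1 1" "s\<^sup>2 = E1 * E2 * E3"
    using real_root[OF that(1) that(2)[unfolded mon_E(1)]] units_Kp_K FSU_root_E123[OF _ _ _ latp] FSU_root_E123[OF _ _ _ lat] by blast
  show "hasse_unit_index K Kp = 1" if "SQ 1 1 1 1"
  proof (rule hasse_1_if, rule notI)
    fix a b c assume "SQ 2 a b c"
    hence "SQ 2 1 1 1" using odds[of 2] not_SQ2_trivial by auto
    \<comment> \<open>If the monomial and its double were both squares, 2 itself would be a square
      in \<open>Kp\<close>.\<close>
    hence "SQ 2 2 2 2" using SQ_mult[OF that] by fastforce
    thus False using SQ_mod[of 2 2 2 2] not_SQ2_trivial by simp
  qed
  assume no: "\<not> SQ 1 1 1 1"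
  have s2: "SQ 2 1 1 1" using SQ_E123[OF n] no by blast
  have "even a \<and> even b \<and> even c" if "SQ 1 a b c" for a b c
    using SQ_mod_cases[OF that] par[OF that] no by (cases "even a") simp_all
  from lattice_mono[OF lattice_Kp this] show "FSU Kp [E1, E2, E3]" by (rule FSU_E)
  show "FSU K [E1, E2, s]" if "s\<^sup>2 = \<i> * E1 * E2 * E3"
    using imaginary_root[OF s2 that[unfolded mon_E(3)]] FSU_root_E123[OF _ _ _ lat] by blast
  show "hasse_unit_index K Kp = 2" by (rule hasse_2_if[OF s2])
qed

text \<open>The exponents of \<open>E1\<close> and \<open>E3\<close> must be even, and
  \<open>E2\<close> is always twice a square, so no further distinction arises.\<close>

lemma case_pos_neg:
  assumes n: "n2 = 1" "n3 = -1"
  shows "FSU Kp [E1, E2, E3]" and "s\<^sup>2 = \<i> * E2 \<Longrightarrow> FSU K [E1, s, E3]" and "hasse_unit_index K Kp = 2"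
proof -
  have par: "even a \<and> even c" if "SQ k a b c" "k > 0" for k a b c
    using SQ_parity[OF that] n by auto
  have par12: "even a \<and> even c" if "SQ 1 a b c \<or> SQ 2 a b c" for a b c
    using that par[of 1 a b c] par[of 2 a b c] by auto
  have lat: "lattice K (\<lambda>a b c. even a \<and> even c)"
    by (rule lattice_mono[OF lattice_K par12])
  note s2 = SQ2_E2[OF n(1)]
  have "even a \<and> even b \<and> even c" if "SQ 1 a b c" for a b c
    using SQ_mod_cases[OF that] par[OF that] not_SQ_E2 by (cases "even b") simp_all
  from lattice_mono[OF lattice_Kp this] show "FSU Kp [E1, E2, E3]" by (rule FSU_E)
  show "FSU K [E1, s, E3]" if "s\<^sup>2 = \<i> * E2"
    using imaginary_root[OF s2 that[unfolded mon_E(4)]] FSU_root_E2[OF _ _ lat] by blast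
  show "hasse_unit_index K Kp = 2" by (rule hasse_2_if[OF s2])
qed

text \<open>The exponents of \<open>E1\<close> and \<open>E2\<close> must be even. The remaining
  class, that of \<open>E3\<close>, can be of either type, and the type alone decides between the
  two indices.\<close>

lemma case_neg_pos:
  assumes n: "n2 = -1" "n3 = 1"
  shows "SQ 1 0 0 1 \<Longrightarrow> s\<^sup>2 = E3 \<Longrightarrow> FSU Kp [E1, E2, s] \<and> FSU K [E1, E2, s]"
    and "SQ 1 0 0 1 \<Longrightarrow> hasse_unit_index K Kp = 1"
    and "\<not> SQ 1 0 0 1 \<Longrightarrow> FSU Kp [E1, E2, E3]"
    and "\<not> SQ 1 0 0 1 \<Longrightarrow> s\<^sup>2 = \<i> * E3 \<Longrightarrow> FSU K [E1, E2, s]"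
    and "\<not> SQ 1 0 0 1 \<Longrightarrow> hasse_unit_index K Kp = 2"
proof -
  have par: "even a \<and> even b" if "SQ k a b c" "k > 0" for k a b c
    using SQ_parity[OF that] n by auto
  have par12: "even a \<and> even b" if "SQ 1 a b c \<or> SQ 2 a b c" for a b c
    using that par[of 1 a b c] par[of 2 a b c] by auto
  have latp: "lattice Kp (\<lambda>a b c. even a \<and> even b)"
    by (rule lattice_mono[OF lattice_Kp par12[OF disjI1]])
  have lat: "lattice K (\<lambda>a b c. even a \<and> even b)"
    by (rule lattice_mono[OF lattice_K par12])
  have odds: "SQ k 0 0 0 \<or> SQ k 0 0 1" if "SQ k a b c" "k > 0" for k a b c
    using SQ_mod_cases[OF that(1)] par[OF that] by (cases "even c") simp_all
  show "FSU Kp [E1, E2, s] \<and> FSU K [E1, E2, s]" if "SQ 1 0 0 1" "s\<^sup>2 = E3"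
    using real_root[OF that(1) that(2)[unfolded mon_E(6)]] units_Kp_K FSU_root_E3[OF _ _ _ latp] FSU_root_E3[OF _ _ _ lat] by blast
  show "hasse_unit_index K Kp = 1" if "SQ 1 0 0 1"
  proof (rule hasse_1_if, rule notI)
    fix a b c assume "SQ 2 a b c"
    hence "SQ 2 0 0 1" using odds[of 2] not_SQ2_trivial by auto
    hence "SQ 2 0 0 2" using SQ_mult[OF that] by fastforce
    thus False using SQ_mod[of 2 0 0 2] not_SQ2_trivial by simp
  qed
  assume no: "\<not> SQ 1 0 0 1"
  have s2: "SQ 2 0 0 1" using SQ_E3[OF n(2)] no by blast
  have "even a \<and> even b \<and> even c" if "SQ 1 a b c" for a b c
    using SQ_mod_cases[OF that] par[OF that] no by (cases "even c") simp_all
  from lattice_mono[OF lattice_Kp this] show "FSU Kp [E1, E2, E3]" by (rule FSU_E)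
  show "FSU K [E1, E2, s]" if "s\<^sup>2 = \<i> * E3"
    using imaginary_root[OF s2 that[unfolded mon_E(5)]] FSU_root_E3[OF _ _ _ lat] by blast
  show "hasse_unit_index K Kp = 2" by (rule hasse_2_if[OF s2])
qed

text \<open>Here the exponents of \<open>E2\<close> and \<open>E3\<close> are both free.
  \<open>E2\<close> is always twice a square, which gives the index 2; if \<open>E3\<close> is one
  too, their product is a square, and this is the origin of the mixed root.\<close>

lemma case_pos_pos:
  assumes n: "n2 = 1" "n3 = 1"
  shows "SQ 1 0 0 1 \<Longrightarrow> s\<^sup>2 = E3 \<Longrightarrow> FSU Kp [E1, E2, s]"
    and "SQ 1 0 0 1 \<Longrightarrow> s\<^sup>2 = \<i> * E2 \<Longrightarrow> t\<^sup>2 = E3 \<Longrightarrow> FSU K [E1, s, t]"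
    and "\<not> SQ 1 0 0 1 \<Longrightarrow> s\<^sup>2 = E2 * E3 \<Longrightarrow> FSU Kp [E1, E2, s]"
    and "\<not> SQ 1 0 0 1 \<Longrightarrow> s\<^sup>2 = E2 * E3 \<Longrightarrow> t\<^sup>2 = \<i> * E3 \<Longrightarrow> FSU K [E1, s, t]"
    and "hasse_unit_index K Kp = 2"
proof -
  have par: "even a" if "SQ k a b c" "k > 0" for k a b c
    using SQ_parity[OF that] n by auto
  have par12: "even a" if "SQ 1 a b c \<or> SQ 2 a b c" for a b c
    using that par[of 1 a b c] par[of 2 a b c] by auto
  have lat: "lattice K (\<lambda>a b c. even a)"
    by (rule lattice_mono[OF lattice_K par12])
  note s2 = SQ2_E2[OF n(1)]
  show "hasse_unit_index K Kp = 2" by (rule hasse_2_if[OF s2])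
  show "FSU K [E1, s, t]" if "SQ 1 0 0 1" "s\<^sup>2 = \<i> * E2" "t\<^sup>2 = E3"
    using imaginary_root[OF s2 that(2)[unfolded mon_E(4)]] real_root[OF that(1) that(3)[unfolded mon_E(6)]]
      units_Kp_K FSU_root_E2_E3[OF _ _ _ _ lat] by blast
  show "FSU Kp [E1, E2, s]" if sq: "SQ 1 0 0 1" and "s\<^sup>2 = E3"
  proof -
    have "even a \<and> even b" if "SQ 1 a b c" for a b c
    proof -
      have "even b"
      proof (rule ccontr)
        assume "odd b"
        with SQ_mod_cases[OF that] par[OF that] have *: "SQ 1 0 1 (of_bool (odd c))" by simp
        have "SQ 1 0 1 0"
        proof (cases "odd c")
          case True
          \<comment> \<open>If \<open>E2 * E3\<close> and \<open>E3\<close> were both squares, so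
            would be \<open>E2\<close> times an even power of \<open>E3\<close>.\<close>
          hence "SQ 1 0 1 2" using SQ_mult[OF * sq] by simp
          thus ?thesis using SQ_mod[of 1 0 1 2] by simp
        qed (use * in simp)
        thus False using not_SQ_E2 by blast
      qed
      thus ?thesis using par[OF that] by simp
    qed
    from lattice_mono[OF lattice_Kp this] have "lattice Kp (\<lambda>a b c. even a \<and> even b)" .
    thus ?thesis using real_root[OF sq that(2)[unfolded mon_E(6)]] FSU_root_E3 by blast
  qed
  assume no: "\<not> SQ 1 0 0 1"
  have s3: "SQ 2 0 0 1" using SQ_E3[OF n(2)] no by blast
  \<comment> \<open>The two factors 2 combine to the square 4, which can be divided out.\<close>
  have "SQ 4 0 1 1" using SQ_mult[OF s2 s3] by simp
  hence s23: "SQ 1 0 1 1" by (rule SQ_4)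
  show "FSU K [E1, s, t]" if "s\<^sup>2 = E2 * E3" "t\<^sup>2 = \<i> * E3"
    using real_root[OF s23 that(1)[unfolded mon_E(2)]] imaginary_root[OF s3 that(2)[unfolded mon_E(5)]]
      units_Kp_K FSU_root_E23_E3[OF _ _ _ _ lat] by blast
  have "even a \<and> even b = even c" if "SQ 1 a b c" for a b c
    using SQ_mod_cases[OF that] par[OF that] no not_SQ_E2 by (cases "even b"; cases "even c") simp_all
  from lattice_mono[OF lattice_Kp this] have "lattice Kp (\<lambda>a b c. even a \<and> even b = even c)" .
  thus "FSU Kp [E1, E2, s]" if "s\<^sup>2 = E2 * E3"
    using real_root[OF s23 that[unfolded mon_E(2)]] FSU_root_E23 by blast
qed

end

section \<open>Rational norms, and the case of equal primes\<close>

lemma complex_of_real_of_rat: "complex_of_real (of_rat r) = of_rat r"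
  by (cases r) (simp add: of_rat_rat)

text \<open>Irrationality of the root makes the coordinates unique, so the definite description in
  \<open>quad_norm\<close> singles out one value.\<close>

lemma quad_norm_eq:
  assumes d: "squarefree d" "d > 1" and AB: "A \<in> \<rat>" "B \<in> \<rat>" "complex_of_real \<epsilon> = A + B * rt d"
  shows "of_rat (quad_norm (int d) \<epsilon>) = A\<^sup>2 - of_nat d * B\<^sup>2"
proof -
  obtain a b where ab: "A = of_rat a" "B = of_rat b" using AB(1,2) by (auto elim!: Rats_cases)
  have iff: "\<epsilon> = of_rat a' + of_rat b' * sqrt (real_of_int (int d)) \<longleftrightarrow> a' = a \<and> b' = b" for a' b'
  proof -
    have "\<epsilon> = of_rat a' + of_rat b' * sqrt (real_of_int (int d)) \<longleftrightarrow>
        complex_of_real \<epsilon> = complex_of_real (of_rat a' + of_rat b' * sqrt (real d))" by (simp only: of_real_eq_iff of_int_of_nat_eq)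
    also have "\<dots> \<longleftrightarrow> of_rat a + of_rat b * rt d = of_rat a' + of_rat b' * rt d" by (simp add: AB(3) ab complex_of_real_of_rat)
    also have "\<dots> \<longleftrightarrow> a' = a \<and> b' = b"
      using adj_coords_unique[OF subfield_C_Rats_complex rt_notin_Rats[OF d], of "of_rat a" "of_rat b" "of_rat a'" "of_rat b'"] by auto
    finally show ?thesis .
  qed
  have "quad_norm (int d) \<epsilon> = a\<^sup>2 - of_nat d * b\<^sup>2"
    unfolding quad_norm_def iff by simp
  thus ?thesis by (simp add: ab of_rat_diff of_rat_mult of_rat_power)
qed

text \<open>For equal primes the third quadratic field is generated by the square root of 2, whose
  fundamental unit has coefficient 1 at that root, so it cannot have the assumed integral form.\<close>

lemma fund_unit_equal_primes:
  assumes p: "p \<ge> 5" and e: "fund_unit (int (2 * p * p)) e"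
    and xy: "e = real_of_int x + real_of_int y * sqrt (real (2 * p * p))"
  shows False
proof -
  define L where "L = quad_field (int (2 * p * p))"
  define M where "M = adj \<rat> (rt 2)"
  have sf2: "squarefree (2::nat)" "(2::nat) > 1" by (auto simp: squarefree_prime)
  have notin: "rt 2 \<notin> \<rat>" by (rule rt_notin_Rats[OF sf2])
  have rr: "rt (2 * p * p) = of_nat p * rt 2"
  proof -
    have "sqrt (real (2 * p * p)) = real p * sqrt (real 2)" by (simp add: real_sqrt_mult)
    thus ?thesis by simp
  qed
  have aut: "field_aut M (qconj \<rat> (rt 2))"
    unfolding M_def by (rule field_aut_qconj[OF subfield_C_Rats_complex notin]) (simp only: rt_square Rats_of_nat)
  note M = field_aut_subfield[OF aut]
  have L: "subfield_C L" unfolding L_def quad_field_def by (rule subfield_C_field_gen)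
  have genL: "rt (2 * p * p) \<in> L" unfolding L_def quad_field_def field_gen_def by auto
  have "rt (2 * p * p) \<in> M"
    unfolding rr M_def using adjI[of 0 \<rat> "of_nat p" "rt 2"] by simp
  hence LM: "L \<subseteq> M" unfolding L_def quad_field_def field_gen_def using M by auto
  have "rt 2 = rt (2 * p * p) / of_nat p" unfolding rr using p by simp
  hence r2L: "rt 2 \<in> L" using genL subfield_C_divide[OF L _ subfield_C_of_nat[OF L]] by metis
  have ri: "algebraic_int (rt 2)" by (rule algebraic_int_sqrtD) (simp only: rt_square algebraic_int_of_nat)
  \<comment> \<open>This shows that 1 + sqrt 2 is a unit above 1, so it bounds the fundamental unit
    \<open>e\<close> from above.\<close>
  have "(1 + rt 2) * (rt 2 - 1) = 1" using rt_square[of 2] by (simp add: algebra_simps power2_eq_square)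
  hence inv: "inverse (1 + rt 2) = rt 2 - 1" by (rule inverse_unique)
  have nz: "1 + rt 2 \<noteq> 0" using \<open>(1 + rt 2) * (rt 2 - 1) = 1\<close> by auto
  have "1 + rt 2 \<in> units_of_field L"
    unfolding units_of_field_iff[OF L] inv using r2L nz ri L
    by (auto intro!: subfield_C_add subfield_C_1 algebraic_int_add algebraic_int_diff)
  hence "complex_of_real (1 + sqrt 2) \<in> units_of_field L" by simp
  moreover have "1 + sqrt 2 > (1 :: real)" by simp
  ultimately have le: "e \<le> 1 + sqrt 2" using e unfolding fund_unit_def L_def by blast
  have e1: "e > 1" and eU: "complex_of_real e \<in> units_of_field M"
    using e units_mono[OF L M LM] unfolding fund_unit_def L_def by auto
  have form: "complex_of_real e = of_int x + of_int (y * int p) * rt 2"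
  proof -
    have "complex_of_real e = of_int x + of_int y * rt (2 * p * p)" unfolding xy by simp
    thus ?thesis unfolding rr by simp
  qed
  have cj: "qconj \<rat> (rt 2) (of_real e) = of_int x - of_int (y * int p) * rt 2"
    unfolding form by (rule qconj_eq[OF subfield_C_Rats_complex notin]) auto
  define f where "f = real_of_int x - real_of_int (y * int p) * sqrt 2"
  have cf: "qconj \<rat> (rt 2) (of_real e) = of_real f" unfolding cj f_def by simp
  have ef: "e = real_of_int x + real_of_int (y * int p) * sqrt 2"
  proof -
    have "complex_of_real e = of_real (real_of_int x + real_of_int (y * int p) * sqrt 2)" unfolding form by simp
    thus ?thesis by (simp only: of_real_eq_iff)
  qed
  have "e * f = (of_int x)\<^sup>2 - 2 * (of_int (y * int p))\<^sup>2"
    unfolding ef f_def by (simp add: algebra_simps power2_eq_square)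
  hence "complex_of_real (e * f) = of_int (x\<^sup>2 - 2 * (y * int p)\<^sup>2)" by simp
  hence "complex_of_real (e * f) \<in> \<rat>" by (simp only: Rats_of_int)
  moreover have "complex_of_real (e * f) \<in> units_of_field M"
    using units_mult[OF M eU units_aut[OF aut eU]] unfolding cf by simp
  ultimately have "complex_of_real (e * f) = 1 \<or> complex_of_real (e * f) = -1" using units_Rats by blast
  hence "complex_of_real (e * f) = of_real 1 \<or> complex_of_real (e * f) = of_real (-1)" by simp
  hence "e * f = 1 \<or> e * f = -1" by (simp only: of_real_eq_iff)
  hence "\<bar>e * f\<bar> = 1" by auto
  hence ab1: "e * \<bar>f\<bar> = 1" using e1 by (simp add: abs_mult)
  hence "\<bar>f\<bar> = 1 / e" using e1 by (simp add: field_simps)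
  hence fl: "\<bar>f\<bar> < 1" using e1 by simp
  have s2: "sqrt 2 < (2::real)" "sqrt 2 > (1::real)" by (simp_all add: real_less_lsqrt)
  show False
  proof (cases "y = 0")
    case True
    hence "f = e" unfolding ef f_def by simp
    thus False using fl e1 by simp
  next
    case False
    hence "1 \<le> \<bar>y\<bar>" by simp
    \<comment> \<open>The conjugate \<open>f\<close> has absolute value below 1, so \<open>e\<close>
      and \<open>f\<close> differ by less than 2 + sqrt 2, whereas a nonzero \<open>y\<close> makes
      them differ by at least 10.\<close>
    hence "5 \<le> \<bar>y * int p\<bar>" using p mult_mono[of 1 "\<bar>y\<bar>" 5 "int p"] by (simp add: abs_mult)
    hence "5 \<le> \<bar>real_of_int (y * int p)\<bar>" by linarith
    hence "5 * 1 \<le> \<bar>real_of_int (y * int p)\<bar> * sqrt 2" using s2 by (intro mult_mono) auto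
    moreover have "2 * (\<bar>real_of_int (y * int p)\<bar> * sqrt 2) = \<bar>e - f\<bar>" unfolding ef f_def by (simp add: abs_mult)
    ultimately show False using fl le s2 e1 by linarith
  qed
qed

lemma fundamental_iff: "fund_unit d e \<longleftrightarrow> fundamental (quad_field d) e"
  by (simp add: fund_unit_def fundamental_def)

text \<open>The rational norm is identified with the product of the unit and its conjugate under
  \<open>tau\<close> or \<open>sig\<close>.\<close>

lemma (in biquad) biquad_unitsI:
  assumes f: "fund_unit (int p) e1" "fund_unit (int (2 * q)) e2" "fund_unit (int (p * (2 * q))) e3"
    and n: "quad_norm (int (2 * q)) e2 = of_int n2" "quad_norm (int (p * (2 * q))) e3 = of_int n3"
    and pm: "n2 = 1 \<or> n2 = -1" "n3 = 1 \<or> n3 = -1"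
  shows "biquad_units p q e1 e2 e3 n2 n3"
proof (unfold_locales)
  show f': "fundamental k1 e1" "fundamental k2 e2" "fundamental k3 e3"
    using f unfolding fundamental_iff quad_fields by auto
  show "n2 = 1 \<or> n2 = -1" "n3 = 1 \<or> n3 = -1" by fact+
  obtain a b where ab: "a \<in> \<rat>" "b \<in> \<rat>" "complex_of_real e2 = a + b * S"
    using f'(2) units_in unfolding fundamental_def k2_def by (metis adjE)
  have t: "tau (of_real e2) = a - b * S" using sig_coords(2)[of a 0 b 0] ab by simp
  have "of_real e2 * tau (of_real e2) = a\<^sup>2 - b\<^sup>2 * S\<^sup>2" unfolding t unfolding ab(3) by (simp add: algebra_simps power2_eq_square)
  also have "\<dots> = a\<^sup>2 - of_nat (2 * q) * b\<^sup>2" unfolding S2 by simp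
  also have "\<dots> = of_rat (quad_norm (int (2 * q)) e2)"
    using quad_norm_eq[OF sf_2q gt1(2) ab(1,2) ab(3)[unfolded S_def]] by simp
  finally show "of_real e2 * tau (of_real e2) = of_int n2" unfolding n by simp
  obtain c d where cd: "c \<in> \<rat>" "d \<in> \<rat>" "complex_of_real e3 = c + d * (R * S)"
    using f'(3) units_in unfolding fundamental_def k3_def by (metis adjE)
  have u: "sig (of_real e3) = c - d * (R * S)" using sig_coords(1)[of c 0 0 d] cd by simp
  have "of_real e3 * sig (of_real e3) = c\<^sup>2 - d\<^sup>2 * (R * S)\<^sup>2" unfolding u unfolding cd(3) by (simp add: algebra_simps power2_eq_square)
  also have "\<dots> = c\<^sup>2 - of_nat (p * (2 * q)) * d\<^sup>2" unfolding RS_eq rt_square by simp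
  also have "\<dots> = of_rat (quad_norm (int (p * (2 * q))) e3)"
    using quad_norm_eq[OF sf_2pq gt1(3) cd(1,2) cd(3)[unfolded RS_eq]] by simp
  finally show "of_real e3 * sig (of_real e3) = of_int n3" unfolding n by simp
qed

section \<open>The classification by the norms of the second and third fundamental unit\<close>

theorem theorem1:
  fixes p1 p2 :: nat and e1 e2 e3 :: real and x y :: int
  defines "Kp \<equiv> field_gen {complex_of_real (sqrt (real p1)), complex_of_real (sqrt (real (2 * p2)))}"
      and "K \<equiv> field_gen {complex_of_real (sqrt (real p1)), complex_of_real (sqrt (real (2 * p2))), \<i>}"
      and "E1 \<equiv> complex_of_real e1" and "E2 \<equiv> complex_of_real e2" and "E3 \<equiv> complex_of_real e3"
  assumes "prime p1" and "prime p2" and "p1 mod 4 = 1" and "p2 mod 4 = 1"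
      and "fund_unit (int p1) e1" and "fund_unit (int (2 * p2)) e2"
      and "fund_unit (int (2 * p1 * p2)) e3"
      and "e3 = real_of_int x + real_of_int y * sqrt (real (2 * p1 * p2))"
  shows
   "(quad_norm (int (2 * p2)) e2 = -1 \<and> quad_norm (int (2 * p1 * p2)) e3 = -1 \<longrightarrow>
       ((\<exists>s\<in>Kp. s^2 = E1 * E2 * E3) \<longrightarrow>
          (\<forall>s. s^2 = E1 * E2 * E3 \<longrightarrow> FSU Kp [E1, E2, s] \<and> FSU K [E1, E2, s])
          \<and> hasse_unit_index K Kp = 1)
     \<and> (\<not> (\<exists>s\<in>Kp. s^2 = E1 * E2 * E3) \<longrightarrow>
          FSU Kp [E1, E2, E3]
          \<and> (\<forall>s. s^2 = \<i> * E1 * E2 * E3 \<longrightarrow> FSU K [E1, E2, s])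
          \<and> hasse_unit_index K Kp = 2))
  \<and> (quad_norm (int (2 * p2)) e2 = 1 \<and> quad_norm (int (2 * p1 * p2)) e3 = -1 \<longrightarrow>
       FSU Kp [E1, E2, E3]
       \<and> (\<forall>s. s^2 = \<i> * E2 \<longrightarrow> FSU K [E1, s, E3])
       \<and> hasse_unit_index K Kp = 2)
  \<and> (quad_norm (int (2 * p1 * p2)) e3 = 1 \<and> quad_norm (int (2 * p2)) e2 = -1 \<longrightarrow>
       ((\<exists>n::nat. 2 * int p1 * (x + 1) = int (n^2) \<or> 2 * int p1 * (x - 1) = int (n^2)) \<longrightarrow>
          (\<forall>s. s^2 = E3 \<longrightarrow> FSU Kp [E1, E2, s] \<and> FSU K [E1, E2, s])
          \<and> hasse_unit_index K Kp = 1)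
     \<and> (\<not> (\<exists>n::nat. 2 * int p1 * (x + 1) = int (n^2) \<or> 2 * int p1 * (x - 1) = int (n^2)) \<longrightarrow>
          FSU Kp [E1, E2, E3]
          \<and> (\<forall>s. s^2 = \<i> * E3 \<longrightarrow> FSU K [E1, E2, s])
          \<and> hasse_unit_index K Kp = 2))
  \<and> (quad_norm (int (2 * p2)) e2 = 1 \<and> quad_norm (int (2 * p1 * p2)) e3 = 1 \<longrightarrow>
       ((\<exists>n::nat. 2 * int p1 * (x + 1) = int (n^2) \<or> 2 * int p1 * (x - 1) = int (n^2)) \<longrightarrow>
          (\<forall>s. s^2 = E3 \<longrightarrow> FSU Kp [E1, E2, s])
          \<and> (\<forall>s t. s^2 = \<i> * E2 \<longrightarrow> t^2 = E3 \<longrightarrow> FSU K [E1, s, t])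
          \<and> hasse_unit_index K Kp = 2)
     \<and> (\<not> (\<exists>n::nat. 2 * int p1 * (x + 1) = int (n^2) \<or> 2 * int p1 * (x - 1) = int (n^2)) \<longrightarrow>
          (\<forall>s. s^2 = E2 * E3 \<longrightarrow> FSU Kp [E1, E2, s])
          \<and> (\<forall>s t. s^2 = E2 * E3 \<longrightarrow> t^2 = \<i> * E3 \<longrightarrow> FSU K [E1, s, t])
          \<and> hasse_unit_index K Kp = 2))"
proof -
  have p5: "p1 \<ge> 5"
  proof (rule ccontr)
    assume "\<not> p1 \<ge> 5"
    hence "p1 \<in> {0, 1, 2, 3, 4}" by auto
    thus False using assms(6,8) by (auto simp: prime_nat_iff)
  qed
  \<comment> \<open>Distinctness is a consequence of the integral coefficients \<open>x\<close> and
    \<open>y\<close> of \<open>e3\<close>.\<close>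
  have ne: "p1 \<noteq> p2"
    using fund_unit_equal_primes[OF p5] assms(12,13) by blast
  interpret biquad p1 p2 by unfold_locales (use assms(6-9) ne in auto)
  have Kp: "Kp = biquad.Kp p1 p2" unfolding assms(1) Kp_eq[symmetric] R_def S_def ..
  have K: "K = biquad.K p1 p2" unfolding assms(2) K_eq[symmetric] R_def S_def ..
  have comm: "2 * p1 * p2 = p1 * (2 * p2)" by simp
  have bu: "biquad_units p1 p2 e1 e2 e3 n2 n3"
    if "quad_norm (int (2 * p2)) e2 = of_int n2" "quad_norm (int (2 * p1 * p2)) e3 = of_int n3"
      "n2 = 1 \<or> n2 = -1" "n3 = 1 \<or> n3 = -1" for n2 n3
    using biquad_unitsI[OF assms(10,11) assms(12)[unfolded comm] that(1) that(2)[unfolded comm] that(3,4)] .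
  note xy = assms(13)[unfolded comm]
  have c1: "quad_norm (int (2 * p2)) e2 = -1 \<and> quad_norm (int (2 * p1 * p2)) e3 = -1 \<longrightarrow>
       ((\<exists>s\<in>Kp. s^2 = E1 * E2 * E3) \<longrightarrow>
          (\<forall>s. s^2 = E1 * E2 * E3 \<longrightarrow> FSU Kp [E1, E2, s] \<and> FSU K [E1, E2, s])
          \<and> hasse_unit_index K Kp = 1)
     \<and> (\<not> (\<exists>s\<in>Kp. s^2 = E1 * E2 * E3) \<longrightarrow>
          FSU Kp [E1, E2, E3]
          \<and> (\<forall>s. s^2 = \<i> * E1 * E2 * E3 \<longrightarrow> FSU K [E1, E2, s])
          \<and> hasse_unit_index K Kp = 2)"
  proof
    assume n: "quad_norm (int (2 * p2)) e2 = -1 \<and> quad_norm (int (2 * p1 * p2)) e3 = -1"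
    \<comment> \<open>The prescribed norms fix both sign parameters, so each case is its own
      instance of the setting.\<close>
    interpret biquad_units p1 p2 e1 e2 e3 "-1" "-1" by (rule bu) (use n in simp_all)
    note E = E1_def[symmetric] E2_def[symmetric] E3_def[symmetric]
    show "((\<exists>s\<in>Kp. s^2 = E1 * E2 * E3) \<longrightarrow>
          (\<forall>s. s^2 = E1 * E2 * E3 \<longrightarrow> FSU Kp [E1, E2, s] \<and> FSU K [E1, E2, s])
          \<and> hasse_unit_index K Kp = 1)
     \<and> (\<not> (\<exists>s\<in>Kp. s^2 = E1 * E2 * E3) \<longrightarrow>
          FSU Kp [E1, E2, E3]
          \<and> (\<forall>s. s^2 = \<i> * E1 * E2 * E3 \<longrightarrow> FSU K [E1, E2, s])
          \<and> hasse_unit_index K Kp = 2)"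
      unfolding Kp K assms(3-5) E square_E123_iff
      using case_neg_neg[OF refl refl] by blast
  qed
  have c2: "quad_norm (int (2 * p2)) e2 = 1 \<and> quad_norm (int (2 * p1 * p2)) e3 = -1 \<longrightarrow>
       FSU Kp [E1, E2, E3]
       \<and> (\<forall>s. s^2 = \<i> * E2 \<longrightarrow> FSU K [E1, s, E3])
       \<and> hasse_unit_index K Kp = 2"
  proof
    assume n: "quad_norm (int (2 * p2)) e2 = 1 \<and> quad_norm (int (2 * p1 * p2)) e3 = -1"
    interpret biquad_units p1 p2 e1 e2 e3 "1" "-1" by (rule bu) (use n in simp_all)
    note E = E1_def[symmetric] E2_def[symmetric] E3_def[symmetric]
    show "FSU Kp [E1, E2, E3]
       \<and> (\<forall>s. s^2 = \<i> * E2 \<longrightarrow> FSU K [E1, s, E3])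
       \<and> hasse_unit_index K Kp = 2"
      unfolding Kp K assms(3-5) E
      using case_pos_neg[OF refl refl] by blast
  qed
  have c3: "quad_norm (int (2 * p1 * p2)) e3 = 1 \<and> quad_norm (int (2 * p2)) e2 = -1 \<longrightarrow>
       ((\<exists>n::nat. 2 * int p1 * (x + 1) = int (n^2) \<or> 2 * int p1 * (x - 1) = int (n^2)) \<longrightarrow>
          (\<forall>s. s^2 = E3 \<longrightarrow> FSU Kp [E1, E2, s] \<and> FSU K [E1, E2, s])
          \<and> hasse_unit_index K Kp = 1)
     \<and> (\<not> (\<exists>n::nat. 2 * int p1 * (x + 1) = int (n^2) \<or> 2 * int p1 * (x - 1) = int (n^2)) \<longrightarrow>
          FSU Kp [E1, E2, E3]
          \<and> (\<forall>s. s^2 = \<i> * E3 \<longrightarrow> FSU K [E1, E2, s])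
          \<and> hasse_unit_index K Kp = 2)"
  proof
    assume n: "quad_norm (int (2 * p1 * p2)) e3 = 1 \<and> quad_norm (int (2 * p2)) e2 = -1"
    interpret biquad_units p1 p2 e1 e2 e3 "-1" "1" by (rule bu) (use n in simp_all)
    note E = E1_def[symmetric] E2_def[symmetric] E3_def[symmetric]
    show "((\<exists>n::nat. 2 * int p1 * (x + 1) = int (n^2) \<or> 2 * int p1 * (x - 1) = int (n^2)) \<longrightarrow>
          (\<forall>s. s^2 = E3 \<longrightarrow> FSU Kp [E1, E2, s] \<and> FSU K [E1, E2, s])
          \<and> hasse_unit_index K Kp = 1)
     \<and> (\<not> (\<exists>n::nat. 2 * int p1 * (x + 1) = int (n^2) \<or> 2 * int p1 * (x - 1) = int (n^2)) \<longrightarrow>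
          FSU Kp [E1, E2, E3]
          \<and> (\<forall>s. s^2 = \<i> * E3 \<longrightarrow> FSU K [E1, E2, s])
          \<and> hasse_unit_index K Kp = 2)"
      \<comment> \<open>The condition on 2 p1 (x + 1) and 2 p1 (x - 1) is replaced by the statement
        that the third unit is a square in the real field.\<close>
      unfolding Kp K assms(3-5) E SQ_E3_iff[OF refl xy, symmetric]
      using case_neg_pos[OF refl refl] by blast
  qed
  have c4: "quad_norm (int (2 * p2)) e2 = 1 \<and> quad_norm (int (2 * p1 * p2)) e3 = 1 \<longrightarrow>
       ((\<exists>n::nat. 2 * int p1 * (x + 1) = int (n^2) \<or> 2 * int p1 * (x - 1) = int (n^2)) \<longrightarrow>
          (\<forall>s. s^2 = E3 \<longrightarrow> FSU Kp [E1, E2, s])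
          \<and> (\<forall>s t. s^2 = \<i> * E2 \<longrightarrow> t^2 = E3 \<longrightarrow> FSU K [E1, s, t])
          \<and> hasse_unit_index K Kp = 2)
     \<and> (\<not> (\<exists>n::nat. 2 * int p1 * (x + 1) = int (n^2) \<or> 2 * int p1 * (x - 1) = int (n^2)) \<longrightarrow>
          (\<forall>s. s^2 = E2 * E3 \<longrightarrow> FSU Kp [E1, E2, s])
          \<and> (\<forall>s t. s^2 = E2 * E3 \<longrightarrow> t^2 = \<i> * E3 \<longrightarrow> FSU K [E1, s, t])
          \<and> hasse_unit_index K Kp = 2)"
  proof
    assume n: "quad_norm (int (2 * p2)) e2 = 1 \<and> quad_norm (int (2 * p1 * p2)) e3 = 1"
    interpret biquad_units p1 p2 e1 e2 e3 "1" "1" by (rule bu) (use n in simp_all)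
    note E = E1_def[symmetric] E2_def[symmetric] E3_def[symmetric]
    show "((\<exists>n::nat. 2 * int p1 * (x + 1) = int (n^2) \<or> 2 * int p1 * (x - 1) = int (n^2)) \<longrightarrow>
          (\<forall>s. s^2 = E3 \<longrightarrow> FSU Kp [E1, E2, s])
          \<and> (\<forall>s t. s^2 = \<i> * E2 \<longrightarrow> t^2 = E3 \<longrightarrow> FSU K [E1, s, t])
          \<and> hasse_unit_index K Kp = 2)
     \<and> (\<not> (\<exists>n::nat. 2 * int p1 * (x + 1) = int (n^2) \<or> 2 * int p1 * (x - 1) = int (n^2)) \<longrightarrow>
          (\<forall>s. s^2 = E2 * E3 \<longrightarrow> FSU Kp [E1, E2, s])
          \<and> (\<forall>s t. s^2 = E2 * E3 \<longrightarrow> t^2 = \<i> * E3 \<longrightarrow> FSU K [E1, s, t])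
          \<and> hasse_unit_index K Kp = 2)"
      unfolding Kp K assms(3-5) E SQ_E3_iff[OF refl xy, symmetric]
      using case_pos_pos[OF refl refl] by blast
  qed
  show ?thesis by (intro conjI c1 c2 c3 c4)
qed

end
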